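(* Let $p$ be an odd prime and let $S\in\gimel_p$ be in case $\kappa_6$. Then $\mathrm{Aut}(S)'\simeq\mathbb{Z}/p\mathbb{Z}$.
   Context: $p$ is an odd prime and $\Delta=\{z\in\mathbb{C}:|z|<1\}$. $\gimel_p$ is the set of compact Riemann surfaces $S$ having an automorphism $T_S$ of order $p$ with $S/\langle T_S\rangle\simeq\mathbb{P}^1$ and $|\mathrm{Fix}(T_S)|=4$ (genus $p-1$). $\mathrm{Aut}(S)'=\{f\in\mathrm{Aut}(S): f(\mathrm{Fix}(T_S))=\mathrm{Fix}(T_S)\}$. For $S\in\gimel_p$ there is a Fuchsian group $\Gamma$ of signature $(0;p,p,p,p)$ and a normal subgroup $\Gamma^*$ acting freely on $\Delta$ with $\Delta/\Gamma^*\simeq S$ and $\Gamma/\Gamma^*\simeq\mathbb{Z}/p\mathbb{Z}$ corresponding to $\langle T_S\rangle$. Tilings. For $\alpha,\beta,\gamma>0$ with $\alpha+\beta+\gamma=2\pi/p$, $\Delta(\alpha,\beta,\gamma)$ denotes the tiling of $\Delta$ by copies of a hyperbolic triangle with interior angles $\alpha,\beta,\gamma$ in counterclockwise order, obtained by repeatedly applying half-turns about midpoints of edges; cyclic permutations of the triple give the same tiling. It is a tiling for $\Gamma$ if $\Gamma$ is generated by the rotations through $2\pi/p$ about the vertices of a tile. The canonical tiling of $S$ is the tiling for $\Gamma$ with $0<\alpha\le\pi/p$, $0<\beta,\gamma<\pi/p$ (written $\Delta(\pi/p,\beta,\gamma)$ with $\beta\ge\gamma$ if an angle equals $\pi/p$).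 The pair $(i,j)$. Choose a tile of the canonical tiling with vertices $A',B',C'$ in counterclockwise order with angles $\alpha,\beta,\gamma$, and let $x,y,z\in\Gamma$ be the counterclockwise rotations through $2\pi/p$ about $A',B',C'$. Then $y\equiv x^i$, $z\equiv x^j$ modulo $\Gamma^*$ with $i,j\in\{1,\dots,p-1\}$, $p\nmid i+j+1$. With $k=-(i+j+1)$ in $\mathbb{Z}/p\mathbb{Z}$, let ${}^{e}\Lambda^p_{(i,j)}=\{(i,j),(j,k),(k,i),(i^{-1}j,i^{-1}),(i^{-1},i^{-1}k),(i^{-1}k,i^{-1}j),(j^{-1},ij^{-1}),(ij^{-1},j^{-1}k),(j^{-1}k,j^{-1}),(jk^{-1},ik^{-1}),(ik^{-1},k^{-1}),(k^{-1},jk^{-1})\}$. Cases (all pairs are modulo $p$, and all pairs $(a,b)$ considered satisfy $a,b,a+b+1\not\equiv 0\pmod p$). $S$ is in: $\kappa_1$ if ${}^{e}\Lambda^p_{(i,j)}$ contains $(1,1)$; $\kappa_2$ if it contains $(1,m)$ or $(m,1)$ with $m\in\{2,\dots,p-4\}$, or $(m,m)$ with $m\in\{2,\dots,p-2\}$, $m\neq(p-3)^{-1}$; $\kappa_3$ if it contains $(-1,-1)$; $\kappa_4$ if it contains $(-1,m)$ with $m\in\{2,\dots,p-2\}$ and $p\nmid m^2+1$; $\kappa_5$ if it contains $(-1,m)$ with $m^2\equiv-1\pmod p$; and $\kappa_6$ if $S$ is in none of $\kappa_1,\dots,\kappa_5$. *)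

theory Defs
  imports
    "HOL-Complex_Analysis.Complex_Analysis"
    "HOL-Algebra.Bij"
    "HOL-Algebra.Elementary_Groups"
    "HOL-Algebra.Multiplicative_Group"
    "HOL-Number_Theory.Modular_Inverse"
begin

section \<open>Riemann surfaces\<close>

record 'a rsurface =
  rs_top :: "'a topology"
  rs_charts :: "('a set \<times> ('a \<Rightarrow> complex)) set"

abbreviation points :: "'a rsurface \<Rightarrow> 'a set" where
  "points S \<equiv> topspace (rs_top S)"

definition riemann_surface :: "'a rsurface \<Rightarrow> bool" where
  "riemann_surface S \<longleftrightarrow>
     points S \<noteq> {} \<and> connected_space (rs_top S) \<and> Hausdorff_space (rs_top S) \<and>
     (\<Union>(U, \<phi>)\<in>rs_charts S. U) = points S \<and>
     (\<forall>(U, \<phi>)\<in>rs_charts S. openin (rs_top S) U \<and> open (\<phi> ` U) \<and>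
        homeomorphic_map (subtopology (rs_top S) U) (top_of_set (\<phi> ` U)) \<phi>) \<and>
     (\<forall>(U, \<phi>)\<in>rs_charts S. \<forall>(V, \<psi>)\<in>rs_charts S.
        (\<psi> \<circ> inv_into U \<phi>) holomorphic_on (\<phi> ` (U \<inter> V)))"

definition holomorphic_map :: "'a rsurface \<Rightarrow> 'b rsurface \<Rightarrow> ('a \<Rightarrow> 'b) \<Rightarrow> bool" where
  "holomorphic_map S R f \<longleftrightarrow>
     continuous_map (rs_top S) (rs_top R) f \<and>
     (\<forall>(U, \<phi>)\<in>rs_charts S. \<forall>(V, \<psi>)\<in>rs_charts R.
        (\<psi> \<circ> f \<circ> inv_into U \<phi>) holomorphic_on (\<phi> ` {x \<in> U. f x \<in> V}))"

definition biholomorphic_map :: "'a rsurface \<Rightarrow> 'b rsurface \<Rightarrow> ('a \<Rightarrow> 'b) \<Rightarrow> bool" where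
  "biholomorphic_map S R f \<longleftrightarrow>
     bij_betw f (points S) (points R) \<and> holomorphic_map S R f \<and>
     holomorphic_map R S (inv_into (points S) f)"

definition biholomorphic_surfaces :: "'a rsurface \<Rightarrow> 'b rsurface \<Rightarrow> bool" where
  "biholomorphic_surfaces S R \<longleftrightarrow> (\<exists>f. biholomorphic_map S R f)"

text \<open>The projective line over the complex numbers, with \<open>None\<close> as the point at infinity.\<close>

definition riemann_sphere :: "complex option rsurface" where
  "riemann_sphere =
     \<lparr>rs_top = Alexandroff_compactification euclidean,
      rs_charts = {(range Some, the),
                   (UNIV - {Some 0}, \<lambda>x. case x of None \<Rightarrow> 0 | Some z \<Rightarrow> inverse z)}\<rparr>"

definition unit_disc :: "complex rsurface" where
  "unit_disc = \<lparr>rs_top = top_of_set (ball 0 1), rs_charts = {(ball 0 1, \<lambda>z. z)}\<rparr>"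

section \<open>Automorphisms and quotients\<close>

definition Aut :: "'a rsurface \<Rightarrow> ('a \<Rightarrow> 'a) monoid" where
  "Aut S = (BijGroup (points S))\<lparr>carrier := {f \<in> Bij (points S). biholomorphic_map S S f}\<rparr>"

definition Fix :: "'a rsurface \<Rightarrow> ('a \<Rightarrow> 'a) \<Rightarrow> 'a set" where
  "Fix S f = {x \<in> points S. f x = x}"

definition Aut_Fix :: "'a rsurface \<Rightarrow> ('a \<Rightarrow> 'a) \<Rightarrow> ('a \<Rightarrow> 'a) monoid" where
  "Aut_Fix S T = (Aut S)\<lparr>carrier := {f \<in> carrier (Aut S). f ` Fix S T = Fix S T}\<rparr>"

definition orbit_map :: "('a \<Rightarrow> 'a) set \<Rightarrow> 'a \<Rightarrow> 'a set" where
  "orbit_map G x = (\<lambda>g. g x) ` G"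

text \<open>
  \<open>Q\<close> is the orbit space with the quotient topology and the complex structure for which the
  projection is holomorphic; this determines \<open>Q\<close> up to the choice of an atlas for that structure.
\<close>

definition quotient_surface ::
    "'a rsurface \<Rightarrow> ('a \<Rightarrow> 'a) set \<Rightarrow> 'a set rsurface \<Rightarrow> bool" where
  "quotient_surface S G Q \<longleftrightarrow>
     riemann_surface Q \<and> quotient_map (rs_top S) (rs_top Q) (orbit_map G) \<and>
     holomorphic_map S Q (orbit_map G)"

text \<open>\<open>S\<close> belongs to the family of surfaces under study, with \<open>T\<close> in the role of \<open>T\<^sub>S\<close>.\<close>

definition gimel :: "nat \<Rightarrow> 'a rsurface \<Rightarrow> ('a \<Rightarrow> 'a) \<Rightarrow> bool" where
  "gimel p S T \<longleftrightarrow>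
     riemann_surface S \<and> compact_space (rs_top S) \<and>
     T \<in> carrier (Aut S) \<and> group.ord (Aut S) T = p \<and>
     (\<exists>Q. quotient_surface S (generate (Aut S) {T}) Q \<and>
          biholomorphic_surfaces Q riemann_sphere) \<and>
     card (Fix S T) = 4"

section \<open>Fuchsian groups\<close>

text \<open>Discreteness is with respect to the compact-open topology: the identity is isolated.\<close>

definition fuchsian_group :: "(complex \<Rightarrow> complex) set \<Rightarrow> bool" where
  "fuchsian_group \<Gamma> \<longleftrightarrow>
     subgroup \<Gamma> (Aut unit_disc) \<and>
     (\<exists>K \<epsilon>. compact K \<and> K \<subseteq> ball 0 1 \<and> \<epsilon> > 0 \<and>
        (\<forall>\<gamma>\<in>\<Gamma>. (\<forall>z\<in>K. dist (\<gamma> z) z < \<epsilon>) \<longrightarrow> \<gamma> = \<one>\<^bsub>Aut unit_disc\<^esub>))"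

definition stabiliser :: "(complex \<Rightarrow> complex) set \<Rightarrow> complex \<Rightarrow> (complex \<Rightarrow> complex) set" where
  "stabiliser \<Gamma> z = {\<gamma> \<in> \<Gamma>. \<gamma> z = z}"

text \<open>Signature \<open>(0; p, p, p, p)\<close>: the orbit space is a topological sphere, and exactly four
  orbits have nontrivial stabilisers, all of order \<open>p\<close>.\<close>

definition signature_0_pppp :: "nat \<Rightarrow> (complex \<Rightarrow> complex) set \<Rightarrow> bool" where
  "signature_0_pppp p \<Gamma> \<longleftrightarrow>
     (\<exists>Q. quotient_surface unit_disc \<Gamma> Q \<and>
          rs_top Q homeomorphic_space rs_top riemann_sphere) \<and>
     (\<forall>z\<in>ball 0 1. stabiliser \<Gamma> z \<noteq> {\<one>\<^bsub>Aut unit_disc\<^esub>} \<longrightarrow> card (stabiliser \<Gamma> z) = p) \<and>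
     card (orbit_map \<Gamma> ` {z \<in> ball 0 1. stabiliser \<Gamma> z \<noteq> {\<one>\<^bsub>Aut unit_disc\<^esub>}}) = 4"

definition acts_freely :: "(complex \<Rightarrow> complex) set \<Rightarrow> bool" where
  "acts_freely \<Gamma> \<longleftrightarrow> (\<forall>\<gamma>\<in>\<Gamma>. \<forall>z\<in>ball 0 1. \<gamma> z = z \<longrightarrow> \<gamma> = \<one>\<^bsub>Aut unit_disc\<^esub>)"

text \<open>
  \<open>\<Gamma>'\<close> is the group written \<open>\<Gamma>\<^sup>*\<close> in the mathematics, and \<open>h\<close> is the isomorphism from the
  quotient of the disc by \<open>\<Gamma>'\<close> to \<open>S\<close>.  The last two clauses say that the action of \<open>\<Gamma> / \<Gamma>'\<close> on
  that quotient is carried by \<open>h\<close> onto the action of the group generated by \<open>T\<close>.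
\<close>

definition fuchsian_model ::
    "nat \<Rightarrow> 'a rsurface \<Rightarrow> ('a \<Rightarrow> 'a) \<Rightarrow> (complex \<Rightarrow> complex) set \<Rightarrow> (complex \<Rightarrow> complex) set \<Rightarrow> bool"
  where
  "fuchsian_model p S T \<Gamma> \<Gamma>' \<longleftrightarrow>
     fuchsian_group \<Gamma> \<and> signature_0_pppp p \<Gamma> \<and>
     \<Gamma>' \<lhd> (Aut unit_disc)\<lparr>carrier := \<Gamma>\<rparr> \<and> acts_freely \<Gamma>' \<and>
     (Aut unit_disc)\<lparr>carrier := \<Gamma>\<rparr> Mod \<Gamma>' \<cong> integer_mod_group p \<and>
     (\<exists>Q h. quotient_surface unit_disc \<Gamma>' Q \<and> biholomorphic_map Q S h \<and>
        (\<forall>\<gamma>\<in>\<Gamma>. \<exists>t\<in>generate (Aut S) {T}.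
           \<forall>z\<in>ball 0 1. h (orbit_map \<Gamma>' (\<gamma> z)) = t (h (orbit_map \<Gamma>' z))) \<and>
        (\<forall>t\<in>generate (Aut S) {T}. \<exists>\<gamma>\<in>\<Gamma>.
           \<forall>z\<in>ball 0 1. h (orbit_map \<Gamma>' (\<gamma> z)) = t (h (orbit_map \<Gamma>' z))))"

section \<open>Hyperbolic triangles and tilings of the disc\<close>

definition hyp_dist :: "complex \<Rightarrow> complex \<Rightarrow> real" where
  "hyp_dist z w = 2 * artanh (cmod (Moebius_function 0 z w))"

definition hyp_midpoint :: "complex \<Rightarrow> complex \<Rightarrow> complex" where
  "hyp_midpoint a b =
     (THE m. m \<in> ball 0 1 \<and> hyp_dist a m = hyp_dist a b / 2 \<and> hyp_dist m b = hyp_dist a b / 2)"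

text \<open>
  The map \<open>Moebius_function 0 a\<close> is an automorphism of the disc sending \<open>a\<close> to \<open>0\<close>, with inverse
  \<open>Moebius_function 0 (-a)\<close>; the counterclockwise rotation through \<open>\<theta>\<close> about \<open>a\<close> is the conjugate
  by it of the Euclidean rotation through \<open>\<theta>\<close> about \<open>0\<close>.
\<close>

definition hyp_rotation :: "complex \<Rightarrow> real \<Rightarrow> complex \<Rightarrow> complex" where
  "hyp_rotation a \<theta> =
     (\<lambda>z\<in>ball 0 1. Moebius_function 0 (- a) (cis \<theta> * Moebius_function 0 a z))"

definition half_turn :: "complex \<Rightarrow> complex \<Rightarrow> complex" where
  "half_turn m = hyp_rotation m pi"

text \<open>
  The signed angle at \<open>a\<close> from the geodesic ray towards \<open>b\<close> to the one towards \<open>c\<close>: the map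
  \<open>Moebius_function 0 a\<close> is conformal and takes these rays to radii of the disc.
\<close>

definition hyp_angle :: "complex \<Rightarrow> complex \<Rightarrow> complex \<Rightarrow> real" where
  "hyp_angle a b c = Arg (Moebius_function 0 a c / Moebius_function 0 a b)"

text \<open>
  A triangle is given by its vertices, in counterclockwise order.  As \<open>Arg\<close> has values in
  \<open>(-\<pi>, \<pi>]\<close>, angles strictly between \<open>0\<close> and \<open>\<pi>\<close> force the triangle to be nondegenerate and
  positively oriented.
\<close>

definition triangle_with_angles ::
    "real \<Rightarrow> real \<Rightarrow> real \<Rightarrow> complex \<times> complex \<times> complex \<Rightarrow> bool" where
  "triangle_with_angles \<alpha> \<beta> \<gamma> = (\<lambda>(a, b, c).
     a \<in> ball 0 1 \<and> b \<in> ball 0 1 \<and> c \<in> ball 0 1 \<and>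
     \<alpha> \<in> {0<..<pi} \<and> \<beta> \<in> {0<..<pi} \<and> \<gamma> \<in> {0<..<pi} \<and>
     hyp_angle a b c = \<alpha> \<and> hyp_angle b c a = \<beta> \<and> hyp_angle c a b = \<gamma>)"

text \<open>
  All images of a triangle under repeated half-turns about midpoints of edges.  A half-turn
  preserves angles and orientation, so every tile is again listed with the angles of the initial
  triangle in the initial order.
\<close>

inductive_set tiles :: "complex \<times> complex \<times> complex \<Rightarrow> (complex \<times> complex \<times> complex) set"
  for t :: "complex \<times> complex \<times> complex" where
  initial: "t \<in> tiles t"
| turn: "(a, b, c) \<in> tiles t \<Longrightarrow>
     m \<in> {hyp_midpoint a b, hyp_midpoint b c, hyp_midpoint c a} \<Longrightarrow>
     (half_turn m a, half_turn m b, half_turn m c) \<in> tiles t"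

text \<open>\<open>\<T>\<close> is a tiling of type \<open>\<Delta>(\<alpha>, \<beta>, \<gamma>)\<close>.\<close>

definition tiling ::
    "nat \<Rightarrow> real \<Rightarrow> real \<Rightarrow> real \<Rightarrow> (complex \<times> complex \<times> complex) set \<Rightarrow> bool" where
  "tiling p \<alpha> \<beta> \<gamma> \<T> \<longleftrightarrow>
     \<alpha> > 0 \<and> \<beta> > 0 \<and> \<gamma> > 0 \<and> \<alpha> + \<beta> + \<gamma> = 2 * pi / real p \<and>
     (\<exists>t. triangle_with_angles \<alpha> \<beta> \<gamma> t \<and> \<T> = tiles t)"

definition tiling_for ::
    "nat \<Rightarrow> (complex \<Rightarrow> complex) set \<Rightarrow> (complex \<times> complex \<times> complex) set \<Rightarrow> bool" where
  "tiling_for p \<Gamma> \<T> \<longleftrightarrow>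
     (\<exists>(a, b, c)\<in>\<T>. \<Gamma> = generate (Aut unit_disc)
        {hyp_rotation a (2 * pi / real p), hyp_rotation b (2 * pi / real p),
         hyp_rotation c (2 * pi / real p)})"

definition canonical_tiling ::
    "nat \<Rightarrow> (complex \<Rightarrow> complex) set \<Rightarrow> real \<Rightarrow> real \<Rightarrow> real \<Rightarrow>
     (complex \<times> complex \<times> complex) set \<Rightarrow> bool" where
  "canonical_tiling p \<Gamma> \<alpha> \<beta> \<gamma> \<T> \<longleftrightarrow>
     tiling p \<alpha> \<beta> \<gamma> \<T> \<and> tiling_for p \<Gamma> \<T> \<and>
     \<alpha> \<le> pi / real p \<and> \<beta> < pi / real p \<and> \<gamma> < pi / real p \<and>
     (\<alpha> = pi / real p \<longrightarrow> \<beta> \<ge> \<gamma>)"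

section \<open>The pair \<open>(i, j)\<close> and the cases\<close>

definition pair_of_tile ::
    "nat \<Rightarrow> (complex \<Rightarrow> complex) set \<Rightarrow> complex \<times> complex \<times> complex \<Rightarrow> nat \<Rightarrow> nat \<Rightarrow> bool" where
  "pair_of_tile p \<Gamma>' = (\<lambda>(a, b, c) i j.
     let G = Aut unit_disc;
         x = hyp_rotation a (2 * pi / real p);
         y = hyp_rotation b (2 * pi / real p);
         z = hyp_rotation c (2 * pi / real p)
     in y \<in> \<Gamma>' #>\<^bsub>G\<^esub> (x [^]\<^bsub>G\<^esub> i) \<and> z \<in> \<Gamma>' #>\<^bsub>G\<^esub> (x [^]\<^bsub>G\<^esub> j) \<and>
        i \<in> {1..p - 1} \<and> j \<in> {1..p - 1} \<and> \<not> p dvd i + j + 1)"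

text \<open>\<open>(i, j)\<close> is the pair attached to \<open>S\<close> by some choice of the groups, the tiling and the tile.\<close>

definition associated_pair :: "nat \<Rightarrow> 'a rsurface \<Rightarrow> ('a \<Rightarrow> 'a) \<Rightarrow> nat \<Rightarrow> nat \<Rightarrow> bool" where
  "associated_pair p S T i j \<longleftrightarrow>
     (\<exists>\<Gamma> \<Gamma>' \<alpha> \<beta> \<gamma> \<T>. \<exists>t\<in>\<T>. fuchsian_model p S T \<Gamma> \<Gamma>' \<and>
        canonical_tiling p \<Gamma> \<alpha> \<beta> \<gamma> \<T> \<and> pair_of_tile p \<Gamma>' t i j)"

text \<open>Residue classes modulo \<open>p\<close> are represented by integers in \<open>{0..<p}\<close>.\<close>

definition Lambda_e :: "nat \<Rightarrow> nat \<Rightarrow> nat \<Rightarrow> (int \<times> int) set" where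
  "Lambda_e p i0 j0 =
    (let i = int i0; j = int j0; k = - (i + j + 1);
         i' = modular_inverse (int p) i; j' = modular_inverse (int p) j;
         k' = modular_inverse (int p) k
     in (\<lambda>(a, b). (a mod int p, b mod int p)) `
        {(i, j), (j, k), (k, i),
         (i' * j, i'), (i', i' * k), (i' * k, i' * j),
         (j', i * j'), (i * j', j' * k), (j' * k, j'),
         (j * k', i * k'), (i * k', k'), (k', j * k')})"

definition kappa1 :: "nat \<Rightarrow> nat \<Rightarrow> nat \<Rightarrow> bool" where
  "kappa1 p i j \<longleftrightarrow> (1, 1) \<in> Lambda_e p i j"

definition kappa2 :: "nat \<Rightarrow> nat \<Rightarrow> nat \<Rightarrow> bool" where
  "kappa2 p i j \<longleftrightarrow>
     (\<exists>m\<in>{2..int p - 4}. (1, m) \<in> Lambda_e p i j \<or> (m, 1) \<in> Lambda_e p i j) \<or>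
     (\<exists>m\<in>{2..int p - 2}. m \<noteq> modular_inverse (int p) (int p - 3) \<and> (m, m) \<in> Lambda_e p i j)"

definition kappa3 :: "nat \<Rightarrow> nat \<Rightarrow> nat \<Rightarrow> bool" where
  "kappa3 p i j \<longleftrightarrow> (int p - 1, int p - 1) \<in> Lambda_e p i j"

definition kappa4 :: "nat \<Rightarrow> nat \<Rightarrow> nat \<Rightarrow> bool" where
  "kappa4 p i j \<longleftrightarrow>
     (\<exists>m\<in>{2..int p - 2}. \<not> int p dvd m\<^sup>2 + 1 \<and> (int p - 1, m) \<in> Lambda_e p i j)"

definition kappa5 :: "nat \<Rightarrow> nat \<Rightarrow> nat \<Rightarrow> bool" where
  "kappa5 p i j \<longleftrightarrow> (\<exists>m. [m\<^sup>2 = -1] (mod int p) \<and> (int p - 1, m) \<in> Lambda_e p i j)"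

definition kappa6 :: "nat \<Rightarrow> nat \<Rightarrow> nat \<Rightarrow> bool" where
  "kappa6 p i j \<longleftrightarrow>
     \<not> kappa1 p i j \<and> \<not> kappa2 p i j \<and> \<not> kappa3 p i j \<and> \<not> kappa4 p i j \<and> \<not> kappa5 p i j"

end

theory Submission
  imports Defs
begin

text \<open>
  Let \<open>P\<close> be the projection of the disc onto \<open>S\<close>.  It is injective near each of the four vertices
  \<open>A s\<close> of a parallelogram made of two adjacent tiles, and the rotations through \<open>2 * pi / p\<close> about
  them induce the powers \<open>\<tau>, \<tau>\<^sup>i, \<tau>\<^sup>j, \<tau>\<^sup>k\<close> of a generator \<open>\<tau>\<close> of the group of \<open>T\<close>, where
  \<open>1 + i + j + k = 0\<close> because the product of suitable such rotations is the identity.  So these powers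
  have one and the same derivative at the fixed points \<open>P (A s)\<close>.

  If \<open>f\<close> permutes the fixed points of \<open>T\<close>, the conjugate of \<open>T\<close> by \<open>f\<close> fixes them all.  An
  automorphism \<open>g\<close> fixing three of them is a power of \<open>T\<close>: if \<open>v\<close> is the coordinate on the quotient
  sphere with zero and pole at two of them, \<open>v (g x) / v x\<close> is a bounded holomorphic function, hence
  constant, with value 1 at the third.  Therefore \<open>f\<close> conjugates \<open>T\<close> to some \<open>T\<^sup>l\<close>, and comparing
  derivatives, multiplication by \<open>l\<close> permutes the residues \<open>1, i, j, k\<close> just as \<open>f\<close> permutes the fixed
  points.  In the last case these residues are distinct and different from \<open>-1\<close>, which forces
  \<open>l = 1\<close>, so \<open>f\<close> fixes all the fixed points and is a power of \<open>T\<close>.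
\<close>

section \<open>Holomorphic functions on a surface\<close>

text \<open>The pair \<open>(i, j)\<close> records rotations of the disc, whereas nothing is given
  about how \<open>T\<close> turns at its fixed points. Derivatives link the two: they are computed
  on the disc and carried to \<open>S\<close> by the projection. This is why the projection must be
  injective near the vertices, and there the discreteness and the free action enter. Nor is it given
  that the vertices lie over fixed points of \<open>T\<close>, or over different ones; both follow
  from the derivatives, and counting to four then shows that every fixed point is reached.

  The cases are conditions on the residues 1, i, j, k up to a common factor: in the first three, two
  residues agree; in the fourth and fifth, two are opposite. Without coincidences the permutation of
  the fixed points can be read off from the factor \<open>l\<close>, and the absence of -1 is what
  forbids a factor of order 2 or 4.\<close>

definition holo_at :: "'a rsurface \<Rightarrow> ('a \<Rightarrow> complex) \<Rightarrow> 'a \<Rightarrow> bool" where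
  "holo_at S g x \<longleftrightarrow>
     (\<forall>(U, \<phi>)\<in>rs_charts S. x \<in> U \<longrightarrow> (g \<circ> inv_into U \<phi>) analytic_on {\<phi> x})"

lemma holo_atI:
  "(\<And>U \<phi>. (U, \<phi>) \<in> rs_charts S \<Longrightarrow> x \<in> U \<Longrightarrow> (\<lambda>z. g (inv_into U \<phi> z)) analytic_on {\<phi> x}) \<Longrightarrow>
    holo_at S g x"
  unfolding holo_at_def o_def by blast

lemma holo_atD:
  "holo_at S g x \<Longrightarrow> (U, \<phi>) \<in> rs_charts S \<Longrightarrow> x \<in> U \<Longrightarrow>
    (\<lambda>z. g (inv_into U \<phi> z)) analytic_on {\<phi> x}"
  unfolding holo_at_def o_def by blast

text \<open>All that is asked of the target in the pointwise description of holomorphic maps. Maps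
  into the sphere can thus be handled once its two charts are known to be open.\<close>

definition open_charts :: "'a rsurface \<Rightarrow> bool" where
  "open_charts S \<longleftrightarrow> (\<forall>(U, \<phi>)\<in>rs_charts S. openin (rs_top S) U)"

lemma riemann_surface_open_charts: "riemann_surface S \<Longrightarrow> open_charts S"
  unfolding riemann_surface_def open_charts_def by blast

lemma chart_cover:
  assumes "riemann_surface S" "x \<in> points S"
  obtains U \<phi> where "(U, \<phi>) \<in> rs_charts S" "x \<in> U"
  using assms unfolding riemann_surface_def by blast

context
  fixes S :: "'a rsurface" and U \<phi>
  assumes S: "riemann_surface S" and U: "(U, \<phi>) \<in> rs_charts S"
begin

lemma chart_open: "openin (rs_top S) U"
  using S U unfolding riemann_surface_def by blast

lemma chart_subset: "U \<subseteq> points S"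
  using chart_open openin_subset by blast

lemma chart_homeo:
  "open (\<phi> ` U)" "homeomorphic_map (subtopology (rs_top S) U) (top_of_set (\<phi> ` U)) \<phi>"
  using S U unfolding riemann_surface_def by blast+

lemma chart_inj: "inj_on \<phi> U"
  using homeomorphic_imp_injective_map[OF chart_homeo(2)] chart_subset
  by (simp add: Int_absorb1)

lemma chart_inv [simp]: "x \<in> U \<Longrightarrow> inv_into U \<phi> (\<phi> x) = x"
  using chart_inj by simp

lemma chart_image_open:
  assumes "openin (rs_top S) W"
  shows "open (\<phi> ` (W \<inter> U))"
proof -
  have "openin (subtopology (rs_top S) U) (W \<inter> U)"
    using assms by (auto simp: openin_subtopology)
  then have "openin (top_of_set (\<phi> ` U)) (\<phi> ` (W \<inter> U))"
    using homeomorphic_imp_open_map[OF chart_homeo(2)] unfolding open_map_def by blast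
  then show ?thesis
    using chart_homeo(1) openin_open_trans by blast
qed

lemma chart_vimage_open:
  assumes "open W"
  shows "openin (rs_top S) {y \<in> U. \<phi> y \<in> W}"
proof -
  have c: "continuous_map (subtopology (rs_top S) U) (top_of_set (\<phi> ` U)) \<phi>"
    using homeomorphic_imp_continuous_map[OF chart_homeo(2)] .
  have "openin (top_of_set (\<phi> ` U)) (\<phi> ` U \<inter> W)"
    using assms by blast
  from openin_continuous_map_preimage[OF c this]
  have "openin (subtopology (rs_top S) U) {x \<in> U. \<phi> x \<in> \<phi> ` U \<inter> W}"
    using chart_subset by (simp add: Int_absorb1)
  moreover have "{x \<in> U. \<phi> x \<in> \<phi> ` U \<inter> W} = {y \<in> U. \<phi> y \<in> W}" by auto
  ultimately show ?thesis
    using chart_open openin_trans_full by metis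
qed

text \<open>Since \<open>\<phi>\<close> is open and injective on \<open>U\<close>,
  \<open>inv_into U \<phi>\<close> is a genuine inverse near \<open>\<phi> x\<close>. This lemma and
  the next translate "near \<open>x\<close>" into the filter \<open>nhds (\<phi> x)\<close> and
  back, so that complex analysis applies.\<close>

lemma chart_eventually:
  assumes "openin (rs_top S) W" "x \<in> W" "x \<in> U"
  shows "eventually (\<lambda>z. inv_into U \<phi> z \<in> W \<and> inv_into U \<phi> z \<in> U \<and> \<phi> (inv_into U \<phi> z) = z)
           (nhds (\<phi> x))"
proof -
  have "eventually (\<lambda>z. z \<in> \<phi> ` (W \<inter> U)) (nhds (\<phi> x))"
    using chart_image_open[OF assms(1)] assms by (intro eventually_nhds_in_open) auto
  then show ?thesis
    by eventually_elim auto
qed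

lemma chart_eventuallyD:
  assumes "eventually P (nhds (\<phi> x))" "x \<in> U"
  obtains W where "openin (rs_top S) W" "x \<in> W" "W \<subseteq> U" "\<And>y. y \<in> W \<Longrightarrow> P (\<phi> y)"
proof -
  obtain N where N: "open N" "\<phi> x \<in> N" "\<And>z. z \<in> N \<Longrightarrow> P z"
    using assms(1) unfolding eventually_nhds by blast
  show ?thesis
    using that[of "{y \<in> U. \<phi> y \<in> N}"] chart_vimage_open[OF N(1)] N assms(2) by blast
qed

end

lemma transition_analytic:
  assumes S: "riemann_surface S"
    and U: "(U, \<phi>) \<in> rs_charts S" and V: "(V, \<psi>) \<in> rs_charts S" and x: "x \<in> U" "x \<in> V"
  shows "(\<psi> \<circ> inv_into U \<phi>) analytic_on {\<phi> x}"
proof -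
  have "(\<psi> \<circ> inv_into U \<phi>) holomorphic_on (\<phi> ` (U \<inter> V))"
    using S U V unfolding riemann_surface_def by blast
  moreover have "open (\<phi> ` (U \<inter> V))"
    using chart_image_open[OF S U chart_open[OF S V]] by (simp add: Int_commute)
  ultimately have "(\<psi> \<circ> inv_into U \<phi>) analytic_on (\<phi> ` (U \<inter> V))"
    by (simp only: analytic_on_open)
  then show ?thesis
    by (rule analytic_on_subset) (use x in blast)
qed

text \<open>The change of charts is analytic, so composing with it carries analyticity from one
  chart to all others.\<close>

lemma holo_at_chart_iff:
  assumes S: "riemann_surface S" and U: "(U, \<phi>) \<in> rs_charts S" and x: "x \<in> U"
  shows "holo_at S g x \<longleftrightarrow> (g \<circ> inv_into U \<phi>) analytic_on {\<phi> x}"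
proof
  assume g: "(g \<circ> inv_into U \<phi>) analytic_on {\<phi> x}"
  have "(g \<circ> inv_into V \<psi>) analytic_on {\<psi> x}" if V: "(V, \<psi>) \<in> rs_charts S" and xV: "x \<in> V" for V \<psi>
  proof -
    have "((g \<circ> inv_into U \<phi>) \<circ> (\<phi> \<circ> inv_into V \<psi>)) analytic_on {\<psi> x}"
      using g transition_analytic[OF S V U xV x] chart_inv[OF S V xV]
      by (intro analytic_on_compose_gen[where T = "{\<phi> x}"]) auto
    moreover have "eventually (\<lambda>z. ((g \<circ> inv_into U \<phi>) \<circ> (\<phi> \<circ> inv_into V \<psi>)) z = (g \<circ> inv_into V \<psi>) z)
        (nhds (\<psi> x))"
      using chart_eventually[OF S V chart_open[OF S U] x xV]
      by eventually_elim (simp add: chart_inv[OF S U])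
    ultimately show ?thesis
      using analytic_at_cong by blast
  qed
  then show "holo_at S g x"
    unfolding holo_at_def by blast
next
  assume "holo_at S g x"
  from holo_atD[OF this U x] show "(g \<circ> inv_into U \<phi>) analytic_on {\<phi> x}"
    by (simp only: o_def)
qed

lemma holo_at_const [simp]: "holo_at S (\<lambda>_. c) x"
  unfolding holo_at_def o_def by simp

lemma holo_at_diff:
  assumes f: "holo_at S f x" and g: "holo_at S g x"
  shows "holo_at S (\<lambda>y. f y - g y) x"
proof (rule holo_atI)
  fix U \<phi> assume U: "(U, \<phi>) \<in> rs_charts S" "x \<in> U"
  show "(\<lambda>z. f (inv_into U \<phi> z) - g (inv_into U \<phi> z)) analytic_on {\<phi> x}"
    by (rule analytic_on_diff[OF holo_atD[OF f U] holo_atD[OF g U]])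
qed

lemma holo_at_mult:
  assumes f: "holo_at S f x" and g: "holo_at S g x"
  shows "holo_at S (\<lambda>y. f y * g y) x"
proof (rule holo_atI)
  fix U \<phi> assume U: "(U, \<phi>) \<in> rs_charts S" "x \<in> U"
  show "(\<lambda>z. f (inv_into U \<phi> z) * g (inv_into U \<phi> z)) analytic_on {\<phi> x}"
    by (rule analytic_on_mult[OF holo_atD[OF f U] holo_atD[OF g U]])
qed

lemma holo_at_divide:
  assumes S: "riemann_surface S" and "holo_at S f x" "holo_at S g x" "g x \<noteq> 0"
  shows "holo_at S (\<lambda>y. f y / g y) x"
proof (rule holo_atI)
  fix U \<phi> assume U: "(U, \<phi>) \<in> rs_charts S" "x \<in> U"
  show "(\<lambda>z. f (inv_into U \<phi> z) / g (inv_into U \<phi> z)) analytic_on {\<phi> x}"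
    by (rule analytic_on_divide[OF holo_atD[OF assms(2) U] holo_atD[OF assms(3) U]])
       (simp add: chart_inv[OF S U] assms(4))
qed

lemma holo_at_cong:
  assumes S: "riemann_surface S" and "holo_at S f x" "openin (rs_top S) W" "x \<in> W"
    and eq: "\<And>y. y \<in> W \<Longrightarrow> f y = g y"
  shows "holo_at S g x"
proof -
  have "(g \<circ> inv_into U \<phi>) analytic_on {\<phi> x}"
    if U: "(U, \<phi>) \<in> rs_charts S" and x: "x \<in> U" for U \<phi>
  proof -
    have "eventually (\<lambda>z. (f \<circ> inv_into U \<phi>) z = (g \<circ> inv_into U \<phi>) z) (nhds (\<phi> x))"
      using chart_eventually[OF S U assms(3,4) x] by eventually_elim (simp add: eq)
    then show ?thesis
      using analytic_at_cong assms(2) U x unfolding holo_at_def by blast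
  qed
  then show ?thesis unfolding holo_at_def by blast
qed

lemma holo_at_locally_continuous:
  assumes S: "riemann_surface S" and g: "holo_at S g x" and x: "x \<in> points S"
    and N: "open N" "g x \<in> N"
  obtains W where "openin (rs_top S) W" "x \<in> W" "\<And>y. y \<in> W \<Longrightarrow> g y \<in> N"
proof -
  obtain U \<phi> where U: "(U, \<phi>) \<in> rs_charts S" "x \<in> U"
    using chart_cover[OF S x] .
  have "isCont (g \<circ> inv_into U \<phi>) (\<phi> x)"
    using g U by (auto simp: holo_at_def intro: analytic_at_imp_isCont)
  then have "((g \<circ> inv_into U \<phi>) \<longlongrightarrow> (g \<circ> inv_into U \<phi>) (\<phi> x)) (nhds (\<phi> x))"
    unfolding isCont_def tendsto_at_iff_tendsto_nhds .
  then have "eventually (\<lambda>z. (g \<circ> inv_into U \<phi>) z \<in> N) (nhds (\<phi> x))"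
    using N chart_inv[OF S U] by (intro topological_tendstoD) (auto simp: o_def)
  then obtain W where "openin (rs_top S) W" "x \<in> W" "W \<subseteq> U"
      "\<And>y. y \<in> W \<Longrightarrow> (g \<circ> inv_into U \<phi>) (\<phi> y) \<in> N"
    using chart_eventuallyD[OF S U(1) _ U(2)] by metis
  then show ?thesis
    using that chart_inv[OF S U(1)] by (metis comp_apply subsetD)
qed

lemma holo_at_continuous_on:
  assumes S: "riemann_surface S" and W: "openin (rs_top S) W"
    and g: "\<And>x. x \<in> W \<Longrightarrow> holo_at S g x"
  shows "continuous_map (subtopology (rs_top S) W) euclidean g"
  unfolding continuous_map_def
proof (intro conjI allI impI)
  fix N :: "complex set" assume "openin euclidean N"
  then have N: "open N" by simp
  have "openin (rs_top S) {x \<in> W. g x \<in> N}"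
  proof (subst openin_subopen, intro ballI)
    fix x assume x: "x \<in> {x \<in> W. g x \<in> N}"
    then have "x \<in> points S" using W openin_subset by blast
    then obtain O' where "openin (rs_top S) O'" "x \<in> O'" "\<And>y. y \<in> O' \<Longrightarrow> g y \<in> N"
      using holo_at_locally_continuous[OF S g, of x N] x N by blast
    then show "\<exists>T. openin (rs_top S) T \<and> x \<in> T \<and> T \<subseteq> {x \<in> W. g x \<in> N}"
      using W x by (intro exI[of _ "O' \<inter> W"]) auto
  qed
  then have "openin (subtopology (rs_top S) W) {x \<in> W. g x \<in> N}"
    using W by (simp add: openin_open_subtopology)
  moreover have "topspace (subtopology (rs_top S) W) = W"
    using W openin_subset by (auto simp: Int_absorb1)
  ultimately show "openin (subtopology (rs_top S) W)
      {x \<in> topspace (subtopology (rs_top S) W). g x \<in> N}" by simp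
qed auto

lemma continuous_map_vimage_openin:
  assumes "continuous_map X Y f" "openin Y V" "openin X W"
  shows "openin X {x \<in> W. f x \<in> V}"
proof -
  have "{x \<in> W. f x \<in> V} = W \<inter> {x \<in> topspace X. f x \<in> V}"
    using openin_subset[OF assms(3)] by auto
  then show ?thesis
    using openin_continuous_map_preimage[OF assms(1,2)] assms(3) by auto
qed

lemma holomorphic_map_continuous:
  "holomorphic_map S R f \<Longrightarrow> continuous_map (rs_top S) (rs_top R) f"
  unfolding holomorphic_map_def by (rule conjunct1)

lemma continuous_map_in_topspace: "continuous_map X Y f \<Longrightarrow> x \<in> topspace X \<Longrightarrow> f x \<in> topspace Y"
  by (simp add: continuous_map_def Pi_iff)

text \<open>By continuity of \<open>f\<close>, the domain of each chart expression of
  \<open>f\<close> is an open set of complex numbers, and on open sets being holomorphic is the same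
  as being analytic at each point. Holomorphic maps can then be treated point by point.\<close>

lemma holomorphic_map_iff:
  assumes S: "riemann_surface S" and R: "open_charts R"
  shows "holomorphic_map S R f \<longleftrightarrow>
    continuous_map (rs_top S) (rs_top R) f \<and>
    (\<forall>x\<in>points S. \<forall>V \<psi>. (V, \<psi>) \<in> rs_charts R \<longrightarrow> f x \<in> V \<longrightarrow> holo_at S (\<psi> \<circ> f) x)"
    (is "_ \<longleftrightarrow> _ \<and> ?h")
proof -
  {
    assume f: "continuous_map (rs_top S) (rs_top R) f"
    have op: "open (\<phi> ` {x \<in> U. f x \<in> V})"
      if U: "(U, \<phi>) \<in> rs_charts S" and V: "(V, \<psi>) \<in> rs_charts R" for U \<phi> V \<psi>
    proof -
      have "openin (rs_top R) V" using R V unfolding open_charts_def by blast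
      from continuous_map_vimage_openin[OF f this chart_open[OF S U]]
      have "open (\<phi> ` ({x \<in> U. f x \<in> V} \<inter> U))"
        by (rule chart_image_open[OF S U])
      moreover have "{x \<in> U. f x \<in> V} \<inter> U = {x \<in> U. f x \<in> V}" by auto
      ultimately show ?thesis by simp
    qed
    have "(\<psi> \<circ> f \<circ> inv_into U \<phi>) holomorphic_on (\<phi> ` {x \<in> U. f x \<in> V}) \<longleftrightarrow>
      (\<forall>x\<in>U. f x \<in> V \<longrightarrow> (\<psi> \<circ> f \<circ> inv_into U \<phi>) analytic_on {\<phi> x})"
      if "(U, \<phi>) \<in> rs_charts S" "(V, \<psi>) \<in> rs_charts R" for U \<phi> V \<psi>
      unfolding analytic_on_open[OF op[OF that], symmetric]
      by (subst analytic_on_analytic_at) auto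
    note hol = this
    have "(\<forall>(U, \<phi>)\<in>rs_charts S. \<forall>(V, \<psi>)\<in>rs_charts R.
        (\<psi> \<circ> f \<circ> inv_into U \<phi>) holomorphic_on (\<phi> ` {x \<in> U. f x \<in> V})) \<longleftrightarrow> ?h" (is "?l \<longleftrightarrow> _")
    proof
      assume l: ?l
      show ?h
        unfolding holo_at_def
      proof clarify
        fix x V \<psi> U \<phi>
        assume U: "(U, \<phi>) \<in> rs_charts S" "x \<in> U" and V: "(V, \<psi>) \<in> rs_charts R" "f x \<in> V"
        have "(\<psi> \<circ> f \<circ> inv_into U \<phi>) holomorphic_on (\<phi> ` {x \<in> U. f x \<in> V})"
          using l U(1) V(1) by blast
        then show "(\<psi> \<circ> f \<circ> inv_into U \<phi>) analytic_on {\<phi> x}"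
          using hol[OF U(1) V(1)] U(2) V(2) by blast
      qed
    next
      assume h: ?h
      show ?l
      proof clarify
        fix U \<phi> V \<psi>
        assume U: "(U, \<phi>) \<in> rs_charts S" and V: "(V, \<psi>) \<in> rs_charts R"
        have "holo_at S (\<psi> \<circ> f) x" if "x \<in> U" "f x \<in> V" for x
          using h V that chart_subset[OF S U] by blast
        then show "(\<psi> \<circ> f \<circ> inv_into U \<phi>) holomorphic_on (\<phi> ` {x \<in> U. f x \<in> V})"
          using hol[OF U V] U unfolding holo_at_def by blast
      qed
    qed
  }
  then show ?thesis
    unfolding holomorphic_map_def by blast
qed

lemma holomorphic_mapI:
  assumes "riemann_surface S" "open_charts R" "continuous_map (rs_top S) (rs_top R) f"
    and "\<And>x V \<psi>. x \<in> points S \<Longrightarrow> (V, \<psi>) \<in> rs_charts R \<Longrightarrow> f x \<in> V \<Longrightarrow> holo_at S (\<psi> \<circ> f) x"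
  shows "holomorphic_map S R f"
  unfolding holomorphic_map_iff[OF assms(1,2)] using assms(3,4) by simp

lemma holomorphic_mapD:
  assumes "riemann_surface S" "open_charts R" "holomorphic_map S R f"
    and "x \<in> points S" "(V, \<psi>) \<in> rs_charts R" "f x \<in> V"
  shows "holo_at S (\<psi> \<circ> f) x"
  using assms(3-6) unfolding holomorphic_map_iff[OF assms(1,2)] by simp

lemma holo_at_compose:
  assumes S: "riemann_surface S" and R: "riemann_surface R"
    and f: "holomorphic_map S R f" and x: "x \<in> points S" and k: "holo_at R k (f x)"
  shows "holo_at S (k \<circ> f) x"
proof -
  have cf: "continuous_map (rs_top S) (rs_top R) f"
    and hf: "\<And>V \<psi>. (V, \<psi>) \<in> rs_charts R \<Longrightarrow> f x \<in> V \<Longrightarrow> holo_at S (\<psi> \<circ> f) x"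
    using holomorphic_map_continuous[OF f] holomorphic_mapD[OF S riemann_surface_open_charts[OF R] f x]
    by this
  obtain V \<psi> where V: "(V, \<psi>) \<in> rs_charts R" "f x \<in> V"
    using chart_cover[OF R continuous_map_in_topspace[OF cf x]] .
  obtain U \<phi> where U: "(U, \<phi>) \<in> rs_charts S" "x \<in> U"
    using chart_cover[OF S x] .
  have "((k \<circ> inv_into V \<psi>) \<circ> (\<psi> \<circ> f \<circ> inv_into U \<phi>)) analytic_on {\<phi> x}"
    using hf[OF V] U k V chart_inv[OF S U] unfolding holo_at_def
    by (intro analytic_on_compose_gen[where T = "{\<psi> (f x)}"]) auto
  moreover have "eventually (\<lambda>z. ((k \<circ> inv_into V \<psi>) \<circ> (\<psi> \<circ> f \<circ> inv_into U \<phi>)) z =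
      (k \<circ> f \<circ> inv_into U \<phi>) z) (nhds (\<phi> x))"
    using chart_eventually[OF S U(1) continuous_map_vimage_openin[OF cf chart_open[OF R V(1)]
        chart_open[OF S U(1)]], of x] U V
    by (auto elim!: eventually_mono simp: chart_inv[OF R V(1)])
  ultimately have "(k \<circ> f \<circ> inv_into U \<phi>) analytic_on {\<phi> x}"
    using analytic_at_cong by blast
  then show ?thesis
    using holo_at_chart_iff[OF S U] by blast
qed

lemma holomorphic_map_compose:
  assumes S: "riemann_surface S" and R: "riemann_surface R" and Q: "open_charts Q"
    and f: "holomorphic_map S R f" and g: "holomorphic_map R Q g"
  shows "holomorphic_map S Q (g \<circ> f)"
proof (rule holomorphic_mapI[OF S Q])
  have cf: "continuous_map (rs_top S) (rs_top R) f" and cg: "continuous_map (rs_top R) (rs_top Q) g"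
    using holomorphic_map_continuous[OF f] holomorphic_map_continuous[OF g] by this
  then show "continuous_map (rs_top S) (rs_top Q) (g \<circ> f)"
    by (rule continuous_map_compose)
  fix x V \<psi> assume x: "x \<in> points S" and V: "(V, \<psi>) \<in> rs_charts Q" "(g \<circ> f) x \<in> V"
  then have fx: "f x \<in> points R"
    using continuous_map_in_topspace[OF cf] by blast
  then have "holo_at R (\<psi> \<circ> g) (f x)"
    using holomorphic_mapD[OF R Q g fx V(1)] V(2) by simp
  then have "holo_at S ((\<psi> \<circ> g) \<circ> f) x"
    by (rule holo_at_compose[OF S R f x])
  then show "holo_at S (\<psi> \<circ> (g \<circ> f)) x" by (simp add: o_assoc)
qed

lemma holomorphic_map_cong:
  assumes S: "riemann_surface S" and R: "open_charts R"
    and "holomorphic_map S R f" and eq: "\<And>x. x \<in> points S \<Longrightarrow> f x = g x"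
  shows "holomorphic_map S R g"
proof (rule holomorphic_mapI[OF S R])
  show "continuous_map (rs_top S) (rs_top R) g"
    using holomorphic_map_continuous[OF assms(3)] eq by (rule continuous_map_eq)
  fix x V \<psi> assume x: "x \<in> points S" and V: "(V, \<psi>) \<in> rs_charts R" "g x \<in> V"
  then have "holo_at S (\<psi> \<circ> f) x"
    using holomorphic_mapD[OF S R assms(3) x V(1)] eq by simp
  then show "holo_at S (\<psi> \<circ> g) x"
    by (rule holo_at_cong[OF S _ openin_topspace x]) (simp add: eq)
qed

lemma holomorphic_map_ident:
  assumes S: "riemann_surface S"
  shows "holomorphic_map S S (\<lambda>x. x)"
proof (rule holomorphic_mapI[OF S riemann_surface_open_charts[OF S]])
  fix x V \<psi> assume V: "(V, \<psi>) \<in> rs_charts S" "x \<in> V"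
  have "holo_at S \<psi> x"
    unfolding holo_at_def using transition_analytic[OF S _ V(1) _ V(2)] by blast
  then show "holo_at S (\<psi> \<circ> (\<lambda>x. x)) x" by (simp add: o_def)
qed simp

section \<open>The automorphism group\<close>

lemma AutD:
  assumes "f \<in> carrier (Aut S)"
  shows "f \<in> Bij (points S)" "bij_betw f (points S) (points S)" "holomorphic_map S S f"
    "\<And>x. x \<in> points S \<Longrightarrow> f x \<in> points S" "continuous_map (rs_top S) (rs_top S) f"
proof -
  show *: "f \<in> Bij (points S)" "holomorphic_map S S f"
    using assms by (simp_all add: Aut_def biholomorphic_map_def)
  then show "bij_betw f (points S) (points S)" by (simp add: Bij_def)
  then show "\<And>x. x \<in> points S \<Longrightarrow> f x \<in> points S" by (rule bij_betwE[rule_format])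
  show "continuous_map (rs_top S) (rs_top S) f"
    by (rule holomorphic_map_continuous[OF *(2)])
qed

lemma Aut_ext:
  assumes "f \<in> carrier (Aut S)" "g \<in> carrier (Aut S)" "\<And>x. x \<in> points S \<Longrightarrow> f x = g x"
  shows "f = g"
  using AutD(1)[OF assms(1)] AutD(1)[OF assms(2)] assms(3)
  by (auto simp: Bij_def intro: extensionalityI)

lemma Aut_mult:
  assumes "f \<in> carrier (Aut S)" "g \<in> carrier (Aut S)"
  shows "f \<otimes>\<^bsub>Aut S\<^esub> g = compose (points S) f g"
  using AutD(1)[OF assms(1)] AutD(1)[OF assms(2)] by (simp add: Aut_def BijGroup_def)

lemma Aut_mult_apply:
  assumes "f \<in> carrier (Aut S)" "g \<in> carrier (Aut S)" "x \<in> points S"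
  shows "(f \<otimes>\<^bsub>Aut S\<^esub> g) x = f (g x)"
  using Aut_mult[OF assms(1,2)] assms(3) by (simp add: compose_def)

lemma Aut_one_apply: "x \<in> points S \<Longrightarrow> \<one>\<^bsub>Aut S\<^esub> x = x"
  by (simp add: Aut_def BijGroup_def)

text \<open>The operations are those of \<open>BijGroup\<close>, so only closure is at stake. Group
  elements are extensional, while \<open>inv_into\<close> and plain composition are not;
  \<open>holomorphic_map_cong\<close> passes between functions that agree on the surface.\<close>

lemma group_Aut:
  assumes S: "riemann_surface S"
  shows "group (Aut S)"
proof -
  note oc = riemann_surface_open_charts[OF S]
  have inv_eq: "inv_into (points S) f x = g x"
    if "bij_betw f (points S) (points S)" "\<And>x. x \<in> points S \<Longrightarrow> g x \<in> points S \<and> f (g x) = x" "x \<in> points S"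
    for f g x
    using that by (metis bij_betw_imp_inj_on inv_into_f_eq)
  have "subgroup (carrier (Aut S)) (BijGroup (points S))"
  proof (rule group.subgroupI[OF group_BijGroup])
    show "carrier (Aut S) \<subseteq> carrier (BijGroup (points S))"
      by (auto simp: Aut_def BijGroup_def)
    have id: "(\<lambda>x\<in>points S. x) \<in> carrier (Aut S)"
    proof -
      have "holomorphic_map S S (\<lambda>x\<in>points S. x)"
        by (rule holomorphic_map_cong[OF S oc holomorphic_map_ident[OF S]]) auto
      moreover have "holomorphic_map S S (inv_into (points S) (\<lambda>x\<in>points S. x))"
        by (rule holomorphic_map_cong[OF S oc holomorphic_map_ident[OF S]])
           (subst inv_eq[where g = "\<lambda>x. x"], auto simp: bij_betw_def inj_on_def)
      ultimately show ?thesis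
        using id_Bij[of "points S"] by (auto simp: Aut_def biholomorphic_map_def Bij_def)
    qed
    then show "carrier (Aut S) \<noteq> {}" by blast
    fix f assume f: "f \<in> carrier (Aut S)"
    then have fB: "f \<in> Bij (points S)" and bf: "bij_betw f (points S) (points S)" by (auto dest: AutD)
    have inv: "inv\<^bsub>BijGroup (points S)\<^esub> f = (\<lambda>x\<in>points S. inv_into (points S) f x)"
      using inv_BijGroup[OF fB] .
    have "holomorphic_map S S (\<lambda>x\<in>points S. inv_into (points S) f x)"
      by (rule holomorphic_map_cong[OF S oc, of "inv_into (points S) f"])
         (use f in \<open>simp_all add: Aut_def biholomorphic_map_def\<close>)
    moreover have B: "(\<lambda>x\<in>points S. inv_into (points S) f x) \<in> Bij (points S)"
      using restrict_inv_into_Bij[OF fB] .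
    moreover have "holomorphic_map S S (inv_into (points S) (\<lambda>x\<in>points S. inv_into (points S) f x))"
    proof (rule holomorphic_map_cong[OF S oc AutD(3)[OF f]])
      fix x assume "x \<in> points S"
      then show "f x = inv_into (points S) (\<lambda>x\<in>points S. inv_into (points S) f x) x"
        using B AutD(4)[OF f] bij_betw_inv_into_left[OF bf]
        by (subst inv_eq[where g = f]) (simp_all add: Bij_def)
    qed
    ultimately show "inv\<^bsub>BijGroup (points S)\<^esub> f \<in> carrier (Aut S)"
      unfolding inv by (auto simp: Aut_def biholomorphic_map_def Bij_def)
    fix g assume g: "g \<in> carrier (Aut S)"
    then have gB: "g \<in> Bij (points S)" and bg: "bij_betw g (points S) (points S)" by (auto dest: AutD)
    have mult: "f \<otimes>\<^bsub>BijGroup (points S)\<^esub> g = compose (points S) f g"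
      using fB gB by (simp add: BijGroup_def)
    have "holomorphic_map S S (compose (points S) f g)"
      by (rule holomorphic_map_cong[OF S oc holomorphic_map_compose[OF S S oc AutD(3)[OF g] AutD(3)[OF f]]])
         (simp add: compose_def)
    moreover have B: "compose (points S) f g \<in> Bij (points S)"
      using compose_Bij[OF fB gB] .
    moreover have "holomorphic_map S S (inv_into (points S) (compose (points S) f g))"
    proof (rule holomorphic_map_cong[OF S oc holomorphic_map_compose[OF S S oc]])
      show "holomorphic_map S S (inv_into (points S) f)" "holomorphic_map S S (inv_into (points S) g)"
        using f g by (auto simp: Aut_def biholomorphic_map_def)
      fix x assume "x \<in> points S"
      then show "(inv_into (points S) g \<circ> inv_into (points S) f) x = inv_into (points S) (compose (points S) f g) x"
        using B bf bg
        by (subst inv_eq[where g = "inv_into (points S) g \<circ> inv_into (points S) f"])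
           (auto simp: Bij_def compose_def bij_betw_inv_into_right bij_betw_def inv_into_into)
    qed
    ultimately show "f \<otimes>\<^bsub>BijGroup (points S)\<^esub> g \<in> carrier (Aut S)"
      unfolding mult by (auto simp: Aut_def biholomorphic_map_def Bij_def)
  qed
  from subgroup.subgroup_is_group[OF this group_BijGroup]
  show ?thesis by (simp add: Aut_def)
qed

section \<open>Bounded functions on a compact surface\<close>

text \<open>Riemann's theorem on removable singularities, applied in a chart around
  \<open>x\<close>; \<open>c\<close> is the value of the extension at
  \<open>\<phi> x\<close>.\<close>

lemma holo_at_removable:
  assumes S: "riemann_surface S" and W: "openin (rs_top S) W" "x \<in> W"
    and g: "\<And>y. y \<in> W - {x} \<Longrightarrow> holo_at S g y"
    and b: "\<And>y. y \<in> W - {x} \<Longrightarrow> cmod (g y) \<le> B"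
  shows "\<exists>c. holo_at S (g(x := c)) x"
proof -
  have x: "x \<in> points S" using W openin_subset by blast
  obtain U \<phi> where U: "(U, \<phi>) \<in> rs_charts S" "x \<in> U"
    using chart_cover[OF S x] .
  note inv = chart_inv[OF S U(1)]
  define N where "N = \<phi> ` (W \<inter> U)"
  have N: "open N" "\<phi> x \<in> N"
    unfolding N_def using chart_image_open[OF S U(1) W(1)] W(2) U(2) by auto
  define G where "G = (\<lambda>z. g (inv_into U \<phi> z))"
  have pt: "\<exists>y\<in>W \<inter> U - {x}. z = \<phi> y" if "z \<in> N - {\<phi> x}" for z
    using that by (auto simp: N_def)
  have "G analytic_on {z}" if z: "z \<in> N - {\<phi> x}" for z
  proof -
    obtain y where y: "y \<in> W \<inter> U - {x}" "z = \<phi> y" using pt[OF z] by blast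
    have "holo_at S g y" using g y(1) by blast
    from holo_atD[OF this U(1), of] y show ?thesis by (simp add: G_def)
  qed
  then have "G analytic_on (N - {\<phi> x})"
    using analytic_on_analytic_at by blast
  then have hol: "G holomorphic_on (N - {\<phi> x})"
    by (rule analytic_imp_holomorphic)
  have bd: "eventually (\<lambda>z. cmod (G z) \<le> B) (at (\<phi> x))"
    unfolding eventually_at_topological
  proof (intro exI[of _ N] conjI ballI impI N)
    fix z assume z: "z \<in> N" "z \<noteq> \<phi> x"
    then obtain y where y: "y \<in> W \<inter> U - {x}" "z = \<phi> y" using pt[of z] by blast
    then show "cmod (G z) \<le> B" using b[of y] inv by (simp add: G_def)
  qed
  have int: "\<phi> x \<in> interior N" using N by (simp add: interior_open)
  obtain H where H: "H holomorphic_on N" "\<And>z. z \<in> N - {\<phi> x} \<Longrightarrow> H z = G z"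
    using holomorphic_on_extend_bounded[OF hol int] bd by blast
  define c where "c = H (\<phi> x)"
  have "H analytic_on N" using H(1) N(1) by (simp only: analytic_on_open)
  then have Ha: "H analytic_on {\<phi> x}"
    by (rule analytic_on_subset) (use N in blast)
  have ev: "eventually (\<lambda>z. H z = (g(x := c) \<circ> inv_into U \<phi>) z) (nhds (\<phi> x))"
    using eventually_nhds_in_open[OF N]
  proof eventually_elim
    case (elim z)
    show ?case
    proof (cases "z = \<phi> x")
      case True
      then show ?thesis by (simp add: inv U(2) c_def)
    next
      case False
      then obtain y where y: "y \<in> W \<inter> U - {x}" "z = \<phi> y" using pt[of z] elim by blast
      have "H z = G z" using H(2) False elim by blast
      then show ?thesis using y inv by (auto simp: G_def)
    qed
  qed
  have "(g(x := c) \<circ> inv_into U \<phi>) analytic_on {\<phi> x}"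
    using analytic_at_cong[OF ev refl] Ha by blast
  then have "holo_at S (g(x := c)) x"
    using holo_at_chart_iff[OF S U] by blast
  then show ?thesis by blast
qed

text \<open>By compactness the modulus of \<open>g\<close> attains its maximum, at \<open>a\<close>
  say. The set where \<open>g\<close> equals \<open>g a\<close> is closed by continuity and open by
  the maximum modulus principle in a chart, hence it is the whole connected surface.\<close>

lemma holo_on_compact_constant:
  assumes S: "riemann_surface S" and comp: "compact_space (rs_top S)"
    and g: "\<And>x. x \<in> points S \<Longrightarrow> holo_at S g x"
  shows "\<exists>c. \<forall>x\<in>points S. g x = c"
proof -
  have ne: "points S \<noteq> {}" and conn: "connected_space (rs_top S)"
    using S unfolding riemann_surface_def by blast+
  have cont: "continuous_map (rs_top S) euclidean g"
    using holo_at_continuous_on[OF S openin_topspace, of g] g by (simp only: subtopology_topspace)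
  have "compactin euclidean (g ` points S)"
    using image_compactin[OF comp[unfolded compact_space_def] cont] .
  then have "compact (g ` points S)" by simp
  then have "\<exists>w\<in>g ` points S. \<forall>v\<in>g ` points S. cmod v \<le> cmod w"
    by (rule continuous_attains_sup) (use ne in \<open>auto intro: continuous_intros\<close>)
  then obtain a where a: "a \<in> points S" "\<And>x. x \<in> points S \<Longrightarrow> cmod (g x) \<le> cmod (g a)"
    by blast
  define A where "A = {x \<in> points S. g x \<in> {g a}}"
  have "closedin (rs_top S) A"
    unfolding A_def by (rule closedin_continuous_map_preimage[OF cont]) simp
  moreover have "openin (rs_top S) A"
  proof (subst openin_subopen, intro ballI)
    fix x assume x: "x \<in> A"
    then have xp: "x \<in> points S" and gx: "g x = g a" by (auto simp: A_def)
    obtain U \<phi> where U: "(U, \<phi>) \<in> rs_charts S" "x \<in> U"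
      using chart_cover[OF S xp] .
    note inv = chart_inv[OF S U(1)]
    have oU: "open (\<phi> ` U)" by (rule chart_homeo(1)[OF S U(1)])
    obtain r where r: "r > 0" "ball (\<phi> x) r \<subseteq> \<phi> ` U"
      using oU U(2) by (meson imageI open_contains_ball)
    define G where "G = (\<lambda>z. g (inv_into U \<phi> z))"
    have Gp: "\<exists>y\<in>U. z = \<phi> y" if "z \<in> ball (\<phi> x) r" for z
      using that r by blast
    have "G analytic_on {z}" if "z \<in> ball (\<phi> x) r" for z
    proof -
      obtain y where y: "y \<in> U" "z = \<phi> y" using Gp[OF \<open>z \<in> ball (\<phi> x) r\<close>] by blast
      then have "holo_at S g y" using g chart_subset[OF S U(1)] by blast
      from holo_atD[OF this U(1) y(1)] y(2) show ?thesis by (simp add: G_def)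
    qed
    then have "G analytic_on ball (\<phi> x) r"
      using analytic_on_analytic_at by blast
    then have hol: "G holomorphic_on ball (\<phi> x) r"
      by (rule analytic_imp_holomorphic)
    have "G constant_on ball (\<phi> x) r"
    proof (rule maximum_modulus_principle[OF hol _ _ _ order_refl])
      show "\<phi> x \<in> ball (\<phi> x) r" using r by simp
      fix z assume "z \<in> ball (\<phi> x) r"
      then obtain y where y: "y \<in> U" "z = \<phi> y" using Gp by blast
      then show "cmod (G z) \<le> cmod (G (\<phi> x))"
        using a(2)[of y] chart_subset[OF S U(1)] U(2) gx inv by (auto simp: G_def)
    qed auto
    then have eq: "G z = G (\<phi> x)" if "z \<in> ball (\<phi> x) r" for z
      using that r unfolding constant_on_def by (metis centre_in_ball)
    let ?W = "{y \<in> U. \<phi> y \<in> ball (\<phi> x) r}"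
    have "openin (rs_top S) ?W" by (rule chart_vimage_open[OF S U(1)]) simp
    moreover have "x \<in> ?W" using U r by simp
    moreover have "?W \<subseteq> A"
    proof
      fix y assume "y \<in> ?W"
      then show "y \<in> A"
        using eq[of "\<phi> y"] chart_subset[OF S U(1)] inv U(2) gx by (auto simp: A_def G_def)
    qed
    ultimately show "\<exists>T. openin (rs_top S) T \<and> x \<in> T \<and> T \<subseteq> A" by blast
  qed
  ultimately have "A = {} \<or> A = points S"
    using conn unfolding connected_space_clopen_in by blast
  moreover have "a \<in> A" using a(1) by (simp add: A_def)
  ultimately show ?thesis by (auto simp: A_def)
qed

lemma openin_Diff_finite:
  assumes "riemann_surface S" "openin (rs_top S) W" "finite F"
  shows "openin (rs_top S) (W - F)"
proof -
  have "t1_space (rs_top S)"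
    using assms(1) Hausdorff_imp_t1_space unfolding riemann_surface_def by blast
  then have "closedin (rs_top S) (points S \<inter> F)"
    using assms(3) unfolding t1_space_closedin_finite by blast
  then have "openin (rs_top S) (W - (points S \<inter> F))"
    by (rule openin_diff[OF assms(2)])
  moreover have "W - (points S \<inter> F) = W - F"
    using openin_subset[OF assms(2)] by blast
  ultimately show ?thesis by simp
qed

text \<open>The singularities in \<open>F\<close> are removable, and the extended function is
  holomorphic on the compact surface. Around a point \<open>x\<close> of \<open>F\<close> the other
  points of \<open>F\<close> are cut away first, so that each extension sees only one
  singularity.\<close>

lemma bounded_holo_constant:
  assumes S: "riemann_surface S" and comp: "compact_space (rs_top S)" and F: "finite F"
    and g: "\<And>x. x \<in> points S - F \<Longrightarrow> holo_at S g x"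
    and b: "\<And>x. x \<in> points S \<inter> F \<Longrightarrow>
      \<exists>W B. openin (rs_top S) W \<and> x \<in> W \<and> (\<forall>y\<in>W - F. cmod (g y) \<le> B)"
  shows "\<exists>c. \<forall>x\<in>points S - F. g x = c"
proof -
  have "\<exists>c. holo_at S (g(x := c)) x" if x: "x \<in> points S \<inter> F" for x
  proof -
    obtain W B where W: "openin (rs_top S) W" "x \<in> W" "\<And>y. y \<in> W - F \<Longrightarrow> cmod (g y) \<le> B"
      using b[OF x] by blast
    have W': "openin (rs_top S) (W - (F - {x}))"
      using openin_Diff_finite[OF S W(1), of "F - {x}"] F by simp
    have *: "y \<in> W - F" "y \<in> points S - F" if "y \<in> W - (F - {x}) - {x}" for y
      using that openin_subset[OF W(1)] by auto
    show ?thesis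
      by (rule holo_at_removable[OF S W', of _ _ B]) (use * W g in auto)
  qed
  then obtain C where C: "\<And>x. x \<in> points S \<inter> F \<Longrightarrow> holo_at S (g(x := C x)) x"
    by metis
  define h where "h = (\<lambda>y. if y \<in> F then C y else g y)"
  have "holo_at S h x" if x: "x \<in> points S" for x
  proof (cases "x \<in> F")
    case True
    have o: "openin (rs_top S) (points S - (F - {x}))"
      using openin_Diff_finite[OF S openin_topspace, of "F - {x}"] F by simp
    have hol: "holo_at S (g(x := C x)) x" by (rule C) (simp add: x True)
    have eq: "(g(x := C x)) y = h y" if "y \<in> points S - (F - {x})" for y
    proof (cases "y = x")
      case False
      then have "y \<notin> F" using that by blast
      then show ?thesis using False by (simp add: h_def)
    qed (simp add: h_def True)
    show ?thesis
      by (rule holo_at_cong[OF S hol o _ eq]) (simp_all add: x)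
  next
    case False
    have o: "openin (rs_top S) (points S - F)"
      by (rule openin_Diff_finite[OF S openin_topspace F])
    have hol: "holo_at S g x" by (rule g) (simp add: x False)
    have eq: "g y = h y" if "y \<in> points S - F" for y
      using that by (simp add: h_def)
    show ?thesis
      by (rule holo_at_cong[OF S hol o _ eq]) (simp_all add: x False)
  qed
  then obtain c where "\<forall>x\<in>points S. h x = c"
    using holo_on_compact_constant[OF S comp] by blast
  then have "\<forall>x\<in>points S - F. g x = c" by (auto simp: h_def)
  then show ?thesis by blast
qed

text \<open>Write \<open>W z = (z - a) ^ n * k z\<close> with \<open>k a\<close> nonzero. Because
  \<open>G\<close> fixes \<open>a\<close>, the powers combine into the \<open>n\<close>-th power of
  the difference quotient of \<open>G\<close>, so the ratio tends to
  \<open>deriv G a ^ n\<close>.\<close>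

lemma analytic_zero_ratio_bounded:
  fixes W G :: "complex \<Rightarrow> complex"
  assumes W: "W analytic_on {a}" "W a = 0" and nz: "eventually (\<lambda>z. W z \<noteq> 0) (at a)"
    and G: "G analytic_on {a}" "G a = a"
  shows "\<exists>B. eventually (\<lambda>z. cmod (W (G z) / W z) \<le> B) (at a)"
proof -
  obtain r0 where r0: "r0 > 0" "W holomorphic_on ball a r0"
    using W(1) unfolding analytic_at_ball by blast
  have nc: "\<not> W constant_on ball a r0"
  proof
    assume "W constant_on ball a r0"
    then have *: "\<And>z. z \<in> ball a r0 \<Longrightarrow> W z = 0"
      using W(2) r0(1) unfolding constant_on_def by (metis centre_in_ball)
    have "eventually (\<lambda>z. W z = 0) (at a)"
      using eventually_at_ball[OF r0(1), of a UNIV] by (rule eventually_mono) (simp add: *)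
    with nz have "eventually (\<lambda>z::complex. False) (at a)" by eventually_elim auto
    then show False by simp
  qed
  obtain k r n where k: "0 < n" "0 < r" "ball a r \<subseteq> ball a r0" "k holomorphic_on ball a r"
      and Wk: "\<And>w. w \<in> ball a r \<Longrightarrow> W w = (w - a) ^ n * k w"
      and k0: "\<And>w. w \<in> ball a r \<Longrightarrow> k w \<noteq> 0"
    using holomorphic_factor_zero_nonconstant[OF r0(2) open_ball connected_ball _ W(2) nc]
      r0(1) by (metis centre_in_ball)
  have kc: "isCont k a"
    using holomorphic_on_imp_continuous_on[OF k(4)] k(2) by (simp add: continuous_on_eq_continuous_at)
  have Gc: "isCont G a" using G(1) by (rule analytic_at_imp_isCont)
  have Gd: "((\<lambda>z. (G z - a) / (z - a)) \<longlongrightarrow> deriv G a) (at a)"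
    using analytic_on_imp_differentiable_at[OF G(1), of a] G(2)
    by (simp add: has_field_derivative_iff flip: DERIV_deriv_iff_field_differentiable)
  have kG: "((\<lambda>z. k (G z)) \<longlongrightarrow> k a) (at a)"
    using isCont_o2[OF Gc, of k] kc G(2) by (simp add: isCont_def)
  have kl: "(k \<longlongrightarrow> k a) (at a)" using kc by (simp add: isCont_def)
  have ka: "k a \<noteq> 0" using k0 k(2) by simp
  have lim: "((\<lambda>z. ((G z - a) / (z - a)) ^ n * (k (G z) / k z)) \<longlongrightarrow> deriv G a ^ n * (k a / k a)) (at a)"
    by (intro tendsto_intros Gd kG kl ka)
  have ev: "eventually (\<lambda>z. ((G z - a) / (z - a)) ^ n * (k (G z) / k z) = W (G z) / W z) (at a)"
  proof -
    have "(G \<longlongrightarrow> a) (at a)" using Gc G(2) by (simp add: isCont_def)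
    then have "eventually (\<lambda>z. G z \<in> ball a r) (at a)"
      by (rule topological_tendstoD) (use k(2) in auto)
    then show ?thesis
      using eventually_at_ball[OF k(2), of a UNIV]
      by eventually_elim (auto simp: Wk power_divide)
  qed
  have "((\<lambda>z. cmod (W (G z) / W z)) \<longlongrightarrow> cmod (deriv G a ^ n * (k a / k a))) (at a)"
    by (rule tendsto_norm[OF Lim_transform_eventually[OF lim ev]])
  then have "eventually (\<lambda>z. cmod (W (G z) / W z) < cmod (deriv G a ^ n * (k a / k a)) + 1) (at a)"
    by (rule order_tendstoD) simp
  then have "eventually (\<lambda>z. cmod (W (G z) / W z) \<le> cmod (deriv G a ^ n * (k a / k a)) + 1) (at a)"
    by eventually_elim simp
  then show ?thesis by blast
qed

lemma holo_zero_ratio_bounded: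
  assumes S: "riemann_surface S" and q: "openin (rs_top S) W" "q \<in> W"
    and v: "\<And>x. x \<in> W \<Longrightarrow> holo_at S v x" "v q = 0" "\<And>x. x \<in> W - {q} \<Longrightarrow> v x \<noteq> 0"
    and h: "holomorphic_map S S h" "h q = q"
  shows "\<exists>O' B. openin (rs_top S) O' \<and> q \<in> O' \<and> (\<forall>y\<in>O' - {q}. cmod (v (h y) / v y) \<le> B)"
proof -
  have qp: "q \<in> points S" using q openin_subset by blast
  obtain U \<phi> where U: "(U, \<phi>) \<in> rs_charts S" "q \<in> U"
    using chart_cover[OF S qp] .
  note inv = chart_inv[OF S U(1)]
  note oU = chart_open[OF S U(1)]
  note hc = holomorphic_map_continuous[OF h(1)]
  define G where "G = \<phi> \<circ> h \<circ> inv_into U \<phi>"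
  define V where "V = v \<circ> inv_into U \<phi>"
  have VA: "V analytic_on {\<phi> q}"
    using v(1)[OF q(2)] U unfolding V_def holo_at_def by blast
  have "holo_at S (\<phi> \<circ> h) q"
    using holomorphic_mapD[OF S riemann_surface_open_charts[OF S] h(1) qp U(1)] h(2) U(2) by simp
  then have GA: "G analytic_on {\<phi> q}"
    using U unfolding G_def holo_at_def by blast
  have nz: "eventually (\<lambda>z. V z \<noteq> 0) (at (\<phi> q))"
  proof -
    have "eventually (\<lambda>z. inv_into U \<phi> z \<in> W \<and> \<phi> (inv_into U \<phi> z) = z) (at (\<phi> q))"
      using chart_eventually[OF S U(1) q U(2)]
      unfolding eventually_nhds_conv_at by (auto elim: eventually_mono)
    moreover have "eventually (\<lambda>z. z \<noteq> \<phi> q) (at (\<phi> q))"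
      by (simp add: eventually_at_filter)
    ultimately show ?thesis
    proof eventually_elim
      case (elim z)
      then have "inv_into U \<phi> z \<in> W - {q}" by auto
      then show ?case using v(3) by (simp add: V_def)
    qed
  qed
  have V0: "V (\<phi> q) = 0" and G0: "G (\<phi> q) = \<phi> q"
    using v(2) h(2) inv[OF U(2)] by (simp_all add: V_def G_def)
  obtain B where "eventually (\<lambda>z. cmod (V (G z) / V z) \<le> B) (at (\<phi> q))"
    using analytic_zero_ratio_bounded[OF VA V0 nz GA G0] by (rule exE)
  then have ev: "eventually (\<lambda>z. z \<noteq> \<phi> q \<longrightarrow> cmod (V (G z) / V z) \<le> B) (nhds (\<phi> q))"
    by (simp add: eventually_at_filter)
  obtain N where N: "openin (rs_top S) N" "q \<in> N" "N \<subseteq> U"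
      "\<And>y. y \<in> N \<Longrightarrow> \<phi> y \<noteq> \<phi> q \<longrightarrow> cmod (V (G (\<phi> y)) / V (\<phi> y)) \<le> B"
    using chart_eventuallyD[OF S U(1) ev U(2)] by blast
  define O' where "O' = {y \<in> N. h y \<in> U}"
  have "openin (rs_top S) O'"
    unfolding O'_def by (rule continuous_map_vimage_openin[OF hc oU N(1)])
  moreover have "q \<in> O'" using N(2) U(2) h(2) by (simp add: O'_def)
  moreover have "cmod (v (h y) / v y) \<le> B" if y: "y \<in> O' - {q}" for y
  proof -
    have yU: "y \<in> U" "y \<in> N" "h y \<in> U" "y \<noteq> q" using y N(3) by (auto simp: O'_def)
    then have "\<phi> y \<noteq> \<phi> q" using inv U(2) by metis
    then show ?thesis using N(4)[OF yU(2)] yU inv by (simp add: V_def G_def)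
  qed
  ultimately show ?thesis by blast
qed

section \<open>Coordinates on the sphere\<close>

text \<open>Homogeneous coordinates: \<open>w\<close> has the coordinate vector
  \<open>(sphere_num w, sphere_den w)\<close>, and infinity is \<open>(1, 0)\<close>. In these terms
  infinity is a point like any other.\<close>

definition sphere_num :: "complex option \<Rightarrow> complex" where
  "sphere_num w = (case w of None \<Rightarrow> 1 | Some z \<Rightarrow> z)"

definition sphere_den :: "complex option \<Rightarrow> complex" where
  "sphere_den w = (case w of None \<Rightarrow> 0 | Some z \<Rightarrow> 1)"

text \<open>The determinant of the coordinate vectors of \<open>w\<close> and
  \<open>a\<close>.\<close>

definition sphere_cross :: "complex option \<Rightarrow> complex option \<Rightarrow> complex" where
  "sphere_cross w a = sphere_num w * sphere_den a - sphere_num a * sphere_den w"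

text \<open>For distinct \<open>a\<close> and \<open>b\<close>, the Moebius coordinate with zero at
  \<open>a\<close> and pole at \<open>b\<close>. At the pole, division by zero gives the value 0,
  which lets \<open>inverse_sphere_coord\<close> hold at every point.\<close>

definition sphere_coord :: "complex option \<Rightarrow> complex option \<Rightarrow> complex option \<Rightarrow> complex" where
  "sphere_coord a b w = sphere_cross w a / sphere_cross w b"

lemma sphere_cross_eq_0 [simp]: "sphere_cross w a = 0 \<longleftrightarrow> w = a"
  by (auto simp: sphere_cross_def sphere_num_def sphere_den_def split: option.splits)

lemma sphere_coord_eq_0: "w \<noteq> b \<Longrightarrow> sphere_coord a b w = 0 \<longleftrightarrow> w = a"
  by (simp add: sphere_coord_def)

lemma inverse_sphere_coord: "inverse (sphere_coord a b w) = sphere_coord b a w"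
  by (simp add: sphere_coord_def)

lemma sphere_coord_inj:
  assumes "a \<noteq> b" "w \<noteq> b" "w' \<noteq> b" "sphere_coord a b w = sphere_coord a b w'"
  shows "w = w'"
proof -
  have "sphere_cross w b \<noteq> 0" "sphere_cross w' b \<noteq> 0" using assms by simp_all
  then have "sphere_cross w a * sphere_cross w' b = sphere_cross w' a * sphere_cross w b"
    using assms(4) by (simp add: sphere_coord_def frac_eq_eq)
  \<comment> \<open>The Pluecker relation between the determinants of four plane vectors.\<close>
  moreover have "sphere_cross w a * sphere_cross w' b - sphere_cross w' a * sphere_cross w b =
      sphere_cross a b * sphere_cross w w'"
    by (simp add: sphere_cross_def algebra_simps)
  ultimately have "sphere_cross a b * sphere_cross w w' = 0" by simp
  then show ?thesis using assms(1) by simp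
qed

lemma open_charts_sphere: "open_charts riemann_sphere"
proof -
  have "openin (rs_top riemann_sphere) (range Some)"
    by (simp add: riemann_sphere_def)
  moreover have "openin (rs_top riemann_sphere) (UNIV - {Some 0})"
  proof -
    have "UNIV - {Some (0::complex)} = insert None (Some ` (topspace euclidean - {0}))"
      using notin_range_Some by (auto simp: image_iff)
    moreover have "compactin euclidean {0::complex}" "closedin euclidean {0::complex}" by simp_all
    ultimately have "openin (Alexandroff_compactification euclidean) (UNIV - {Some (0::complex)})"
      unfolding openin_Alexandroff_compactification by blast
    then show ?thesis by (simp add: riemann_sphere_def)
  qed
  ultimately show ?thesis
    by (auto simp: open_charts_def riemann_sphere_def)
qed

lemma holo_at_sphere_coord:
  assumes S: "riemann_surface S" and u: "holomorphic_map S riemann_sphere u"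
    and x: "x \<in> points S" and b: "u x \<noteq> b"
  shows "holo_at S (\<lambda>y. sphere_coord a b (u y)) x"
proof -
  note D = holomorphic_mapD[OF S open_charts_sphere u x]
  note cu = holomorphic_map_continuous[OF u]
  have lin: "holo_at S (\<lambda>y. (c * f y - d) / (c' * f y - d')) x"
    if "holo_at S f x" "c' * f x - d' \<noteq> 0" for f c d c' d'
    by (intro holo_at_divide[OF S] holo_at_diff holo_at_mult holo_at_const that)
  have vim: "openin (rs_top S) {y \<in> points S. u y \<in> V}" if "(V, \<psi>) \<in> rs_charts riemann_sphere" for V \<psi>
    using continuous_map_vimage_openin[OF cu _ openin_topspace, of V] open_charts_sphere that
    unfolding open_charts_def by blast
  show ?thesis
  proof (cases "u x")
    case (Some z)
    have C: "(range Some, the) \<in> rs_charts riemann_sphere"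
      by (simp add: riemann_sphere_def)
    have "holo_at S (the \<circ> u) x" using D[OF C] Some by simp
    moreover have "sphere_den b * (the \<circ> u) x - sphere_num b \<noteq> 0"
      using b Some by (auto simp: sphere_num_def sphere_den_def split: option.splits)
    ultimately have "holo_at S (\<lambda>y. (sphere_den a * (the \<circ> u) y - sphere_num a) /
        (sphere_den b * (the \<circ> u) y - sphere_num b)) x"
      by (rule lin)
    then show ?thesis
    proof (rule holo_at_cong[OF S _ vim[OF C]])
      fix y assume "y \<in> {y \<in> points S. u y \<in> range Some}"
      then show "(sphere_den a * (the \<circ> u) y - sphere_num a) /
        (sphere_den b * (the \<circ> u) y - sphere_num b) = sphere_coord a b (u y)"
        by (auto simp: sphere_coord_def sphere_cross_def sphere_num_def[of "Some _"]
            sphere_den_def[of "Some _"] mult.commute)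
    qed (use x Some in auto)
  next
    case None
    define \<psi> :: "complex option \<Rightarrow> complex" where
      "\<psi> = (\<lambda>x. case x of None \<Rightarrow> 0 | Some z \<Rightarrow> inverse z)"
    have C: "(UNIV - {Some 0}, \<psi>) \<in> rs_charts riemann_sphere"
      by (simp add: riemann_sphere_def \<psi>_def)
    have "holo_at S (\<psi> \<circ> u) x" using D[OF C] None by simp
    moreover have "(- sphere_num b) * (\<psi> \<circ> u) x - (- sphere_den b) \<noteq> 0"
      using b None by (auto simp: sphere_num_def sphere_den_def \<psi>_def split: option.splits)
    ultimately have "holo_at S (\<lambda>y. ((- sphere_num a) * (\<psi> \<circ> u) y - (- sphere_den a)) /
        ((- sphere_num b) * (\<psi> \<circ> u) y - (- sphere_den b))) x"
      by (rule lin)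
    then show ?thesis
    proof (rule holo_at_cong[OF S _ vim[OF C]])
      fix y assume y: "y \<in> {y \<in> points S. u y \<in> UNIV - {Some 0}}"
      show "((- sphere_num a) * (\<psi> \<circ> u) y - (- sphere_den a)) /
        ((- sphere_num b) * (\<psi> \<circ> u) y - (- sphere_den b)) = sphere_coord a b (u y)"
      proof (cases "u y")
        case (Some z)
        with y have z: "z \<noteq> 0" by auto
        \<comment> \<open>In this chart the coordinate vector \<open>(z, 1)\<close> is rescaled to
          \<open>(1, 1 / z)\<close>; the factor \<open>1 / z\<close> cancels in the
          quotient.\<close>
        have e: "(- sphere_num c) * (\<psi> \<circ> u) y - (- sphere_den c) = sphere_cross (u y) c / z" for c
          using z Some by (simp add: \<psi>_def sphere_cross_def sphere_num_def[of "Some _"]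
            sphere_den_def[of "Some _"] field_simps)
        show ?thesis unfolding e sphere_coord_def using z by simp
      qed (simp add: \<psi>_def sphere_coord_def sphere_cross_def sphere_num_def[of None]
            sphere_den_def[of None])
    qed (use x None in auto)
  qed
qed

section \<open>Automorphisms fixing three branch points\<close>

text \<open>By \<open>fib\<close>, the map \<open>u\<close> takes its values at the three points
  nowhere else, so the coordinate \<open>v\<close> vanishes only at \<open>q2\<close> and its
  reciprocal only at \<open>q1\<close>. As \<open>g\<close> fixes both points, \<open>v\<close> and
  \<open>v\<close> composed with \<open>g\<close> have zero and pole in the same places, and their
  quotient stays bounded there.\<close>

lemma quotient_invariant:
  assumes S: "riemann_surface S" and comp: "compact_space (rs_top S)"
    and u: "holomorphic_map S riemann_sphere u"
    and q: "q1 \<in> points S" "q2 \<in> points S" "q3 \<in> points S" "q1 \<noteq> q2" "q1 \<noteq> q3" "q2 \<noteq> q3"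
    and fib: "\<And>x q. x \<in> points S \<Longrightarrow> q \<in> {q1, q2, q3} \<Longrightarrow> u x = u q \<Longrightarrow> x = q"
    and g: "g \<in> carrier (Aut S)" "g q1 = q1" "g q2 = q2" "g q3 = q3"
    and x: "x \<in> points S"
  shows "u (g x) = u x"
proof -
  define a b where "a = u q2" and "b = u q1"
  have ab: "a \<noteq> b" using fib[of q2 q1] q by (auto simp: a_def b_def)
  note bij = AutD(2)[OF g(1)]
  note gp = AutD(4)[OF g(1)]
  have ginj: "g y = g z \<Longrightarrow> y = z" if "y \<in> points S" "z \<in> points S" for y z
    using bij that by (auto simp: bij_betw_def inj_on_def)
  have ua: "u y \<noteq> a" if "y \<in> points S" "y \<noteq> q2" for y
    using fib[of y q2] that by (auto simp: a_def)
  have ub: "u y \<noteq> b" if "y \<in> points S" "y \<noteq> q1" for y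
    using fib[of y q1] that by (auto simp: b_def)
  have g1: "g y \<noteq> q1" if "y \<in> points S" "y \<noteq> q1" for y
    using ginj[OF that(1) q(1)] g(2) that(2) by auto
  have g2: "g y \<noteq> q2" if "y \<in> points S" "y \<noteq> q2" for y
    using ginj[OF that(1) q(2)] g(3) that(2) by auto
  define v where "v = (\<lambda>y. sphere_coord a b (u y))"
  define v' where "v' = (\<lambda>y. sphere_coord b a (u y))"
  have inv: "v' y = inverse (v y)" for y by (simp add: v_def v'_def inverse_sphere_coord)
  have hv: "holo_at S v y" if "y \<in> points S - {q1}" for y
    unfolding v_def using holo_at_sphere_coord[OF S u _ ub] that by blast
  have hv': "holo_at S v' y" if "y \<in> points S - {q2}" for y
    unfolding v'_def using holo_at_sphere_coord[OF S u _ ua] that by blast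
  have vn: "v y \<noteq> 0" if "y \<in> points S" "y \<noteq> q1" "y \<noteq> q2" for y
    using sphere_coord_eq_0[OF ub] ua that by (simp add: v_def)
  have v2: "v q2 = 0" using sphere_coord_eq_0[OF ub, of q2 a] q by (simp add: v_def a_def)
  have v1: "v' q1 = 0" using sphere_coord_eq_0[OF ua, of q1 b] q by (simp add: v'_def b_def)
  define \<rho> where "\<rho> = (\<lambda>y. v (g y) / v y)"
  have hr: "holo_at S \<rho> y" if y: "y \<in> points S - {q1, q2}" for y
  proof -
    have y1: "y \<in> points S" "y \<noteq> q1" "y \<noteq> q2" using y by auto
    have "g y \<in> points S - {q1}" using gp[OF y1(1)] g1[OF y1(1,2)] by blast
    then have "holo_at S (v \<circ> g) y"
      by (rule holo_at_compose[OF S S AutD(3)[OF g(1)] y1(1) hv])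
    then have 1: "holo_at S (\<lambda>y. v (g y)) y" by (simp add: o_def)
    have 2: "holo_at S v y" by (rule hv) (simp add: y1)
    show ?thesis unfolding \<rho>_def by (rule holo_at_divide[OF S 1 2 vn[OF y1]])
  qed
  have o1: "openin (rs_top S) (points S - {q1})" and o2: "openin (rs_top S) (points S - {q2})"
    by (rule openin_Diff_finite[OF S openin_topspace], simp)+
  have bdd: "\<exists>W B. openin (rs_top S) W \<and> y \<in> W \<and> (\<forall>z\<in>W - {q1, q2}. cmod (\<rho> z) \<le> B)"
    if y: "y \<in> points S \<inter> {q1, q2}" for y
  proof (cases "y = q2")
    case True
    have "q2 \<in> points S - {q1}" using q by auto
    moreover have "v z \<noteq> 0" if "z \<in> points S - {q1} - {q2}" for z using vn that by auto
    ultimately obtain W B where W: "openin (rs_top S) W" "q2 \<in> W"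
        "\<And>z. z \<in> W - {q2} \<Longrightarrow> cmod (v (g z) / v z) \<le> B"
      using holo_zero_ratio_bounded[OF S o1 _ hv v2 _ AutD(3)[OF g(1)] g(3)] by metis
    have "\<forall>z\<in>W - {q1, q2}. cmod (\<rho> z) \<le> B"
      using W(3) unfolding \<rho>_def by blast
    with W(1,2) True show ?thesis by blast
  next
    case False
    then have yq: "y = q1" using y by auto
    \<comment> \<open>At the pole, with \<open>w = g z\<close>, the quotient equals
      \<open>v' (h w) / v' w\<close> for the reciprocal coordinate \<open>v'\<close> and the inverse
      \<open>h\<close> of \<open>g\<close>, so the estimate at a zero applies once more.\<close>
    define h where "h = inv_into (points S) g"
    have hol: "holomorphic_map S S h"
      using g(1) by (simp add: h_def Aut_def biholomorphic_map_def)
    have hg: "h (g z) = z" if "z \<in> points S" for z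
      using bij_betw_inv_into_left[OF bij that] by (simp add: h_def)
    have hq: "h q1 = q1" using hg[OF q(1)] g(2) by simp
    have "q1 \<in> points S - {q2}" using q by auto
    moreover have "v' z \<noteq> 0" if "z \<in> points S - {q2} - {q1}" for z using vn that by (auto simp: inv)
    ultimately obtain W B where W: "openin (rs_top S) W" "q1 \<in> W"
        "\<And>z. z \<in> W - {q1} \<Longrightarrow> cmod (v' (h z) / v' z) \<le> B"
      using holo_zero_ratio_bounded[OF S o2 _ hv' v1 _ hol hq] by metis
    define W' where "W' = {z \<in> points S. g z \<in> W}"
    have "openin (rs_top S) W'"
      unfolding W'_def by (rule continuous_map_vimage_openin[OF AutD(5)[OF g(1)] W(1) openin_topspace])
    moreover have "q1 \<in> W'" using q W(2) g(2) by (simp add: W'_def)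
    moreover have "cmod (\<rho> z) \<le> B" if z: "z \<in> W' - {q1, q2}" for z
    proof -
      have zp: "z \<in> points S" "z \<noteq> q1" "g z \<in> W" using z by (auto simp: W'_def)
      have "g z \<in> W - {q1}" using zp g1 by blast
      from W(3)[OF this] show ?thesis
        by (simp add: hg[OF zp(1)] inv \<rho>_def field_simps)
    qed
    ultimately show ?thesis using yq by blast
  qed
  obtain c where c: "\<forall>y\<in>points S - {q1, q2}. \<rho> y = c"
    using bounded_holo_constant[OF S comp _ hr bdd] by blast
  have q3: "q3 \<in> points S - {q1, q2}" using q by auto
  have "\<rho> q3 = 1" using vn[of q3] q g(4) by (auto simp: \<rho>_def)
  then have c1: "c = 1" using c q3 by metis
  show ?thesis
  proof (cases "x \<in> {q1, q2}")
    case True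
    then show ?thesis using g by auto
  next
    case False
    then have xn: "x \<noteq> q1" "x \<noteq> q2" by auto
    then have "\<rho> x = 1" using c c1 x by simp
    then have "v (g x) = v x" using vn[OF x xn] by (simp add: \<rho>_def)
    then show ?thesis
      using sphere_coord_inj[OF ab ub[OF gp[OF x] g1[OF x xn(1)]] ub[OF x xn(1)]] by (simp add: v_def)
  qed
qed

section \<open>Powers of an automorphism of prime order\<close>

lemma (in group) nat_pow_eq_iff_cong:
  assumes "x \<in> carrier G"
  shows "x [^] (m::nat) = x [^] (n::nat) \<longleftrightarrow> [m = n] (mod ord x)"
proof -
  have "x [^] m = x [^] n \<longleftrightarrow> int (ord x) dvd int n - int m"
    using int_pow_eq[OF assms, of "int m" "int n"] by (simp add: int_pow_int)
  also have "\<dots> \<longleftrightarrow> [m = n] (mod ord x)"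
    by (simp add: cong_iff_dvd_diff dvd_diff_commute flip: cong_int_iff)
  finally show ?thesis .
qed

lemma Aut_pow_Suc:
  assumes "riemann_surface S" "T \<in> carrier (Aut S)" "x \<in> points S"
  shows "(T [^]\<^bsub>Aut S\<^esub> Suc n) x = (T [^]\<^bsub>Aut S\<^esub> n) (T x)"
    "(T [^]\<^bsub>Aut S\<^esub> (0::nat)) x = x"
proof -
  interpret group "Aut S" by (rule group_Aut[OF assms(1)])
  show "(T [^]\<^bsub>Aut S\<^esub> Suc n) x = (T [^]\<^bsub>Aut S\<^esub> n) (T x)"
    using Aut_mult_apply[OF nat_pow_closed[OF assms(2), of n] assms(2,3)] by simp
  show "(T [^]\<^bsub>Aut S\<^esub> (0::nat)) x = x"
    using Aut_one_apply[OF assms(3)] by simp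
qed

lemma Aut_pow_fix:
  assumes "riemann_surface S" "T \<in> carrier (Aut S)" "x \<in> points S" "T x = x"
  shows "(T [^]\<^bsub>Aut S\<^esub> (n::nat)) x = x"
  by (induction n) (simp_all add: Aut_pow_Suc[OF assms(1-3)] assms(4) del: nat_pow_Suc nat_pow_0)

text \<open>Since \<open>n\<close> is invertible modulo \<open>p\<close>, \<open>T\<close> is itself
  a power of its \<open>n\<close>-th power.\<close>

lemma Aut_pow_fix_prime:
  assumes S: "riemann_surface S" and T: "T \<in> carrier (Aut S)" and x: "x \<in> points S"
    and p: "prime p" "group.ord (Aut S) T = p"
    and n: "(T [^]\<^bsub>Aut S\<^esub> (n::nat)) x = x" "\<not> p dvd n"
  shows "T x = x"
proof -
  interpret group "Aut S" by (rule group_Aut[OF S])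
  have "coprime n p" using p n by (metis prime_imp_coprime coprime_commute)
  then obtain a where a: "[n * a = 1] (mod p)"
    using cong_solve_coprime_nat by (metis One_nat_def)
  have e: "T [^]\<^bsub>Aut S\<^esub> (n * a) = T"
    using nat_pow_eq_iff_cong[OF T, of "n * a" 1] a p(2) T by simp
  have "((T [^]\<^bsub>Aut S\<^esub> n) [^]\<^bsub>Aut S\<^esub> a) x = x"
    by (rule Aut_pow_fix[OF S nat_pow_closed[OF T] x n(1)])
  then show ?thesis by (simp add: nat_pow_pow[OF T] e)
qed

text \<open>Off the fixed points, the exponent below \<open>p\<close> by which \<open>g\<close>
  moves \<open>x\<close> along its orbit is unique, and it is locally constant because the space is
  Hausdorff. To pass to a global constant, the exponent is regarded as a holomorphic function
  bounded by \<open>p\<close>, which is constant by \<open>bounded_holo_constant\<close>; this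
  replaces the connectedness of the complement of a finite set.\<close>

lemma orbit_preserving_imp_power:
  assumes S: "riemann_surface S" and comp: "compact_space (rs_top S)"
    and T: "T \<in> carrier (Aut S)" and p: "prime p" "group.ord (Aut S) T = p"
    and fin: "finite (Fix S T)" and g: "g \<in> carrier (Aut S)"
    and orb: "\<And>x. x \<in> points S \<Longrightarrow> \<exists>n::nat. g x = (T [^]\<^bsub>Aut S\<^esub> n) x"
  shows "\<exists>n::nat. g = T [^]\<^bsub>Aut S\<^esub> n"
proof -
  interpret group "Aut S" by (rule group_Aut[OF S])
  have haus: "Hausdorff_space (rs_top S)" using S unfolding riemann_surface_def by blast
  have p0: "p > 0" using p(1) by (rule prime_gt_0_nat)
  have Tc: "T [^]\<^bsub>Aut S\<^esub> n \<in> carrier (Aut S)" for n :: nat by (rule nat_pow_closed[OF T])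
  have uniq: "m = n" if "m < p" "n < p" "x \<in> points S - Fix S T"
      "(T [^]\<^bsub>Aut S\<^esub> m) x = (T [^]\<^bsub>Aut S\<^esub> n) x" for m n :: nat and x
    using that
  proof (induction m n rule: linorder_wlog)
    case (le m n)
    have xp: "x \<in> points S" and nf: "T x \<noteq> x" using le by (auto simp: Fix_def)
    have "(T [^]\<^bsub>Aut S\<^esub> m) ((T [^]\<^bsub>Aut S\<^esub> (n - m)) x) = (T [^]\<^bsub>Aut S\<^esub> m) x"
      using Aut_mult_apply[OF Tc Tc xp, of m "n - m"] le by (simp add: nat_pow_mult[OF T])
    then have "(T [^]\<^bsub>Aut S\<^esub> (n - m)) x = x"
      using AutD(2)[OF Tc, of m] AutD(4)[OF Tc xp] xp by (auto simp: bij_betw_def inj_on_def)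
    then have "p dvd n - m" using Aut_pow_fix_prime[OF S T xp p] nf by blast
    then show ?case using le p0 by (auto dest!: dvd_imp_le)
  qed metis
  have orb': "\<exists>n<p. g x = (T [^]\<^bsub>Aut S\<^esub> n) x" if x: "x \<in> points S" for x
  proof -
    obtain n :: nat where n: "g x = (T [^]\<^bsub>Aut S\<^esub> n) x" using orb[OF x] by blast
    have "T [^]\<^bsub>Aut S\<^esub> n = T [^]\<^bsub>Aut S\<^esub> (n mod p)"
      by (simp add: nat_pow_eq_iff_cong[OF T] p(2) cong_def)
    then show ?thesis using n p0 by (intro exI[of _ "n mod p"]) simp
  qed
  define N where "N = (\<lambda>x. THE n. n < p \<and> g x = (T [^]\<^bsub>Aut S\<^esub> n) x)"
  have N_eq: "N x = n" if "x \<in> points S - Fix S T" "n < p" "g x = (T [^]\<^bsub>Aut S\<^esub> n) x" for x n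
    unfolding N_def
  proof (rule the_equality)
    show "n < p \<and> g x = (T [^]\<^bsub>Aut S\<^esub> n) x" using that by simp
    show "m = n" if "m < p \<and> g x = (T [^]\<^bsub>Aut S\<^esub> m) x" for m
      by (rule uniq[of m n x]) (use that \<open>x \<in> points S - Fix S T\<close> \<open>n < p\<close> \<open>g x = _\<close> in simp_all)
  qed
  have o: "openin (rs_top S) (points S - Fix S T)"
    by (rule openin_Diff_finite[OF S openin_topspace fin])
  have loc: "\<exists>W n. openin (rs_top S) W \<and> x \<in> W \<and> (\<forall>y\<in>W. N y = n)"
    if x: "x \<in> points S - Fix S T" for x
  proof -
    have xp: "x \<in> points S" using x by blast
    obtain n where n: "n < p" "g x = (T [^]\<^bsub>Aut S\<^esub> n) x" using orb'[OF xp] by blast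
    have sep: "\<exists>W. openin (rs_top S) W \<and> x \<in> W \<and> (\<forall>y\<in>W. g y \<noteq> (T [^]\<^bsub>Aut S\<^esub> m) y)"
      if m: "m \<in> {..<p} - {n}" for m
    proof -
      have "g x \<noteq> (T [^]\<^bsub>Aut S\<^esub> m) x" using uniq[OF _ n(1) x, of m] m n(2) by auto
      then obtain V1 V2 where V: "openin (rs_top S) V1" "openin (rs_top S) V2" "g x \<in> V1"
          "(T [^]\<^bsub>Aut S\<^esub> m) x \<in> V2" "disjnt V1 V2"
        using haus AutD(4)[OF g xp] AutD(4)[OF Tc xp] unfolding Hausdorff_space_def by metis
      define W where "W = {y \<in> {y \<in> points S. g y \<in> V1}. (T [^]\<^bsub>Aut S\<^esub> m) y \<in> V2}"
      have "openin (rs_top S) W"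
        unfolding W_def
        by (intro continuous_map_vimage_openin[OF AutD(5)[OF Tc] V(2)]
            continuous_map_vimage_openin[OF AutD(5)[OF g] V(1)] openin_topspace)
      moreover have "x \<in> W" using xp V by (simp add: W_def)
      moreover have "\<forall>y\<in>W. g y \<noteq> (T [^]\<^bsub>Aut S\<^esub> m) y"
        using V(5) by (auto simp: W_def disjnt_iff)
      ultimately show ?thesis by blast
    qed
    then obtain W where W: "\<And>m. m \<in> {..<p} - {n} \<Longrightarrow> openin (rs_top S) (W m)"
        "\<And>m. m \<in> {..<p} - {n} \<Longrightarrow> x \<in> W m"
        "\<And>m y. m \<in> {..<p} - {n} \<Longrightarrow> y \<in> W m \<Longrightarrow> g y \<noteq> (T [^]\<^bsub>Aut S\<^esub> m) y"
      by metis
    \<comment> \<open>Each \<open>W m\<close> rules out the exponent \<open>m\<close>; on the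
      intersection only \<open>n\<close> is left.\<close>
    define V where "V = \<Inter> (insert (points S - Fix S T) (W ` ({..<p} - {n})))"
    have "openin (rs_top S) V"
      unfolding V_def by (rule openin_Inter) (use W(1) o in auto)
    moreover have "x \<in> V" using W(2) x by (auto simp: V_def)
    moreover have "N y = n" if y: "y \<in> V" for y
    proof -
      have yp: "y \<in> points S - Fix S T" using y by (auto simp: V_def)
      obtain m where m: "m < p" "g y = (T [^]\<^bsub>Aut S\<^esub> m) y" using orb'[of y] yp by blast
      have "m = n"
      proof (rule ccontr)
        assume "m \<noteq> n"
        then have "m \<in> {..<p} - {n}" using m by simp
        then show False using W(3)[of m y] y m(2) by (auto simp: V_def)
      qed
      then show ?thesis using N_eq[OF yp m] by simp
    qed
    ultimately show ?thesis by blast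
  qed
  have hN: "holo_at S (\<lambda>x. of_nat (N x)) x" if x: "x \<in> points S - Fix S T" for x
  proof -
    obtain W n where W: "openin (rs_top S) W" "x \<in> W" "\<forall>y\<in>W. N y = n" using loc[OF x] by blast
    show ?thesis
      by (rule holo_at_cong[OF S holo_at_const[of S "of_nat n"] W(1,2)]) (use W(3) in simp)
  qed
  have "\<exists>c. \<forall>x\<in>points S - Fix S T. (of_nat (N x) :: complex) = c"
  proof (rule bounded_holo_constant[OF S comp fin hN])
    fix x assume x: "x \<in> points S \<inter> Fix S T"
    have "cmod (of_nat (N y)) \<le> real p" if y: "y \<in> points S - Fix S T" for y
    proof -
      obtain n where "n < p" "g y = (T [^]\<^bsub>Aut S\<^esub> n) y" using orb'[of y] y by blast
      then show ?thesis using N_eq[OF y] by simp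
    qed
    then show "\<exists>W B. openin (rs_top S) W \<and> x \<in> W \<and> (\<forall>y\<in>W - Fix S T. cmod (of_nat (N y)) \<le> B)"
      using x by (intro exI[of _ "points S"] exI[of _ "real p"]) auto
  qed
  then obtain c :: complex where c: "\<And>x. x \<in> points S - Fix S T \<Longrightarrow> of_nat (N x) = c" by blast
  obtain n where n: "\<And>x. x \<in> points S - Fix S T \<Longrightarrow> N x = n"
  proof (cases "points S - Fix S T = {}")
    case False
    then obtain a where "a \<in> points S - Fix S T" by blast
    then have "N x = N a" if "x \<in> points S - Fix S T" for x
      using c[OF that] c[of a] by (metis of_nat_eq_iff)
    then show ?thesis using that by blast
  qed (use that in blast)
  have "g = T [^]\<^bsub>Aut S\<^esub> n"
  proof (rule Aut_ext[OF g Tc])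
    fix x assume x: "x \<in> points S"
    show "g x = (T [^]\<^bsub>Aut S\<^esub> n) x"
    proof (cases "x \<in> Fix S T")
      case True
      then have "T x = x" by (simp add: Fix_def)
      then show ?thesis using orb[OF x] Aut_pow_fix[OF S T x] by auto
    next
      case False
      then have xf: "x \<in> points S - Fix S T" using x by blast
      obtain m where m: "m < p" "g x = (T [^]\<^bsub>Aut S\<^esub> m) x" using orb'[OF x] by blast
      then show ?thesis using N_eq[OF xf m] n[OF xf] by simp
    qed
  qed
  then show ?thesis by blast
qed

section \<open>The unit disc\<close>

lemma points_unit_disc [simp]: "points unit_disc = ball 0 1"
  by (simp add: unit_disc_def)

lemma charts_unit_disc: "rs_charts unit_disc = {(ball 0 1, \<lambda>z. z)}"
  by (simp add: unit_disc_def)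

lemma inv_into_ident: "z \<in> A \<Longrightarrow> inv_into A (\<lambda>z. z) z = z"
  by (metis f_inv_into_f image_ident)

lemma riemann_surface_unit_disc: "riemann_surface unit_disc"
proof -
  have "connected_space (top_of_set (ball (0::complex) 1))"
    using connected_ball[of "0::complex" 1] connectedin_iff_connected unfolding connectedin_def by blast
  moreover have "Hausdorff_space (top_of_set (ball (0::complex) 1))"
    by (rule Hausdorff_space_subtopology) simp
  moreover have "homeomorphic_map (top_of_set (ball (0::complex) 1)) (top_of_set (ball 0 1)) (\<lambda>z. z)"
    using homeomorphic_map_id[of "top_of_set (ball (0::complex) 1)" "top_of_set (ball 0 1)"]
    by (simp add: id_def)
  moreover have "((\<lambda>z. z) \<circ> inv_into (ball 0 1) (\<lambda>z. z)) holomorphic_on (ball (0::complex) 1)"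
    by (rule holomorphic_transform[of "\<lambda>z. z"]) (auto simp: inv_into_ident)
  ultimately show ?thesis
    unfolding riemann_surface_def charts_unit_disc points_unit_disc
    by (simp add: unit_disc_def subtopology_subtopology)
qed

lemma group_Aut_unit_disc: "group (Aut unit_disc)"
  by (rule group_Aut[OF riemann_surface_unit_disc])

lemma holomorphic_map_unit_disc:
  assumes "f holomorphic_on ball 0 1" "f ` ball 0 1 \<subseteq> ball 0 1"
  shows "holomorphic_map unit_disc unit_disc f"
proof -
  have "continuous_map (top_of_set (ball 0 1)) (top_of_set (ball 0 1)) f"
    using holomorphic_on_imp_continuous_on[OF assms(1)] assms(2) by (auto simp: image_subset_iff)
  moreover have "((\<lambda>z. z) \<circ> f \<circ> inv_into (ball 0 1) (\<lambda>z. z)) holomorphic_on {x \<in> ball 0 1. f x \<in> ball 0 1}"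
    by (rule holomorphic_transform[of f])
       (use assms in \<open>auto simp: inv_into_ident intro: holomorphic_on_subset\<close>)
  ultimately show ?thesis
    unfolding holomorphic_map_def charts_unit_disc by (simp add: unit_disc_def)
qed

lemma holomorphic_map_unit_discD:
  assumes "holomorphic_map unit_disc unit_disc f"
  shows "f holomorphic_on ball 0 1"
proof -
  have f: "f ` ball 0 1 \<subseteq> ball 0 1"
    using continuous_map_in_topspace[OF holomorphic_map_continuous[OF assms]] by auto
  have "((\<lambda>z. z) \<circ> f \<circ> inv_into (ball 0 1) (\<lambda>z. z)) holomorphic_on ((\<lambda>z. z) ` {x \<in> ball 0 1. f x \<in> ball 0 1})"
    using assms unfolding holomorphic_map_def charts_unit_disc by simp
  moreover have "(\<lambda>z. z) ` {x \<in> ball 0 1. f x \<in> ball 0 1} = ball 0 1" using f by auto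
  ultimately have "((\<lambda>z. z) \<circ> f \<circ> inv_into (ball 0 1) (\<lambda>z. z)) holomorphic_on ball 0 1" by simp
  then show ?thesis
    by (rule holomorphic_transform) (simp add: inv_into_ident)
qed

lemma Aut_unit_discI:
  assumes "f \<in> extensional (ball 0 1)" "f holomorphic_on ball 0 1" "g holomorphic_on ball 0 1"
    and "f ` ball 0 1 \<subseteq> ball 0 1" "g ` ball 0 1 \<subseteq> ball 0 1"
    and "\<And>z. z \<in> ball 0 1 \<Longrightarrow> g (f z) = z" "\<And>z. z \<in> ball 0 1 \<Longrightarrow> f (g z) = z"
  shows "f \<in> carrier (Aut unit_disc)"
proof -
  have bij: "bij_betw f (ball 0 1) (ball 0 1)"
    by (rule bij_betw_byWitness[where f' = g]) (use assms in auto)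
  have "inv_into (ball 0 1) f z = g z" if "z \<in> ball 0 1" for z
    using inv_into_f_eq[OF bij_betw_imp_inj_on[OF bij], of "g z" z] assms(5,7) that by blast
  then have "inv_into (ball 0 1) f holomorphic_on ball 0 1" "inv_into (ball 0 1) f ` ball 0 1 \<subseteq> ball 0 1"
    using assms(3,5) holomorphic_cong[of "ball 0 1" "ball 0 1" "inv_into (ball 0 1) f" g] by auto
  then show ?thesis
    using assms(1,2,4) bij
    by (simp add: Aut_def Bij_def biholomorphic_map_def holomorphic_map_unit_disc)
qed

lemma Aut_unit_discD:
  assumes "f \<in> carrier (Aut unit_disc)"
  shows "f \<in> extensional (ball 0 1)" "bij_betw f (ball 0 1) (ball 0 1)" "f holomorphic_on ball 0 1"
    "inv_into (ball 0 1) f holomorphic_on ball 0 1" "\<And>z. z \<in> ball 0 1 \<Longrightarrow> f z \<in> ball 0 1"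
proof -
  show "f \<in> extensional (ball 0 1)"
    using AutD(1)[OF assms] by (simp add: Bij_def)
  show "bij_betw f (ball 0 1) (ball 0 1)" using AutD(2)[OF assms] by simp
  show "f holomorphic_on ball 0 1" using AutD(3)[OF assms] holomorphic_map_unit_discD by blast
  show "inv_into (ball 0 1) f holomorphic_on ball 0 1"
    using assms by (auto simp: Aut_def biholomorphic_map_def intro: holomorphic_map_unit_discD)
  show "\<And>z. z \<in> ball 0 1 \<Longrightarrow> f z \<in> ball 0 1" using AutD(4)[OF assms] by simp
qed

section \<open>Moebius maps and Schwarz's lemma\<close>

abbreviation moebius :: "complex \<Rightarrow> complex \<Rightarrow> complex" where
  "moebius \<equiv> Moebius_function 0"

lemma moebius_in_ball [simp]:
  assumes "cmod a < 1" "cmod z < 1"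
  shows "cmod (moebius a z) < 1"
  using Moebius_function_norm_lt_1 assms by blast

lemma moebius_inverse [simp]:
  assumes "cmod a < 1" "cmod z < 1"
  shows "moebius (- a) (moebius a z) = z" "moebius a (moebius (- a) z) = z"
  using Moebius_function_compose assms by simp_all

lemma moebius_self [simp]: "moebius a a = 0"
  by (rule Moebius_function_eq_zero)

lemma moebius_zero: "moebius (- a) 0 = a"
  by (simp add: Moebius_function_of_zero)

lemma moebius_eq_0_iff:
  assumes "cmod a < 1" "cmod z < 1"
  shows "moebius a z = 0 \<longleftrightarrow> z = a"
  using moebius_inverse(1)[OF assms] moebius_zero[of a] by auto

lemma moebius_eq_iff:
  assumes "cmod a < 1" "cmod z < 1" "cmod w < 1"
  shows "moebius a z = moebius a w \<longleftrightarrow> z = w"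
  using moebius_inverse(1)[OF assms(1,2)] moebius_inverse(1)[OF assms(1,3)] by metis

lemma norm_moebius_commute: "cmod (moebius a b) = cmod (moebius b a)"
proof -
  have "cmod (1 - cnj a * b) = cmod (1 - cnj b * a)"
    by (metis complex_cnj_cnj complex_cnj_diff complex_cnj_mult complex_cnj_one complex_mod_cnj mult.commute)
  then show ?thesis
    by (simp add: Moebius_function_simple norm_divide norm_minus_commute)
qed

lemma Aut_moebius:
  assumes "cmod a < 1"
  shows "(\<lambda>z\<in>ball 0 1. moebius a z) \<in> carrier (Aut unit_disc)"
proof (rule Aut_unit_discI[where g = "moebius (- a)"])
  show "(\<lambda>z\<in>ball 0 1. moebius a z) holomorphic_on ball 0 1"
    by (rule holomorphic_transform[OF Moebius_function_holomorphic[OF assms, of 0]]) simp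
  show "moebius (- a) holomorphic_on ball 0 1"
    using assms by (intro Moebius_function_holomorphic) simp
qed (use assms in auto)

text \<open>In the coordinates centred at \<open>a\<close> and \<open>f a\<close> an automorphism fixes the origin, so it is a
  rotation by Schwarz's lemma.\<close>

lemma Aut_unit_disc_moebius:
  assumes f: "f \<in> carrier (Aut unit_disc)" and a: "cmod a < 1"
  obtains c where "cmod c = 1" "\<And>z. cmod z < 1 \<Longrightarrow> moebius (f a) (f z) = c * moebius a z"
proof -
  define g where "g = inv_into (ball 0 1) f"
  note D = Aut_unit_discD[OF f]
  have fb: "cmod (f z) < 1" if "cmod z < 1" for z using D(5)[of z] that by simp
  have fa: "cmod (f a) < 1" by (rule fb[OF a])
  have gf: "g (f z) = z" if "cmod z < 1" for z
    using bij_betw_inv_into_left[OF D(2), of z] that by (simp add: g_def)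
  have fg: "f (g z) = z" if "cmod z < 1" for z
    using bij_betw_inv_into_right[OF D(2), of z] that by (simp add: g_def)
  have gb: "cmod (g z) < 1" if "cmod z < 1" for z
    using bij_betw_apply[OF bij_betw_inv_into[OF D(2)], of z] that by (simp add: g_def)
  have hm: "moebius b holomorphic_on ball 0 1" if "cmod b < 1" for b
    by (rule Moebius_function_holomorphic[OF that])
  have comp: "(\<lambda>z. moebius b (k (moebius (- c) z))) holomorphic_on ball 0 1"
    if "k holomorphic_on ball 0 1" "\<And>z. cmod z < 1 \<Longrightarrow> cmod (k z) < 1" "cmod b < 1" "cmod c < 1" for k b c
  proof -
    have c': "cmod (- c) < 1" using that(4) by simp
    have "(k \<circ> moebius (- c)) holomorphic_on ball 0 1"
      by (rule holomorphic_on_compose_gen[OF hm[OF c'] that(1)]) (use that(4) in auto)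
    then have "(moebius b \<circ> (k \<circ> moebius (- c))) holomorphic_on ball 0 1"
      by (rule holomorphic_on_compose_gen[OF _ hm[OF that(3)]]) (use that(2,4) in auto)
    then show ?thesis by (simp add: o_def)
  qed
  define F where "F = (\<lambda>z. moebius (f a) (f (moebius (- a) z)))"
  define G where "G = (\<lambda>z. moebius a (g (moebius (- f a) z)))"
  have F: "F holomorphic_on ball 0 1" unfolding F_def by (rule comp[OF D(3) fb fa a])
  have G: "G holomorphic_on ball 0 1" unfolding G_def
    by (rule comp[OF _ gb a fa]) (use D(4) in \<open>simp_all add: g_def\<close>)
  have F0: "F 0 = 0" by (simp add: F_def moebius_zero)
  have G0: "G 0 = 0" by (simp add: G_def moebius_zero gf a)
  have Fb: "cmod (F z) < 1" if "cmod z < 1" for z using that a fa fb by (simp add: F_def)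
  have Gb: "cmod (G z) < 1" if "cmod z < 1" for z using that a fa gb by (simp add: G_def)
  have GF: "G (F z) = z" if "cmod z < 1" for z
    using that a fa fb gf by (simp add: F_def G_def)
  \<comment> \<open>Schwarz's inequality for \<open>F\<close> and for its inverse \<open>G\<close>
    forces equality at the sample point 1/2, and equality at one nonzero point makes
    \<open>F\<close> a rotation.\<close>
  have h: "cmod (1/2::complex) < 1" by simp
  have "cmod (F (1/2)) \<le> cmod (1/2)" by (rule Schwarz_Lemma(1)[OF F F0 Fb h])
  moreover have "cmod (G (F (1/2))) \<le> cmod (F (1/2))" by (rule Schwarz_Lemma(1)[OF G G0 Gb Fb[OF h]])
  ultimately have "cmod (F (1/2)) = cmod (1/2)" using GF[OF h] by simp
  then have "\<exists>z. cmod z < 1 \<and> z \<noteq> 0 \<and> cmod (F z) = cmod z"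
    by (intro exI[of _ "1/2"]) simp
  then obtain c where c: "\<And>z. cmod z < 1 \<Longrightarrow> F z = c * z" "cmod c = 1"
    using Schwarz_Lemma(3)[OF F F0 Fb h] by blast
  have "moebius (f a) (f z) = c * moebius a z" if "cmod z < 1" for z
    using c(1)[of "moebius a z"] a that by (simp add: F_def)
  with c(2) show ?thesis by (rule that)
qed

lemma norm_moebius_Aut:
  assumes "f \<in> carrier (Aut unit_disc)" "cmod a < 1" "cmod b < 1"
  shows "cmod (moebius (f a) (f b)) = cmod (moebius a b)"
  using Aut_unit_disc_moebius[OF assms(1,2)] assms(3) by (metis norm_mult mult_1)

lemma norm_moebius_moebius:
  assumes "cmod a < 1" "cmod m < 1" "cmod b < 1"
  shows "cmod (moebius (moebius a m) (moebius a b)) = cmod (moebius m b)"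
  using norm_moebius_Aut[OF Aut_moebius[OF assms(1)] assms(2,3)] assms by simp

section \<open>Hyperbolic rotations and half-turns\<close>

lemma hyp_rotation_in_ball [simp]:
  assumes "cmod a < 1" "cmod z < 1"
  shows "cmod (hyp_rotation a \<theta> z) < 1"
  using assms by (simp add: hyp_rotation_def norm_mult)

lemma moebius_hyp_rotation:
  assumes "cmod a < 1" "cmod z < 1"
  shows "moebius a (hyp_rotation a \<theta> z) = cis \<theta> * moebius a z"
  using assms by (simp add: hyp_rotation_def norm_mult)

lemma hyp_rotation_eqI:
  assumes "cmod a < 1" "cmod z < 1" "cmod w < 1" "moebius a w = cis \<theta> * moebius a z"
  shows "hyp_rotation a \<theta> z = w"
  using moebius_eq_iff[of a "hyp_rotation a \<theta> z" w] moebius_hyp_rotation[OF assms(1,2), of \<theta>] assms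
  by simp

lemma hyp_rotation_self [simp]: "cmod a < 1 \<Longrightarrow> hyp_rotation a \<theta> a = a"
  by (rule hyp_rotation_eqI) simp_all

lemma hyp_rotation_compose:
  assumes "cmod a < 1" "cmod z < 1"
  shows "hyp_rotation a \<theta> (hyp_rotation a \<eta> z) = hyp_rotation a (\<theta> + \<eta>) z"
  using assms by (intro hyp_rotation_eqI) (simp_all add: moebius_hyp_rotation cis_mult[symmetric])

lemma hyp_rotation_0:
  assumes "cmod a < 1" "cmod z < 1"
  shows "hyp_rotation a 0 z = z"
  using assms by (intro hyp_rotation_eqI) simp_all

lemma hyp_rotation_holomorphic:
  assumes "cmod a < 1"
  shows "hyp_rotation a \<theta> holomorphic_on ball 0 1"
proof -
  have a': "cmod (- a) < 1" using assms by simp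
  have "(\<lambda>z. cis \<theta> * moebius a z) holomorphic_on ball 0 1"
    by (intro holomorphic_intros Moebius_function_holomorphic[OF assms])
  then have "(moebius (- a) \<circ> (\<lambda>z. cis \<theta> * moebius a z)) holomorphic_on ball 0 1"
    by (rule holomorphic_on_compose_gen[OF _ Moebius_function_holomorphic[OF a']])
       (use assms in \<open>auto simp: norm_mult\<close>)
  then show ?thesis
    by (rule holomorphic_transform) (simp add: hyp_rotation_def)
qed

lemma Aut_hyp_rotation:
  assumes "cmod a < 1"
  shows "hyp_rotation a \<theta> \<in> carrier (Aut unit_disc)"
proof (rule Aut_unit_discI[where g = "hyp_rotation a (- \<theta>)"])
  show "hyp_rotation a \<theta> \<in> extensional (ball 0 1)" by (simp add: hyp_rotation_def)
qed (use assms in \<open>auto simp: hyp_rotation_holomorphic hyp_rotation_compose hyp_rotation_0\<close>)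

text \<open>Between the coordinates centred at \<open>a\<close> and at \<open>f a\<close>, the
  automorphism is multiplication by a constant, which commutes with multiplication by
  \<open>cis \<theta>\<close>.\<close>

lemma hyp_rotation_conj:
  assumes f: "f \<in> carrier (Aut unit_disc)" and a: "cmod a < 1" and z: "cmod z < 1"
  shows "f (hyp_rotation a \<theta> z) = hyp_rotation (f a) \<theta> (f z)"
proof -
  have fb: "cmod (f z) < 1" if "cmod z < 1" for z using Aut_unit_discD(5)[OF f, of z] that by simp
  obtain c where c: "\<And>z. cmod z < 1 \<Longrightarrow> moebius (f a) (f z) = c * moebius a z"
    using Aut_unit_disc_moebius[OF f a] by blast
  show ?thesis
    by (rule hyp_rotation_eqI[symmetric])
       (use a z fb in \<open>simp_all add: c moebius_hyp_rotation\<close>)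
qed

lemma half_turn_in_ball [simp]: "cmod m < 1 \<Longrightarrow> cmod z < 1 \<Longrightarrow> cmod (half_turn m z) < 1"
  by (simp add: half_turn_def)

lemma half_turn_half_turn [simp]:
  assumes "cmod m < 1" "cmod z < 1"
  shows "half_turn m (half_turn m z) = z"
  using hyp_rotation_compose[OF assms, of pi pi]
  by (simp add: half_turn_def) (use assms in \<open>simp add: hyp_rotation_def\<close>)

lemma Aut_half_turn: "cmod m < 1 \<Longrightarrow> half_turn m \<in> carrier (Aut unit_disc)"
  unfolding half_turn_def by (rule Aut_hyp_rotation)

section \<open>Hyperbolic midpoints\<close>

lemma tanh_artanh_real:
  fixes s :: real
  assumes "-1 < s" "s < 1"
  shows "tanh (artanh s) = s"
proof -
  have "exp (- 2 * artanh s) = exp (- ln ((1 + s) / (1 - s)))"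
    by (simp add: artanh_def)
  also have "\<dots> = (1 - s) / (1 + s)"
    using assms by (simp add: exp_minus)
  finally have e: "exp (- 2 * artanh s) = (1 - s) / (1 + s)" .
  show ?thesis unfolding tanh_real_altdef e using assms by (simp add: field_simps)
qed

lemma artanh_eq_iff:
  fixes x y :: real
  assumes "\<bar>x\<bar> < 1" "\<bar>y\<bar> < 1"
  shows "artanh x = artanh y \<longleftrightarrow> x = y"
proof
  assume "artanh x = artanh y"
  then have "tanh (artanh x) = tanh (artanh y)" by simp
  then show "x = y" using assms by (simp add: tanh_artanh_real)
qed simp

text \<open>\<open>hyp_dist\<close> is \<open>2 * artanh\<close> of the modulus \<open>s\<close> of
  a Moebius image, so \<open>t\<close> is the modulus that belongs to half the distance. The
  quadratic relation is the doubling formula of \<open>tanh\<close>.\<close>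

lemma half_artanh:
  fixes s :: real
  assumes "0 < s" "s < 1"
  defines "t \<equiv> tanh (artanh s / 2)"
  shows "0 < t" "t < 1" "s * (1 + t\<^sup>2) = 2 * t" "artanh t = artanh s / 2"
proof -
  show t: "0 < t" "t < 1"
    using assms tanh_artanh_real[of s] tanh_real_pos_iff[of "artanh s"]
    by (simp_all add: t_def tanh_real_lt_1)
  show "artanh t = artanh s / 2" by (simp add: t_def artanh_tanh_real)
  have "s = tanh (artanh s / 2 + artanh s / 2)"
    using assms by (simp add: tanh_artanh_real)
  also have "\<dots> = (t + t) / (1 + t * t)"
    unfolding t_def by (rule tanh_add) simp_all
  finally have "s = (t + t) / (1 + t * t)" .
  moreover have "1 + t * t \<noteq> 0"
    using zero_le_square[of t] by linarith
  ultimately show "s * (1 + t\<^sup>2) = 2 * t"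
    by (simp add: power2_eq_square)
qed

text \<open>The two equations on moduli force the inner product \<open>R\<close> of \<open>n\<close>
  and \<open>b\<close> to be \<open>s * t\<close>, the product of their lengths. This is the
  equality case of the Cauchy-Schwarz inequality, so \<open>n\<close> lies on the segment from 0 to
  \<open>b\<close>, at distance \<open>t\<close> from 0.\<close>

lemma midpoint_from_origin:
  fixes b n :: complex and s t :: real
  assumes s: "cmod b = s" "0 < s" "s < 1" and t: "0 < t" "t < 1" "s * (1 + t\<^sup>2) = 2 * t"
  shows "cmod n < 1 \<and> cmod n = t \<and> cmod (moebius n b) = t \<longleftrightarrow> n = of_real (t / s) * b" (is "?l \<longleftrightarrow> ?r")
    and "moebius (of_real (t / s) * b) b = of_real (t / s) * b"
proof -
  have ne: "1 - t * s \<noteq> 0"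
  proof -
    have "t * s < 1 * 1" using s t by (intro mult_strict_mono) auto
    then show ?thesis by simp
  qed
  have key: "(1 - t / s) / (1 - t * s) = t / s"
  proof -
    have "s - t = t - t * t * s" using t(3) by (simp add: algebra_simps power2_eq_square)
    then have "s * (s - t) = s * (t - t * t * s)" by simp
    then show ?thesis using s ne by (simp add: field_simps)
  qed
  have bb: "cnj b * b = of_real (s\<^sup>2)"
    using s(1) by (metis complex_norm_square mult.commute)
  show M: "moebius (of_real (t / s) * b) b = of_real (t / s) * b"
  proof -
    have "moebius (of_real (t / s) * b) b = (of_real (1 - t / s) * b) / (1 - of_real (t / s) * (cnj b * b))"
      by (simp add: Moebius_function_simple algebra_simps)
    also have "\<dots> = of_real (1 - t / s) * b / of_real (1 - t * s)"
      using s(2) unfolding bb by (simp add: power2_eq_square flip: of_real_mult of_real_divide)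
    also have "\<dots> = of_real ((1 - t / s) / (1 - t * s)) * b" by simp
    finally show ?thesis unfolding key .
  qed
  show "?l \<longleftrightarrow> ?r"
  proof
    assume r: ?r
    then have "cmod n = t" using s t by (simp add: norm_mult norm_divide)
    moreover have "moebius n b = n" using M r by simp
    ultimately show ?l using t by simp
  next
    assume l: ?l
    have nn: "(Re n)\<^sup>2 + (Im n)\<^sup>2 = t\<^sup>2" using l by (metis cmod_power2)
    have bb2: "(Re b)\<^sup>2 + (Im b)\<^sup>2 = s\<^sup>2" using s(1) by (metis cmod_power2)
    define R where "R = Re n * Re b + Im n * Im b"
    have "1 - cnj n * b \<noteq> 0"
    proof
      assume "1 - cnj n * b = 0"
      then have "cmod (cnj n * b) = 1" by (metis eq_iff_diff_eq_0 norm_one)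
      then have "t * s = 1" using l s(1) by (simp add: norm_mult)
      then show False using ne by simp
    qed
    then have "cmod (b - n) = t * cmod (1 - cnj n * b)"
      using l by (simp add: Moebius_function_simple norm_divide field_simps)
    then have "(cmod (b - n))\<^sup>2 = t\<^sup>2 * (cmod (1 - cnj n * b))\<^sup>2"
      by (simp add: power_mult_distrib)
    moreover have "(cmod (b - n))\<^sup>2 = s\<^sup>2 - 2 * R + t\<^sup>2"
      unfolding cmod_power2 R_def nn[symmetric] bb2[symmetric] by (simp add: power2_eq_square algebra_simps)
    moreover have "(cmod (1 - cnj n * b))\<^sup>2 = 1 - 2 * R + t\<^sup>2 * s\<^sup>2"
      unfolding cmod_power2 R_def nn[symmetric] bb2[symmetric] by (simp add: power2_eq_square algebra_simps)
    ultimately have "s\<^sup>2 - 2 * R + t\<^sup>2 = t\<^sup>2 * (1 - 2 * R + t\<^sup>2 * s\<^sup>2)" by simp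
    then have "2 * R * (1 - t\<^sup>2) = s * (s * (1 + t\<^sup>2)) * (1 - t\<^sup>2)"
      by (simp add: algebra_simps power2_eq_square)
    moreover have "1 - t\<^sup>2 \<noteq> 0" using t by (simp add: power_eq_1_iff abs_square_eq_1)
    ultimately have R: "R = s * t" using t(3) by simp
    have "(cmod (n - of_real (t / s) * b))\<^sup>2 = t\<^sup>2 - 2 * (t / s) * R + (t / s)\<^sup>2 * s\<^sup>2"
      unfolding cmod_power2 R_def nn[symmetric] bb2[symmetric] by (simp add: power2_eq_square algebra_simps)
    also have "\<dots> = 0" using s(2) unfolding R by (simp add: power2_eq_square field_simps)
    finally show ?r by simp
  qed
qed

text \<open>Moving \<open>a\<close> to the origin reduces the definite description to
  \<open>midpoint_from_origin\<close>, so it has exactly one solution. Seen from the midpoint,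
  \<open>a\<close> and \<open>b\<close> have opposite coordinates, hence the half-turn exchanges
  them.\<close>

lemma hyp_midpoint:
  assumes a: "cmod a < 1" and b: "cmod b < 1" and ab: "a \<noteq> b"
  shows "cmod (hyp_midpoint a b) < 1" "half_turn (hyp_midpoint a b) a = b" "half_turn (hyp_midpoint a b) b = a"
proof -
  define b' s t where "b' = moebius a b" and "s = cmod b'" and "t = tanh (artanh s / 2)"
  have s: "0 < s" "s < 1"
    using moebius_eq_0_iff[OF a b] ab a b by (auto simp: s_def b'_def)
  note t = half_artanh[OF s, folded t_def]
  define n where "n = of_real (t / s) * b'"
  note mid = midpoint_from_origin[OF s_def[symmetric] s t(1,2,3)]
  have n: "cmod n < 1" using mid(1)[of n] by (simp add: n_def)
  have hd: "hyp_dist x y = hyp_dist a b / 2 \<longleftrightarrow> cmod (moebius x y) = t" if "cmod x < 1" "cmod y < 1" for x y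
  proof -
    have "hyp_dist x y = hyp_dist a b / 2 \<longleftrightarrow> artanh (cmod (moebius x y)) = artanh t"
      unfolding t(4) by (auto simp: hyp_dist_def s_def b'_def)
    then show ?thesis
      using artanh_eq_iff[of "cmod (moebius x y)" t] t(1,2) moebius_in_ball[OF that] by simp
  qed
  have iff: "m \<in> ball 0 1 \<and> hyp_dist a m = hyp_dist a b / 2 \<and> hyp_dist m b = hyp_dist a b / 2 \<longleftrightarrow>
      m = moebius (- a) n" for m
  proof (cases "cmod m < 1")
    case True
    have "hyp_dist a m = hyp_dist a b / 2 \<and> hyp_dist m b = hyp_dist a b / 2 \<longleftrightarrow>
        cmod (moebius a m) = t \<and> cmod (moebius (moebius a m) b') = t"
      using hd[OF a True] hd[OF True b] norm_moebius_moebius[OF a True b] by (simp add: b'_def)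
    also have "\<dots> \<longleftrightarrow> moebius a m = n"
      using mid(1)[of "moebius a m"] moebius_in_ball[OF a True] by (simp add: n_def)
    also have "\<dots> \<longleftrightarrow> m = moebius (- a) n"
      using a True n by auto
    finally show ?thesis using True by simp
  next
    case False
    then show ?thesis using a n moebius_in_ball[of "- a" n] by auto
  qed
  have m: "hyp_midpoint a b = moebius (- a) n"
    unfolding hyp_midpoint_def iff by simp
  define m where "m = moebius (- a) n"
  have m1: "cmod m < 1" using a n by (simp add: m_def)
  show "cmod (hyp_midpoint a b) < 1" using m1 m by (simp add: m_def)
  \<comment> \<open>Coordinates centred at \<open>m\<close> agree, up to the unimodular factor
    \<open>c\<close>, with those centred at \<open>n\<close> after moving \<open>a\<close> to the
    origin; there \<open>b\<close> becomes \<open>n\<close> and \<open>a\<close> becomes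
    \<open>- n\<close>.\<close>
  obtain c where c: "cmod c = 1" "\<And>z. cmod z < 1 \<Longrightarrow> moebius (moebius a m) (moebius a z) = c * moebius m z"
    using Aut_unit_disc_moebius[OF Aut_moebius[OF a] m1] m1 by simp blast
  have am: "moebius a m = n" using a n by (simp add: m_def)
  have "c * moebius m b = n" using c(2)[OF b] mid(2) by (simp add: am n_def b'_def)
  moreover have "c * moebius m a = - n" using c(2)[OF a] by (simp add: am Moebius_function_of_zero)
  ultimately have "c * moebius m b = c * (- moebius m a)" by simp
  moreover have "c \<noteq> 0" using c(1) by auto
  ultimately have "moebius m b = - moebius m a" by (simp only: mult_cancel_left) simp
  then show "half_turn (hyp_midpoint a b) a = b" "half_turn (hyp_midpoint a b) b = a"
    unfolding m m_def[symmetric] half_turn_def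
    by (auto intro!: hyp_rotation_eqI m1 a b)
qed

lemma hyp_midpoint_commute: "hyp_midpoint a b = hyp_midpoint b a"
proof -
  have "hyp_dist x y = hyp_dist y x" for x y
    using norm_moebius_commute[of x y] by (simp add: hyp_dist_def)
  then show ?thesis unfolding hyp_midpoint_def by (metis (no_types, lifting))
qed

section \<open>Triangles and their half-turns\<close>

text \<open>For coinciding points the quotient is 0, by \<open>x / 0 = 0\<close> where necessary,
  and \<open>Arg 0 = 0\<close>. A positive angle therefore excludes degenerate sides.\<close>

lemma hyp_angle_decomp:
  assumes "hyp_angle a b c = \<alpha>" "0 < \<alpha>"
  shows "moebius a b \<noteq> 0"
    "\<exists>r>0. moebius a c / moebius a b = of_real r * cis \<alpha>"
proof -
  let ?w = "moebius a c / moebius a b"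
  have A: "Arg ?w = \<alpha>" using assms by (simp add: hyp_angle_def)
  have nz: "?w \<noteq> 0" using A assms(2) by (auto simp: Arg_zero)
  then show "moebius a b \<noteq> 0" by auto
  have "?w = of_real (cmod ?w) * cis \<alpha>"
    using A by (metis Arg_eq cis_conv_exp nz)
  then show "\<exists>r>0. ?w = of_real r * cis \<alpha>"
    using nz by (intro exI[of _ "cmod ?w"]) auto
qed

lemma triangle_cyclic:
  "triangle_with_angles \<alpha> \<beta> \<gamma> (a, b, c) \<Longrightarrow> triangle_with_angles \<beta> \<gamma> \<alpha> (b, c, a)"
  by (simp add: triangle_with_angles_def)

lemma triangle_distinct:
  assumes "triangle_with_angles \<alpha> \<beta> \<gamma> (a, b, c)"
  shows "cmod a < 1" "cmod b < 1" "cmod c < 1" "a \<noteq> b" "b \<noteq> c" "c \<noteq> a"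
proof -
  show "cmod a < 1" "cmod b < 1" "cmod c < 1"
    using assms by (simp_all add: triangle_with_angles_def)
  show "a \<noteq> b" "b \<noteq> c" "c \<noteq> a"
    using assms hyp_angle_decomp(1)[of a b c \<alpha>] hyp_angle_decomp(1)[of b c a \<beta>]
      hyp_angle_decomp(1)[of c a b \<gamma>]
    by (auto simp: triangle_with_angles_def)
qed

text \<open>An automorphism multiplies all coordinates centred at a vertex by one unimodular factor,
  which cancels in the quotient that defines the angle.\<close>

lemma triangle_Aut:
  assumes f: "f \<in> carrier (Aut unit_disc)" and t: "triangle_with_angles \<alpha> \<beta> \<gamma> (a, b, c)"
  shows "triangle_with_angles \<alpha> \<beta> \<gamma> (f a, f b, f c)"
proof -
  have ang: "hyp_angle (f x) (f y) (f z) = hyp_angle x y z"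
    if "cmod x < 1" "cmod y < 1" "cmod z < 1" for x y z
  proof -
    obtain k where k: "cmod k = 1" "\<And>z. cmod z < 1 \<Longrightarrow> moebius (f x) (f z) = k * moebius x z"
      using Aut_unit_disc_moebius[OF f \<open>cmod x < 1\<close>] by blast
    have "k \<noteq> 0" using k(1) by auto
    then show ?thesis using that by (simp add: hyp_angle_def k(2))
  qed
  show ?thesis
    using t ang triangle_distinct(1-3)[OF t] Aut_unit_discD(5)[OF f]
    by (simp add: triangle_with_angles_def)
qed

text \<open>Follow the direction of a side through the three half-turns, i.e. around the triangle: at each
  vertex it turns by the angle there.\<close>

lemma triangle_half_turns:
  assumes t: "triangle_with_angles \<alpha> \<beta> \<gamma> (a, b, c)" and z: "cmod z < 1"
  shows "hyp_rotation a (\<alpha> + \<beta> + \<gamma>) z =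
    half_turn (hyp_midpoint c a) (half_turn (hyp_midpoint b c) (half_turn (hyp_midpoint a b) z))"
proof -
  note d = triangle_distinct[OF t]
  \<comment> \<open>The half-turn exchanges \<open>x\<close> and \<open>y\<close>, so between the
    coordinates centred at these points it is multiplication by a constant, found by evaluating at
    \<open>y\<close>.\<close>
  have side: "moebius y (half_turn (hyp_midpoint x y) w) = (moebius y x / moebius x y) * moebius x w"
    if x: "cmod x < 1" and y: "cmod y < 1" and xy: "x \<noteq> y" and w: "cmod w < 1" for x y w
  proof -
    note m = hyp_midpoint[OF x y xy]
    obtain k where k: "\<And>z. cmod z < 1 \<Longrightarrow>
        moebius y (half_turn (hyp_midpoint x y) z) = k * moebius x z"
      using Aut_unit_disc_moebius[OF Aut_half_turn[OF m(1)] x] m(2) by metis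
    have "moebius x y \<noteq> 0" using moebius_eq_0_iff[OF x y] xy by simp
    then have "k = moebius y x / moebius x y" using k[OF y] m(3) by (simp add: field_simps)
    then show ?thesis using k[OF w] by simp
  qed
  note ma = hyp_midpoint[OF d(1,2,4)] and mb = hyp_midpoint[OF d(2,3,5)]
    and mc = hyp_midpoint[OF d(3,1,6)]
  define H where "H = (\<lambda>w. half_turn (hyp_midpoint c a) (half_turn (hyp_midpoint b c)
    (half_turn (hyp_midpoint a b) w)))"
  \<comment> \<open>The product of the constants of the three sides, regrouped by vertices: each of
    \<open>A\<close>, \<open>B\<close>, \<open>C\<close> compares the two sides at one vertex, and
    its argument is the angle there.\<close>
  define A B C where "A = moebius a c / moebius a b" and "B = moebius b a / moebius b c"
    and "C = moebius c b / moebius c a"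
  have nz: "moebius a b \<noteq> 0" "moebius b c \<noteq> 0" "moebius c a \<noteq> 0"
    using d moebius_eq_0_iff by auto
  have eq: "moebius a (H w) = (A * B * C) * moebius a w" if w: "cmod w < 1" for w
    using side[OF d(3,1,6), of "half_turn (hyp_midpoint b c) (half_turn (hyp_midpoint a b) w)"]
      side[OF d(2,3,5), of "half_turn (hyp_midpoint a b) w"] side[OF d(1,2,4) w] nz w ma(1) mb(1)
    by (simp add: H_def A_def B_def C_def field_simps)
  obtain ra rb rc where r: "ra > 0" "A = of_real ra * cis \<alpha>" "rb > 0" "B = of_real rb * cis \<beta>"
      "rc > 0" "C = of_real rc * cis \<gamma>"
    using hyp_angle_decomp(2)[of a b c \<alpha>] hyp_angle_decomp(2)[of b c a \<beta>]
      hyp_angle_decomp(2)[of c a b \<gamma>] t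
    unfolding A_def B_def C_def triangle_with_angles_def by auto
  have ABC: "A * B * C = of_real (ra * rb * rc) * cis (\<alpha> + \<beta> + \<gamma>)"
    by (simp add: r cis_mult[symmetric] mult_ac)
  \<comment> \<open>Half-turns preserve the modulus of Moebius images, so the composite factor has
    modulus 1 and only the sum of the angles remains.\<close>
  have "cmod (A * B * C) = 1"
  proof -
    have "cmod (moebius a (H b)) = cmod (moebius a b)"
      using norm_moebius_Aut[OF Aut_half_turn[OF mc(1)] d(3), of "half_turn (hyp_midpoint b c) a"]
        norm_moebius_Aut[OF Aut_half_turn[OF mb(1)] d(2,1)]
        norm_moebius_Aut[OF Aut_half_turn[OF ma(1)] d(1,2)] d(1) ma mb mc
      by (simp add: H_def norm_moebius_commute[of b a])
    then show ?thesis using eq[OF d(2)] nz(1) by (simp add: norm_mult)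
  qed
  then have "ra * rb * rc = 1"
    unfolding ABC using r by (simp add: norm_mult)
  then have "moebius a (H z) = cis (\<alpha> + \<beta> + \<gamma>) * moebius a z"
    unfolding eq[OF z] ABC by simp
  then have "hyp_rotation a (\<alpha> + \<beta> + \<gamma>) z = H z"
    using z ma(1) mb(1) mc(1) by (intro hyp_rotation_eqI[OF d(1) z]) (simp_all add: H_def)
  then show ?thesis by (simp add: H_def)
qed

section \<open>The groups generated by the vertex rotations of a tile\<close>

definition tile_rotations :: "real \<Rightarrow> complex \<times> complex \<times> complex \<Rightarrow> (complex \<Rightarrow> complex) set" where
  "tile_rotations \<theta> = (\<lambda>(a, b, c). {hyp_rotation a \<theta>, hyp_rotation b \<theta>, hyp_rotation c \<theta>})"

lemma tile_rotations_cyclic: "tile_rotations \<theta> (b, c, a) = tile_rotations \<theta> (a, b, c)"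
  by (auto simp: tile_rotations_def)

lemma tile_rotations_subset:
  "cmod a < 1 \<Longrightarrow> cmod b < 1 \<Longrightarrow> cmod c < 1 \<Longrightarrow> tile_rotations \<theta> (a, b, c) \<subseteq> carrier (Aut unit_disc)"
  by (simp add: tile_rotations_def Aut_hyp_rotation)

text \<open>With \<open>h\<^sub>a, h\<^sub>b, h\<^sub>c\<close> the half-turns about the midpoints of \<open>bc, ca, ab\<close>, the rotations about
  \<open>a, b, c\<close> are \<open>h\<^sub>b h\<^sub>a h\<^sub>c\<close>, \<open>h\<^sub>c h\<^sub>b h\<^sub>a\<close>, \<open>h\<^sub>a h\<^sub>c h\<^sub>b\<close>.\<close>

lemma fourth_rotation:
  assumes t: "triangle_with_angles \<alpha> \<beta> \<gamma> (a, b, c)" and \<theta>: "\<alpha> + \<beta> + \<gamma> = \<theta>" and w: "cmod w < 1"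
  shows "hyp_rotation (half_turn (hyp_midpoint c a) b) \<theta>
    (hyp_rotation a \<theta> (hyp_rotation b \<theta> (hyp_rotation c \<theta> w))) = w"
proof -
  note d = triangle_distinct[OF t]
  define hc ha hb where "hc = half_turn (hyp_midpoint a b)" and "ha = half_turn (hyp_midpoint b c)"
    and "hb = half_turn (hyp_midpoint c a)"
  note ma = hyp_midpoint(1)[OF d(1,2,4)] and mb = hyp_midpoint(1)[OF d(2,3,5)]
    and mc = hyp_midpoint(1)[OF d(3,1,6)]
  have bb: "cmod (ha z) < 1" "cmod (hb z) < 1" "cmod (hc z) < 1" if "cmod z < 1" for z
    using that ma mb mc by (simp_all add: ha_def hb_def hc_def)
  have ii: "ha (ha z) = z" "hb (hb z) = z" "hc (hc z) = z" if "cmod z < 1" for z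
    using that ma mb mc by (simp_all add: ha_def hb_def hc_def)
  have x: "hyp_rotation a \<theta> z = hb (ha (hc z))" if "cmod z < 1" for z
    using triangle_half_turns[OF t that] by (simp add: \<theta> ha_def hb_def hc_def)
  have y: "hyp_rotation b \<theta> z = hc (hb (ha z))" if "cmod z < 1" for z
  proof -
    have e: "\<beta> + \<gamma> + \<alpha> = \<theta>" using \<theta> by simp
    show ?thesis
      using triangle_half_turns[OF triangle_cyclic[OF t] that] by (simp add: e ha_def hb_def hc_def)
  qed
  have z: "hyp_rotation c \<theta> z = ha (hc (hb z))" if "cmod z < 1" for z
  proof -
    have e: "\<gamma> + \<alpha> + \<beta> = \<theta>" using \<theta> by simp
    show ?thesis
      using triangle_half_turns[OF triangle_cyclic[OF triangle_cyclic[OF t]] that]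
      by (simp add: e ha_def hb_def hc_def)
  qed
  \<comment> \<open>The rotation about the turned vertex is the conjugate by \<open>hb\<close> of
    the one about \<open>b\<close>. Written in half-turns, the product of the four rotations then
    cancels in pairs.\<close>
  have R: "hyp_rotation (hb b) \<theta> v = hb (hyp_rotation b \<theta> (hb v))" if "cmod v < 1" for v
    using hyp_rotation_conj[OF Aut_half_turn[OF mc] d(2), of "hb v" \<theta>] bb(2)[OF that] ii(2)[OF that]
    by (simp add: hb_def)
  have "hyp_rotation (hb b) \<theta> (hyp_rotation a \<theta> (hyp_rotation b \<theta> (hyp_rotation c \<theta> w))) = w"
    using w by (simp add: x y z R bb ii)
  then show ?thesis by (simp add: hb_def)
qed

text \<open>The half-turn exchanges \<open>a\<close> and \<open>c\<close>, so the only new rotation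
  is the one about \<open>h b\<close>; by \<open>fourth_rotation\<close> it is the inverse of the
  product of the three old ones.\<close>

lemma turned_rotations_subset:
  assumes t: "triangle_with_angles \<alpha> \<beta> \<gamma> (a, b, c)" and \<theta>: "\<alpha> + \<beta> + \<gamma> = \<theta>"
  defines "h \<equiv> half_turn (hyp_midpoint c a)"
  shows "tile_rotations \<theta> (h a, h b, h c) \<subseteq> generate (Aut unit_disc) (tile_rotations \<theta> (a, b, c))"
proof -
  interpret group "Aut unit_disc" by (rule group_Aut_unit_disc)
  note d = triangle_distinct[OF t]
  note m = hyp_midpoint[OF d(3,1,6)]
  let ?K = "generate (Aut unit_disc) (tile_rotations \<theta> (a, b, c))"
  have K: "subgroup ?K (Aut unit_disc)"
    by (rule generate_is_subgroup[OF tile_rotations_subset[OF d(1-3)]])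
  have xyz: "hyp_rotation a \<theta> \<in> ?K" "hyp_rotation b \<theta> \<in> ?K" "hyp_rotation c \<theta> \<in> ?K"
    by (auto intro: generate.incl simp: tile_rotations_def)
  have hb: "cmod (h b) < 1" using m(1) d by (simp add: h_def)
  let ?R = "hyp_rotation (h b) \<theta>"
  have c: "?R \<in> carrier (Aut unit_disc)" "hyp_rotation a \<theta> \<in> carrier (Aut unit_disc)"
      "hyp_rotation b \<theta> \<in> carrier (Aut unit_disc)" "hyp_rotation c \<theta> \<in> carrier (Aut unit_disc)"
    using hb d by (simp_all add: Aut_hyp_rotation)
  let ?P = "hyp_rotation a \<theta> \<otimes>\<^bsub>Aut unit_disc\<^esub> (hyp_rotation b \<theta> \<otimes>\<^bsub>Aut unit_disc\<^esub> hyp_rotation c \<theta>)"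
  have P: "?P \<in> ?K" using subgroup.m_closed[OF K] xyz by simp
  have "?R \<otimes>\<^bsub>Aut unit_disc\<^esub> ?P = \<one>\<^bsub>Aut unit_disc\<^esub>"
  proof (rule Aut_ext)
    fix w assume "w \<in> points unit_disc"
    then have w: "w \<in> points unit_disc" "cmod w < 1" by simp_all
    have "cmod (hyp_rotation b \<theta> (hyp_rotation c \<theta> w)) < 1" "cmod (hyp_rotation c \<theta> w) < 1"
      using w d by simp_all
    then show "(?R \<otimes>\<^bsub>Aut unit_disc\<^esub> ?P) w = \<one>\<^bsub>Aut unit_disc\<^esub> w"
      using fourth_rotation[OF t \<theta> w(2)] w c d
      by (simp add: Aut_mult_apply Aut_one_apply h_def)
  qed (use c in auto)
  then have "?R = inv\<^bsub>Aut unit_disc\<^esub> ?P"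
    using c by (intro inv_equality[symmetric]) auto
  then have "?R \<in> ?K" using subgroup.m_inv_closed[OF K P] by simp
  moreover have "h a = c" "h c = a" using m by (simp_all add: h_def)
  ultimately show ?thesis using xyz by (simp add: tile_rotations_def)
qed

text \<open>The turned triangle has the same midpoint on its \<open>ca\<close> side, and turning it
  again gives the old triangle back; so the preceding inclusion holds both ways.\<close>

lemma turned_rotations_generate:
  assumes t: "triangle_with_angles \<alpha> \<beta> \<gamma> (a, b, c)" and \<theta>: "\<alpha> + \<beta> + \<gamma> = \<theta>"
  defines "h \<equiv> half_turn (hyp_midpoint c a)"
  shows "generate (Aut unit_disc) (tile_rotations \<theta> (h a, h b, h c)) =
    generate (Aut unit_disc) (tile_rotations \<theta> (a, b, c))"
proof -
  interpret group "Aut unit_disc" by (rule group_Aut_unit_disc)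
  note d = triangle_distinct[OF t]
  note m = hyp_midpoint[OF d(3,1,6)]
  have t': "triangle_with_angles \<alpha> \<beta> \<gamma> (h a, h b, h c)"
    unfolding h_def by (rule triangle_Aut[OF Aut_half_turn[OF m(1)] t])
  note d' = triangle_distinct[OF t']
  have "hyp_midpoint (h c) (h a) = hyp_midpoint c a"
    using m hyp_midpoint_commute[of a c] by (simp add: h_def)
  then have sub: "tile_rotations \<theta> (h (h a), h (h b), h (h c)) \<subseteq>
      generate (Aut unit_disc) (tile_rotations \<theta> (h a, h b, h c))"
    using turned_rotations_subset[OF t' \<theta>] by (simp add: h_def)
  have hh: "h (h w) = w" if "cmod w < 1" for w using that m(1) by (simp add: h_def)
  show ?thesis
  proof (rule equalityI)
    show "generate (Aut unit_disc) (tile_rotations \<theta> (h a, h b, h c)) \<subseteq>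
        generate (Aut unit_disc) (tile_rotations \<theta> (a, b, c))"
      unfolding h_def
      by (rule generate_subgroup_incl[OF turned_rotations_subset[OF t \<theta>]
            generate_is_subgroup[OF tile_rotations_subset[OF d(1-3)]]])
    show "generate (Aut unit_disc) (tile_rotations \<theta> (a, b, c)) \<subseteq>
        generate (Aut unit_disc) (tile_rotations \<theta> (h a, h b, h c))"
      by (rule generate_subgroup_incl[OF sub[unfolded hh[OF d(1)] hh[OF d(2)] hh[OF d(3)]]
            generate_is_subgroup[OF tile_rotations_subset[OF d'(1-3)]]])
  qed
qed

text \<open>\<open>tiling_for\<close> speaks of some generating tile, while the pair may be read off
  on another one; hence the group has to be independent of the tile. The three edges are a single
  case up to cyclic relabelling.\<close>

lemma tiles_rotations:
  assumes "t \<in> tiles t0" "triangle_with_angles \<alpha> \<beta> \<gamma> t0" "\<alpha> + \<beta> + \<gamma> = \<theta>"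
  shows "triangle_with_angles \<alpha> \<beta> \<gamma> t \<and>
    generate (Aut unit_disc) (tile_rotations \<theta> t) = generate (Aut unit_disc) (tile_rotations \<theta> t0)"
  using assms(1)
proof induction
  case initial
  then show ?case using assms(2) by simp
next
  case (turn a b c m)
  then have t: "triangle_with_angles \<alpha> \<beta> \<gamma> (a, b, c)" by blast
  have cyc: "\<beta> + \<gamma> + \<alpha> = \<theta>" "\<gamma> + \<alpha> + \<beta> = \<theta>" using assms(3) by simp_all
  note t' = triangle_cyclic[OF t]
  note t'' = triangle_cyclic[OF t']
  note d = triangle_distinct[OF t]
  have m: "cmod m < 1"
    using turn.hyps hyp_midpoint(1)[OF d(1,2,4)] hyp_midpoint(1)[OF d(2,3,5)]
      hyp_midpoint(1)[OF d(3,1,6)] by auto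
  have "generate (Aut unit_disc) (tile_rotations \<theta> (half_turn m a, half_turn m b, half_turn m c)) =
      generate (Aut unit_disc) (tile_rotations \<theta> (a, b, c))"
    using turn.hyps turned_rotations_generate[OF t assms(3)] turned_rotations_generate[OF t' cyc(1)]
      turned_rotations_generate[OF t'' cyc(2)]
    by (auto simp: tile_rotations_cyclic)
  then show ?case
    using turn.IH triangle_Aut[OF Aut_half_turn[OF m] t] by simp
qed

text \<open>The point \<open>d\<close> is \<open>b\<close> turned about the midpoint of
  \<open>ca\<close>. Together with the tile it spans the parallelogram whose four vertex rotations
  have product 1.\<close>

lemma canonical_tiling_rotations:
  assumes T: "canonical_tiling p \<Gamma> \<alpha> \<beta> \<gamma> \<T>" and t: "(a, b, c) \<in> \<T>"
  defines "\<theta> \<equiv> 2 * pi / real p"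
  shows "cmod a < 1" "cmod b < 1" "cmod c < 1" "hyp_rotation a \<theta> \<in> \<Gamma>" "hyp_rotation b \<theta> \<in> \<Gamma>" "hyp_rotation c \<theta> \<in> \<Gamma>"
    "\<exists>d. cmod d < 1 \<and> hyp_rotation d \<theta> \<in> \<Gamma> \<and> (\<forall>w. cmod w < 1 \<longrightarrow>
      hyp_rotation d \<theta> (hyp_rotation a \<theta> (hyp_rotation b \<theta> (hyp_rotation c \<theta> w))) = w)"
proof -
  obtain t0 where t0: "triangle_with_angles \<alpha> \<beta> \<gamma> t0" "\<T> = tiles t0" and \<theta>: "\<alpha> + \<beta> + \<gamma> = \<theta>"
    using T by (auto simp: canonical_tiling_def tiling_def \<theta>_def)
  obtain s where s: "s \<in> \<T>" "\<Gamma> = generate (Aut unit_disc) (tile_rotations \<theta> s)"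
    using T by (fastforce simp: canonical_tiling_def tiling_for_def tile_rotations_def \<theta>_def)
  have tr: "triangle_with_angles \<alpha> \<beta> \<gamma> (a, b, c)" and
    gen: "generate (Aut unit_disc) (tile_rotations \<theta> (a, b, c)) = \<Gamma>"
    using tiles_rotations[OF _ t0(1) \<theta>] t s unfolding t0(2) by auto
  note d = triangle_distinct[OF tr]
  note m = hyp_midpoint(1)[OF d(3,1,6)]
  show "cmod a < 1" "cmod b < 1" "cmod c < 1" by (rule d)+
  show "hyp_rotation a \<theta> \<in> \<Gamma>" "hyp_rotation b \<theta> \<in> \<Gamma>" "hyp_rotation c \<theta> \<in> \<Gamma>"
    unfolding gen[symmetric] by (auto intro: generate.incl simp: tile_rotations_def)
  show "\<exists>d. cmod d < 1 \<and> hyp_rotation d \<theta> \<in> \<Gamma> \<and> (\<forall>w. cmod w < 1 \<longrightarrow>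
      hyp_rotation d \<theta> (hyp_rotation a \<theta> (hyp_rotation b \<theta> (hyp_rotation c \<theta> w))) = w)"
    using turned_rotations_subset[OF tr \<theta>] fourth_rotation[OF tr \<theta>] m d(2)
    unfolding gen by (intro exI[of _ "half_turn (hyp_midpoint c a) b"]) (simp add: tile_rotations_def)
qed

section \<open>Multipliers at fixed points\<close>

text \<open>At a fixed point the derivative does not depend on the chart. It is demanded in every
  chart, so that uniqueness can be read off in any one of them.\<close>

definition has_multiplier :: "'a rsurface \<Rightarrow> ('a \<Rightarrow> 'a) \<Rightarrow> 'a \<Rightarrow> complex \<Rightarrow> bool" where
  "has_multiplier S g q \<mu> \<longleftrightarrow> g q = q \<and>
     (\<forall>(U, \<phi>)\<in>rs_charts S. q \<in> U \<longrightarrow>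
        ((\<lambda>z. \<phi> (g (inv_into U \<phi> z))) has_field_derivative \<mu>) (at (\<phi> q)))"

lemma has_multiplierD:
  "has_multiplier S g q \<mu> \<Longrightarrow> (U, \<phi>) \<in> rs_charts S \<Longrightarrow> q \<in> U \<Longrightarrow>
    ((\<lambda>z. \<phi> (g (inv_into U \<phi> z))) has_field_derivative \<mu>) (at (\<phi> q))"
  unfolding has_multiplier_def by blast

lemma has_multiplier_fix: "has_multiplier S g q \<mu> \<Longrightarrow> g q = q"
  unfolding has_multiplier_def by blast

lemma has_multiplier_unique:
  assumes S: "riemann_surface S" and q: "q \<in> points S"
    and "has_multiplier S g q \<mu>" "has_multiplier S g q \<nu>"
  shows "\<mu> = \<nu>"
proof -
  obtain U \<phi> where U: "(U, \<phi>) \<in> rs_charts S" "q \<in> U"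
    using chart_cover[OF S q] .
  show ?thesis
    using DERIV_unique[OF has_multiplierD[OF assms(3) U] has_multiplierD[OF assms(4) U]] .
qed

lemma has_multiplier_compose:
  assumes S: "riemann_surface S" and q: "q \<in> points S"
    and h: "continuous_map (rs_top S) (rs_top S) h"
    and "has_multiplier S g q \<mu>" "has_multiplier S h q \<nu>"
    and k: "\<And>x. x \<in> points S \<Longrightarrow> k x = g (h x)"
  shows "has_multiplier S k q (\<mu> * \<nu>)"
  unfolding has_multiplier_def
proof (intro conjI)
  have hq: "h q = q" and gq: "g q = q"
    using has_multiplier_fix[OF assms(5)] has_multiplier_fix[OF assms(4)] by this
  then show "k q = q" using k[OF q] by simp
  have "((\<lambda>z. \<phi> (k (inv_into U \<phi> z))) has_field_derivative \<mu> * \<nu>) (at (\<phi> q))"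
    if U: "(U, \<phi>) \<in> rs_charts S" "q \<in> U" for U \<phi>
  proof -
    note inv = chart_inv[OF S U(1)]
    have d1: "((\<lambda>z. \<phi> (g (inv_into U \<phi> z))) has_field_derivative \<mu>) (at ((\<lambda>z. \<phi> (h (inv_into U \<phi> z))) (\<phi> q)))"
      using has_multiplierD[OF assms(4) U] by (simp add: inv[OF U(2)] hq)
    note d2 = has_multiplierD[OF assms(5) U]
    have "openin (rs_top S) {y \<in> U. h y \<in> U}"
      by (rule continuous_map_vimage_openin[OF h chart_open[OF S U(1)] chart_open[OF S U(1)]])
    from chart_eventually[OF S U(1) this _ U(2)]
    have "eventually (\<lambda>z. inv_into U \<phi> z \<in> {y \<in> U. h y \<in> U} \<and> inv_into U \<phi> z \<in> U \<and> \<phi> (inv_into U \<phi> z) = z) (nhds (\<phi> q))"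
      using hq U(2) by simp
    then have ev: "eventually (\<lambda>z. ((\<lambda>z. \<phi> (g (inv_into U \<phi> z))) \<circ> (\<lambda>z. \<phi> (h (inv_into U \<phi> z)))) z =
        \<phi> (k (inv_into U \<phi> z))) (nhds (\<phi> q))"
    proof eventually_elim
      case (elim z)
      then have y: "inv_into U \<phi> z \<in> U" "h (inv_into U \<phi> z) \<in> U" by auto
      then have "inv_into U \<phi> z \<in> points S" using chart_subset[OF S U(1)] by blast
      then show ?case using inv[OF y(2)] k by simp
    qed
    show ?thesis
      using DERIV_cong_ev[OF refl ev refl] DERIV_chain[OF d1 d2] by blast
  qed
  then show "\<forall>(U, \<phi>)\<in>rs_charts S. q \<in> U \<longrightarrow>
      ((\<lambda>z. \<phi> (k (inv_into U \<phi> z))) has_field_derivative \<mu> * \<nu>) (at (\<phi> q))" by blast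
qed

lemma has_multiplier_one:
  assumes S: "riemann_surface S" and q: "q \<in> points S"
  shows "has_multiplier S \<one>\<^bsub>Aut S\<^esub> q 1"
  unfolding has_multiplier_def
proof (intro conjI)
  show "\<one>\<^bsub>Aut S\<^esub> q = q" by (rule Aut_one_apply[OF q])
  have "((\<lambda>z. \<phi> (\<one>\<^bsub>Aut S\<^esub> (inv_into U \<phi> z))) has_field_derivative 1) (at (\<phi> q))"
    if U: "(U, \<phi>) \<in> rs_charts S" "q \<in> U" for U \<phi>
  proof -
    have ev: "eventually (\<lambda>z. z = \<phi> (\<one>\<^bsub>Aut S\<^esub> (inv_into U \<phi> z))) (nhds (\<phi> q))"
      using chart_eventually[OF S U(1) openin_topspace q U(2)]
      by eventually_elim (simp add: Aut_one_apply)
    show ?thesis using DERIV_cong_ev[OF refl ev refl] DERIV_ident by blast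
  qed
  then show "\<forall>(U, \<phi>)\<in>rs_charts S. q \<in> U \<longrightarrow>
      ((\<lambda>z. \<phi> (\<one>\<^bsub>Aut S\<^esub> (inv_into U \<phi> z))) has_field_derivative 1) (at (\<phi> q))" by blast
qed

lemma has_multiplier_pow:
  assumes S: "riemann_surface S" and q: "q \<in> points S" and g: "g \<in> carrier (Aut S)"
    and m: "has_multiplier S g q \<mu>"
  shows "has_multiplier S (g [^]\<^bsub>Aut S\<^esub> (n::nat)) q (\<mu> ^ n)"
proof (induction n)
  case 0
  then show ?case using has_multiplier_one[OF S q] by simp
next
  case (Suc n)
  interpret group "Aut S" by (rule group_Aut[OF S])
  have "has_multiplier S (g [^]\<^bsub>Aut S\<^esub> Suc n) q (\<mu> ^ n * \<mu>)"
    by (rule has_multiplier_compose[OF S q AutD(5)[OF g] Suc m])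
       (simp add: Aut_mult_apply[OF nat_pow_closed[OF g] g])
  then show ?case by (simp add: mult.commute)
qed

lemma cis_root_power_eq:
  assumes "1 < (p::nat)"
  shows "cis (2 * pi / real p) ^ r = cis (2 * pi / real p) \<longleftrightarrow> [r = 1] (mod p)"
proof -
  have e: "cis (2 * pi / real p) = exp (2 * of_real pi * \<i> / of_nat p)"
    by (simp add: cis_conv_exp mult_ac)
  have "cis (2 * pi / real p) ^ r = exp (2 * of_real pi * \<i> * of_nat r / of_nat p)"
    unfolding e exp_of_nat_mult[symmetric] by (simp add: mult_ac)
  then show ?thesis
    using complex_root_unity_eq[of p r 1] assms unfolding e by (simp add: cong_def)
qed

text \<open>\<open>t1\<close> is nontrivial because its multiplier is not 1, so it generates the
  group of prime order and \<open>t2\<close> is a power of it. Comparing multipliers shows that the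
  exponent is 1 modulo \<open>p\<close>. The argument goes through \<open>t1\<close> because the
  multiplier of \<open>T\<close> itself is unknown.\<close>

lemma multiplier_determines_power:
  assumes S: "riemann_surface S" and q: "q \<in> points S" and T: "T \<in> carrier (Aut S)"
    and p: "prime p" "group.ord (Aut S) T = p"
    and t: "t1 \<in> generate (Aut S) {T}" "t2 \<in> generate (Aut S) {T}"
    and m: "has_multiplier S t1 q (cis (2 * pi / real p))" "has_multiplier S t2 q (cis (2 * pi / real p))"
  shows "t1 = t2"
proof -
  interpret group "Aut S" by (rule group_Aut[OF S])
  have p0: "p > 1" using p(1) by (rule prime_gt_1_nat)
  have gen: "generate (Aut S) {T} = {T [^]\<^bsub>Aut S\<^esub> k |k. k \<in> (UNIV :: nat set)}"
    by (rule generate_pow_nat[OF T]) (use p0 p in simp)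
  obtain m n :: nat where mn: "t1 = T [^]\<^bsub>Aut S\<^esub> m" "t2 = T [^]\<^bsub>Aut S\<^esub> n"
    using t unfolding gen by blast
  have t1: "t1 \<in> carrier (Aut S)" unfolding mn by (rule nat_pow_closed[OF T])
  note root = cis_root_power_eq[OF p0]
  have "t1 \<noteq> \<one>\<^bsub>Aut S\<^esub>"
  proof
    assume "t1 = \<one>\<^bsub>Aut S\<^esub>"
    then have "cis (2 * pi / real p) = 1"
      using has_multiplier_unique[OF S q m(1)] has_multiplier_one[OF S q] by simp
    then show False using root[of 0] p0 by (simp add: cong_def)
  qed
  then have "\<not> p dvd m" using pow_eq_id[OF T, of m] p(2) mn by simp
  then have "coprime m p" using p(1) by (metis prime_imp_coprime coprime_commute)
  then obtain a where a: "[m * a = 1] (mod p)"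
    using cong_solve_coprime_nat by (metis One_nat_def)
  \<comment> \<open>\<open>a\<close> inverts \<open>m\<close> modulo \<open>p\<close>, so the
    \<open>a\<close>-th power of \<open>t1\<close> is \<open>T\<close>.\<close>
  have t2: "t2 = t1 [^]\<^bsub>Aut S\<^esub> (a * n)"
  proof -
    have "[m * (a * n) = n] (mod p)"
      using cong_scalar_right[OF a, of n] by (simp add: mult.assoc)
    then show ?thesis
      unfolding mn by (simp add: nat_pow_pow[OF T] nat_pow_eq_iff_cong[OF T] p(2) cong_sym)
  qed
  have "cis (2 * pi / real p) ^ (a * n) = cis (2 * pi / real p)"
    using has_multiplier_unique[OF S q has_multiplier_pow[OF S q t1 m(1)] m(2)[unfolded t2]] .
  then have "[a * n = 1] (mod p)" using root by blast
  then have "t1 [^]\<^bsub>Aut S\<^esub> (a * n) = t1"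
  proof -
    assume "[a * n = 1] (mod p)"
    then have "[m * (a * n) = m] (mod p)" using cong_scalar_left[of "a * n" 1 p m] by simp
    then show ?thesis
      unfolding mn by (simp add: nat_pow_pow[OF T] nat_pow_eq_iff_cong[OF T] p(2))
  qed
  then show ?thesis using t2 by simp
qed

section \<open>Multipliers carried over from the disc\<close>

lemma deriv_hyp_rotation:
  assumes a: "cmod a < 1"
  shows "(hyp_rotation a \<theta> has_field_derivative cis \<theta>) (at a)"
proof -
  have ne: "1 - cnj a * a \<noteq> 0"
  proof
    assume "1 - cnj a * a = 0"
    then have "cmod (cnj a * a) = 1" by (metis eq_iff_diff_eq_0 norm_one)
    then have "cmod a * cmod a = 1" by (simp add: norm_mult)
    moreover have "cmod a * cmod a < 1" using a mult_strict_mono[of "cmod a" 1 "cmod a" 1] by simp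
    ultimately show False by simp
  qed
  have "((\<lambda>z. (z - a) / (1 - cnj a * z)) has_field_derivative 1 / (1 - cnj a * a)) (at a)"
    using ne by (auto intro!: derivative_eq_intros)
  then have d1: "((\<lambda>z. cis \<theta> * moebius a z) has_field_derivative cis \<theta> * (1 / (1 - cnj a * a))) (at a)"
    unfolding Moebius_function_simple by (rule DERIV_cmult)
  have "((\<lambda>z. (z + a) / (1 + cnj a * z)) has_field_derivative 1 - cnj a * a) (at 0)"
    by (auto intro!: derivative_eq_intros)
  then have d2: "(moebius (- a) has_field_derivative 1 - cnj a * a) (at (cis \<theta> * moebius a a))"
    by (simp add: Moebius_function_simple[abs_def])
  have d: "(moebius (- a) \<circ> (\<lambda>z. cis \<theta> * moebius a z) has_field_derivative
      (1 - cnj a * a) * (cis \<theta> * (1 / (1 - cnj a * a)))) (at a)"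
    by (rule DERIV_chain[OF d2 d1])
  have "eventually (\<lambda>z. z \<in> ball 0 1) (nhds a)"
    using a by (intro eventually_nhds_in_open) auto
  then have ev: "eventually (\<lambda>z. (moebius (- a) \<circ> (\<lambda>z. cis \<theta> * moebius a z)) z = hyp_rotation a \<theta> z) (nhds a)"
    by eventually_elim (simp add: hyp_rotation_def)
  show ?thesis
    using DERIV_cong_ev[OF refl ev, of _ "cis \<theta>"] d ne by (simp add: o_def)
qed

lemma holo_at_unit_disc:
  assumes "cmod z < 1"
  shows "holo_at unit_disc k z \<longleftrightarrow> k analytic_on {z}"
proof -
  have C: "(ball 0 1, \<lambda>z. z) \<in> rs_charts unit_disc" by (simp add: charts_unit_disc)
  have z: "z \<in> ball 0 1" using assms by simp
  have "eventually (\<lambda>w. w \<in> ball (0::complex) 1) (nhds z)"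
    using z by (intro eventually_nhds_in_open) auto
  then have ev: "eventually (\<lambda>w. (k \<circ> inv_into (ball 0 1) (\<lambda>z. z)) w = k w) (nhds z)"
    by eventually_elim (simp add: inv_into_ident)
  show ?thesis
    using holo_at_chart_iff[OF riemann_surface_unit_disc C z, of k] analytic_at_cong[OF ev refl] by simp
qed

text \<open>The map \<open>k = \<phi> \<circ> P\<close> is injective near \<open>a\<close>, so its
  derivative there is nonzero and cancels from the chain rule for
  \<open>F \<circ> k = k \<circ> hyp_rotation a \<theta>\<close>. What remains is that
  \<open>t\<close> has the derivative of the rotation.\<close>

lemma rotation_multiplier:
  assumes S: "riemann_surface S" and P: "holomorphic_map unit_disc S P"
    and a: "cmod a < 1" and r: "0 < r" "inj_on P (ball a r)" "ball a r \<subseteq> ball 0 1"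
    and t: "t \<in> carrier (Aut S)"
    and rot: "\<And>z. cmod z < 1 \<Longrightarrow> P (hyp_rotation a \<theta> z) = t (P z)"
  shows "has_multiplier S t (P a) (cis \<theta>)"
  unfolding has_multiplier_def
proof (intro conjI)
  have ta: "t (P a) = P a" using rot[OF a] a by simp
  then show "t (P a) = P a" .
  note oc = riemann_surface_open_charts[OF S]
  note cP = holomorphic_map_continuous[OF P]
  have PS: "P z \<in> points S" if "cmod z < 1" for z
    using continuous_map_in_topspace[OF cP] that by simp
  have "((\<lambda>z. \<phi> (t (inv_into U \<phi> z))) has_field_derivative cis \<theta>) (at (\<phi> (P a)))"
    if U: "(U, \<phi>) \<in> rs_charts S" "P a \<in> U" for U \<phi>
  proof -
    note inv = chart_inv[OF S U(1)]
    define k where "k = \<phi> \<circ> P"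
    define F where "F = \<phi> \<circ> t \<circ> inv_into U \<phi>"
    have ana: "k analytic_on {z}" if "cmod z < 1" "P z \<in> U" for z
      using holomorphic_mapD[OF riemann_surface_unit_disc oc P _ U(1) that(2)] that(1)
      unfolding k_def by (simp add: holo_at_unit_disc)
    have "openin (rs_top unit_disc) {z \<in> ball 0 1. P z \<in> U}"
      using continuous_map_vimage_openin[OF cP chart_open[OF S U(1)] openin_topspace] by simp
    then have oD: "open {z \<in> ball 0 1. P z \<in> U}"
      by (simp add: unit_disc_def openin_open_eq)
    define D where "D = {z \<in> ball 0 1. P z \<in> U} \<inter> ball a r"
    have D: "open D" "a \<in> D" using oD a U(2) r(1) by (auto simp: D_def)
    have "k analytic_on D" using ana analytic_on_analytic_at[of k D] by (auto simp: D_def)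
    then have hk: "k holomorphic_on D" by (rule analytic_imp_holomorphic)
    have "inj_on k D"
    proof (rule inj_onI)
      fix x y assume xy: "x \<in> D" "y \<in> D" "k x = k y"
      then have "P x = P y" using inv by (auto simp: D_def k_def) metis
      then show "x = y" using r(2) xy by (auto simp: D_def inj_on_def)
    qed
    then have k0: "deriv k a \<noteq> 0"
      using holomorphic_injective_imp_regular[OF hk D(1) _ D(2)] by blast
    have dk: "(k has_field_derivative deriv k a) (at a)"
      by (rule holomorphic_derivI[OF hk D])
    have "holo_at S (\<phi> \<circ> t) (P a)"
      by (rule holomorphic_mapD[OF S oc AutD(3)[OF t] PS[OF a] U(1)]) (simp add: ta U(2))
    then have "F analytic_on {\<phi> (P a)}"
      using holo_at_chart_iff[OF S U] by (simp add: F_def)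
    then have dF: "(F has_field_derivative deriv F (k a)) (at (k a))"
      using analytic_on_imp_differentiable_at[of F "{\<phi> (P a)}"] DERIV_deriv_iff_field_differentiable
      by (auto simp: k_def)
    have "eventually (\<lambda>z. z \<in> D) (nhds a)"
      by (rule eventually_nhds_in_open[OF D])
    then have ev: "eventually (\<lambda>z. (F \<circ> k) z = (k \<circ> hyp_rotation a \<theta>) z) (nhds a)"
      by eventually_elim (auto simp: D_def F_def k_def inv rot)
    have d1: "(F \<circ> k has_field_derivative deriv F (k a) * deriv k a) (at a)"
      by (rule DERIV_chain[OF dF dk])
    have d2: "(k \<circ> hyp_rotation a \<theta> has_field_derivative deriv k a * cis \<theta>) (at a)"
      by (rule DERIV_chain[OF _ deriv_hyp_rotation[OF a]]) (use dk a in simp)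
    have "deriv F (k a) * deriv k a = deriv k a * cis \<theta>"
      using DERIV_unique[OF _ d2] DERIV_cong_ev[OF refl ev refl] d1 by blast
    then have "deriv F (k a) = cis \<theta>" using k0 by simp
    then show ?thesis using dF by (simp add: F_def k_def o_def)
  qed
  then show "\<forall>(U, \<phi>)\<in>rs_charts S. P a \<in> U \<longrightarrow>
      ((\<lambda>z. \<phi> (t (inv_into U \<phi> z))) has_field_derivative cis \<theta>) (at (\<phi> (P a)))" by blast
qed

section \<open>The projection of a free Fuchsian group is locally injective\<close>

lemma one_minus_cnj_mult_nonzero:
  assumes "cmod a < 1" "cmod z < 1"
  shows "1 - cnj a * z \<noteq> 0"
proof
  assume "1 - cnj a * z = 0"
  then have "cmod (cnj a * z) = 1" by (metis eq_iff_diff_eq_0 norm_one)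
  then have "cmod a * cmod z = 1" by (simp add: norm_mult)
  moreover have "cmod a * cmod z < 1 * 1" using assms by (intro mult_strict_mono') auto
  ultimately show False by simp
qed

lemma tendsto_moebius:
  assumes "(f \<longlongrightarrow> a) F" "(g \<longlongrightarrow> z) F" "cmod a < 1" "cmod z < 1"
  shows "((\<lambda>n. moebius (f n) (g n)) \<longlongrightarrow> moebius a z) F"
  unfolding Moebius_function_simple
  by (intro tendsto_intros assms one_minus_cnj_mult_nonzero)

lemma Aut_unit_disc_explicit:
  assumes f: "f \<in> carrier (Aut unit_disc)" and z: "cmod z < 1"
  obtains c where "cmod c = 1" "\<And>w. cmod w < 1 \<Longrightarrow> f w = moebius (- f z) (c * moebius z w)"
proof -
  obtain c where c: "cmod c = 1" "\<And>w. cmod w < 1 \<Longrightarrow> moebius (f z) (f w) = c * moebius z w"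
    using Aut_unit_disc_moebius[OF f z] by blast
  have fb: "cmod (f w) < 1" if "cmod w < 1" for w using Aut_unit_discD(5)[OF f, of w] that by simp
  have "f w = moebius (- f z) (c * moebius z w)" if "cmod w < 1" for w
    using moebius_inverse(1)[OF fb[OF z] fb[OF that]] c(2)[OF that] by simp
  with c(1) show ?thesis by (rule that)
qed

text \<open>Otherwise there are nontrivial elements moving points close to \<open>a\<close> to points close to \<open>a\<close>.
  They subconverge, so by discreteness they are eventually constant, and the limit fixes \<open>a\<close>.\<close>

lemma free_fuchsian_locally_injective:
  assumes G: "subgroup \<Gamma>' (Aut unit_disc)" and sub: "\<Gamma>' \<subseteq> \<Gamma>" and fuchs: "fuchsian_group \<Gamma>"
    and free: "acts_freely \<Gamma>'" and a: "cmod a < 1"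
  obtains r where "0 < r" "ball a r \<subseteq> ball 0 1"
    "\<And>g z. g \<in> \<Gamma>' \<Longrightarrow> z \<in> ball a r \<Longrightarrow> g z \<in> ball a r \<Longrightarrow> g z = z"
proof (rule ccontr)
  interpret group "Aut unit_disc" by (rule group_Aut_unit_disc)
  assume no: "\<not> thesis"
  obtain K \<epsilon> where K: "compact K" "K \<subseteq> ball 0 1" "\<epsilon> > 0"
    "\<And>g. g \<in> \<Gamma> \<Longrightarrow> (\<And>z. z \<in> K \<Longrightarrow> dist (g z) z < \<epsilon>) \<Longrightarrow> g = \<one>\<^bsub>Aut unit_disc\<^esub>"
    using fuchs unfolding fuchsian_group_def by metis
  have Gc: "g \<in> carrier (Aut unit_disc)" if "g \<in> \<Gamma>'" for g
    using subgroup.mem_carrier[OF G that] .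
  obtain r0 where r0: "r0 > 0" "ball a r0 \<subseteq> ball 0 1"
    using a by (metis mem_ball_0 open_ball open_contains_ball)
  have "\<exists>g z. g \<in> \<Gamma>' \<and> z \<in> ball a (r0 / Suc n) \<and> g z \<in> ball a (r0 / Suc n) \<and> g z \<noteq> z" for n
  proof (rule ccontr)
    assume c: "\<not> ?thesis"
    have "r0 / Suc n \<le> r0" using r0 by (simp add: field_simps)
    then have "ball a (r0 / Suc n) \<subseteq> ball 0 1" using r0(2) by (meson subset_ball subset_trans)
    then show False using that[of "r0 / Suc n"] no c r0(1) by auto
  qed
  then obtain g z where g: "\<And>n. g n \<in> \<Gamma>'" and z: "\<And>n. z n \<in> ball a (r0 / Suc n)"
      "\<And>n. g n (z n) \<in> ball a (r0 / Suc n)" "\<And>n. g n (z n) \<noteq> z n"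
    by metis
  have lim0: "(\<lambda>n. r0 / Suc n) \<longlonglongrightarrow> 0"
    by (rule LIMSEQ_Suc[OF lim_const_over_n])
  have conv: "u \<longlonglongrightarrow> a" if "\<And>n. u n \<in> ball a (r0 / Suc n)" for u
  proof (rule metric_tendsto_imp_tendsto[OF lim0 always_eventually], rule allI)
    fix n
    show "dist (u n) a \<le> dist (r0 / Suc n) 0"
      using that[of n] r0(1) by (simp add: dist_commute)
  qed
  define w where "w = (\<lambda>n. g n (z n))"
  have zl: "z \<longlonglongrightarrow> a" and wl: "w \<longlonglongrightarrow> a" using z by (auto intro: conv simp: w_def)
  have in1: "cmod u < 1" if "u \<in> ball a (r0 / Suc n)" for u n
  proof -
    have "r0 / Suc n \<le> r0" using r0 by (simp add: field_simps)
    then have "u \<in> ball a r0" using that by auto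
    then show ?thesis using r0(2) by auto
  qed
  have z1: "cmod (z n) < 1" and w1: "cmod (w n) < 1" for n using in1 z by (auto simp: w_def)
  have "\<exists>c. cmod c = 1 \<and> (\<forall>u. cmod u < 1 \<longrightarrow> g n u = moebius (- w n) (c * moebius (z n) u))" for n
    using Aut_unit_disc_explicit[OF Gc[OF g] z1[of n], of n] unfolding w_def by metis
  then obtain c where c: "\<And>n. cmod (c n) = 1"
      "\<And>n u. cmod u < 1 \<Longrightarrow> g n u = moebius (- w n) (c n * moebius (z n) u)"
    by metis
  \<comment> \<open>Each \<open>g n\<close> is determined by \<open>z n\<close>, its image
    \<open>w n\<close> and the unimodular factor \<open>c n\<close>. The first two tend to
    \<open>a\<close> and the circle is compact, so all three converge along a subsequence
    \<open>s\<close>.\<close>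
  have "compact (sphere (0::complex) 1)" by simp
  moreover have "\<forall>n. c n \<in> sphere 0 1" using c(1) by simp
  ultimately obtain c0 s where c0: "cmod c0 = 1" and s: "strict_mono s" "(c \<circ> s) \<longlonglongrightarrow> c0"
    unfolding compact_def by (metis dist_0_norm mem_sphere)
  define k where "k = (\<lambda>n u. moebius (- z n) (cnj (c n) * moebius (w n) u))"
  have k_g: "k n (g n u) = u" if "cmod u < 1" for n u
  proof -
    have b: "cmod (c n * moebius (z n) u) < 1" using c(1) z1 that by (simp add: norm_mult)
    have cc: "cnj (c n) * c n = 1"
      using c(1)[of n] by (metis complex_norm_square mult.commute of_real_1 power_one)
    have "k n (g n u) = moebius (- z n) ((cnj (c n) * c n) * moebius (z n) u)"
      using w1[of n] b by (simp add: k_def c(2)[OF that] mult.assoc)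
    then show ?thesis unfolding cc using z1 that by simp
  qed
  have ginv: "m_inv (Aut unit_disc) (g n) u = k n u" if u: "cmod u < 1" for n u
  proof -
    note B = Aut_unit_discD(2)[OF Gc[OF g[of n]]]
    obtain v where v: "cmod v < 1" "g n v = u"
      using B u unfolding bij_betw_def by (metis imageE mem_ball_0)
    have "(m_inv (Aut unit_disc) (g n) \<otimes>\<^bsub>Aut unit_disc\<^esub> g n) v = v"
      using Aut_one_apply[of v unit_disc] v(1) Gc[OF g] by simp
    then show ?thesis
      using Aut_mult_apply[OF inv_closed[OF Gc[OF g]] Gc[OF g], of v n n] v k_g[OF v(1), of n] by simp
  qed
  \<comment> \<open>Discreteness isolates only the identity. It is therefore applied to the
    quotients of consecutive elements, whose parameters have the same limits.\<close>
  define h where "h = (\<lambda>n. m_inv (Aut unit_disc) (g (s n)) \<otimes>\<^bsub>Aut unit_disc\<^esub> g (s (Suc n)))"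
  have hG: "h n \<in> \<Gamma>'" for n
    unfolding h_def by (intro subgroup.m_closed[OF G] subgroup.m_inv_closed[OF G] g)
  have h_eq: "h n u = k (s n) (g (s (Suc n)) u)" if "cmod u < 1" for n u
  proof -
    have "cmod (g (s (Suc n)) u) < 1"
      using Aut_unit_discD(5)[OF Gc[OF g], of u] that by simp
    then show ?thesis
      unfolding h_def using Aut_mult_apply[OF inv_closed[OF Gc[OF g]] Gc[OF g], of u] that ginv by simp
  qed
  have "eventually (\<lambda>n. h n = \<one>\<^bsub>Aut unit_disc\<^esub>) sequentially"
  proof (rule ccontr)
    assume "\<not> ?thesis"
    then have "\<exists>\<^sub>F n in sequentially. h n \<noteq> \<one>\<^bsub>Aut unit_disc\<^esub>" by (simp add: frequently_def)
    then have "infinite {n. h n \<noteq> \<one>\<^bsub>Aut unit_disc\<^esub>}"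
      by (simp add: frequently_cofinite flip: cofinite_eq_sequentially)
    then obtain q :: "nat \<Rightarrow> nat" where q: "strict_mono q" "\<And>n. h (q n) \<noteq> \<one>\<^bsub>Aut unit_disc\<^esub>"
      using infinite_enumerate by blast
    have "\<exists>u\<in>K. \<epsilon> \<le> dist (h (q n) u) u" for n
      using K(4)[of "h (q n)"] hG sub q(2) by (meson linorder_not_le subsetD)
    \<comment> \<open>The quotients have to approach the identity uniformly on \<open>K\<close>.
      Otherwise points of \<open>K\<close> moved by at least \<open>\<epsilon>\<close> accumulate at
      some \<open>l\<close> in \<open>K\<close>, where the limits of the two factors cancel.\<close>
    then obtain u where u: "\<And>n. u n \<in> K" "\<And>n. \<epsilon> \<le> dist (h (q n) (u n)) (u n)" by metis
    obtain l v where l: "l \<in> K" and v: "strict_mono v" "(u \<circ> v) \<longlonglongrightarrow> l"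
      using K(1) u(1) unfolding compact_def by metis
    have l1: "cmod l < 1" using l K(2) by auto
    have u1: "cmod (u n) < 1" for n using u(1) K(2) by (meson mem_ball_0 subsetD)
    define j where "j = (\<lambda>n. s (q (v n)))"
    define j' where "j' = (\<lambda>n. s (Suc (q (v n))))"
    have mono: "strict_mono (\<lambda>n. q (v n))" using q(1) v(1) by (simp add: strict_mono_def)
    have fj: "filterlim j sequentially sequentially" and fj': "filterlim j' sequentially sequentially"
      using mono s(1) by (auto intro!: filterlim_subseq simp: j_def j'_def strict_mono_def)
    have fq: "filterlim (\<lambda>n. q (v n)) sequentially sequentially" by (rule filterlim_subseq[OF mono])
    have fq': "filterlim (\<lambda>n. Suc (q (v n))) sequentially sequentially"
      using mono by (auto intro!: filterlim_subseq simp: strict_mono_def)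
    have zj: "(\<lambda>n. z (j n)) \<longlonglongrightarrow> a" "(\<lambda>n. z (j' n)) \<longlonglongrightarrow> a" "(\<lambda>n. w (j n)) \<longlonglongrightarrow> a" "(\<lambda>n. w (j' n)) \<longlonglongrightarrow> a"
      using filterlim_compose[OF zl fj] filterlim_compose[OF zl fj'] filterlim_compose[OF wl fj]
        filterlim_compose[OF wl fj'] by simp_all
    have cj: "(\<lambda>n. c (j n)) \<longlonglongrightarrow> c0" "(\<lambda>n. c (j' n)) \<longlonglongrightarrow> c0"
      using filterlim_compose[OF s(2) fq] filterlim_compose[OF s(2) fq'] by (simp_all add: j_def j'_def)
    have ul: "(\<lambda>n. u (v n)) \<longlonglongrightarrow> l" using v(2) by (simp add: o_def)
    have b1: "cmod (c0 * moebius a l) < 1" using c0 a l1 by (simp add: norm_mult)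
    have b2: "cmod (moebius (- a) (c0 * moebius a l)) < 1" using b1 a by simp
    have b3: "cmod (cnj c0 * moebius a (moebius (- a) (c0 * moebius a l))) < 1"
      using c0 a b2 by (simp add: norm_mult)
    have "(\<lambda>n. h (q (v n)) (u (v n))) \<longlonglongrightarrow>
        moebius (- a) (cnj c0 * moebius a (moebius (- a) (c0 * moebius a l)))"
    proof -
      have "h (q (v n)) (u (v n)) = moebius (- z (j n)) (cnj (c (j n)) * moebius (w (j n))
          (moebius (- w (j' n)) (c (j' n) * moebius (z (j' n)) (u (v n)))))" for n
        unfolding h_eq[OF u1] by (simp add: k_def c(2)[OF u1] j_def j'_def)
      moreover have "(\<lambda>n. moebius (- z (j n)) (cnj (c (j n)) * moebius (w (j n))
          (moebius (- w (j' n)) (c (j' n) * moebius (z (j' n)) (u (v n)))))) \<longlonglongrightarrow>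
          moebius (- a) (cnj c0 * moebius a (moebius (- a) (c0 * moebius a l)))"
        by (intro tendsto_moebius tendsto_mult tendsto_minus tendsto_cnj zj cj ul) (use a l1 b1 b2 b3 in simp_all)
      ultimately show ?thesis by simp
    qed
    moreover have "moebius (- a) (cnj c0 * moebius a (moebius (- a) (c0 * moebius a l))) = l"
    proof -
      have cc: "cnj c0 * c0 = 1"
        using c0 by (metis complex_norm_square mult.commute of_real_1 power_one)
      have e: "cnj c0 * (c0 * moebius a l) = moebius a l" by (simp add: cc flip: mult.assoc)
      show ?thesis using a b1 l1 by (simp add: e del: mult_cancel_right1)
    qed
    ultimately have "(\<lambda>n. dist (h (q (v n)) (u (v n))) (u (v n))) \<longlonglongrightarrow> dist l l"
      using ul by (intro tendsto_dist) simp_all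
    then have "eventually (\<lambda>n. dist (h (q (v n)) (u (v n))) (u (v n)) < \<epsilon>) sequentially"
      using K(3) by (intro order_tendstoD) simp_all
    then obtain n where "dist (h (q (v n)) (u (v n))) (u (v n)) < \<epsilon>"
      by (meson eventually_happens' sequentially_bot)
    then show False using u(2)[of "v n"] by simp
  qed
  then obtain N where N: "\<And>n. n \<ge> N \<Longrightarrow> h n = \<one>\<^bsub>Aut unit_disc\<^esub>"
    unfolding eventually_sequentially by blast
  have const: "g (s (N + n)) = g (s N)" for n
  proof (induction n)
    case (Suc n)
    have "h (N + n) = \<one>\<^bsub>Aut unit_disc\<^esub>" by (rule N) simp
    then have "g (s (Suc (N + n))) = g (s (N + n))"
      unfolding h_def using Gc[OF g] by (metis inv_closed inv_equality inv_inv)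
    then show ?case using Suc by simp
  qed simp
  define f where "f = g (s N)"
  have fc: "f \<in> carrier (Aut unit_disc)" using Gc[OF g] by (simp add: f_def)
  have fl: "filterlim (\<lambda>n. s (N + n)) sequentially sequentially"
    using s(1) by (intro filterlim_subseq) (simp add: strict_mono_def)
  have "isCont f a"
    using holomorphic_on_imp_continuous_on[OF Aut_unit_discD(3)[OF fc]] a
    by (simp add: continuous_on_eq_continuous_at)
  then have "(\<lambda>n. f (z (s (N + n)))) \<longlonglongrightarrow> f a"
    using filterlim_compose[OF zl fl] by (rule isCont_tendsto_compose)
  moreover have "(\<lambda>n. f (z (s (N + n)))) = (\<lambda>n. w (s (N + n)))"
    using const by (auto simp: w_def f_def)
  moreover have "(\<lambda>n. w (s (N + n))) \<longlonglongrightarrow> a" by (rule filterlim_compose[OF wl fl])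
  ultimately have "f a = a" using LIMSEQ_unique by metis
  then have "f = \<one>\<^bsub>Aut unit_disc\<^esub>"
    using free g a unfolding acts_freely_def f_def by (meson mem_ball_0)
  then have "g (s N) (z (s N)) = z (s N)"
    using Aut_one_apply[of "z (s N)" unit_disc] z1 by (simp add: f_def)
  then show False using z(3) by blast
qed

section \<open>Arithmetic of the case distinction\<close>

text \<open>The three groups divide 1, i, j, k by 1, by i and by j, and list the other three ratios
  in cyclic pairs. Any two of the four residues include one of 1, i, j, so a coincidence always
  shows up here as a ratio 1.\<close>

lemma Lambda_e_mem:
  fixes p i j :: nat
  defines "q \<equiv> int p" and "k \<equiv> - (int i + int j + 1)"
    and "i' \<equiv> modular_inverse (int p) (int i)" and "j' \<equiv> modular_inverse (int p) (int j)"
  shows "(int i mod q, int j mod q) \<in> Lambda_e p i j" "(int j mod q, k mod q) \<in> Lambda_e p i j"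
    "(k mod q, int i mod q) \<in> Lambda_e p i j"
    "(i' * int j mod q, i' mod q) \<in> Lambda_e p i j" "(i' mod q, i' * k mod q) \<in> Lambda_e p i j"
    "(i' * k mod q, i' * int j mod q) \<in> Lambda_e p i j"
    "(j' mod q, int i * j' mod q) \<in> Lambda_e p i j" "(int i * j' mod q, j' * k mod q) \<in> Lambda_e p i j"
    "(j' * k mod q, j' mod q) \<in> Lambda_e p i j"
  unfolding Lambda_e_def Let_def q_def k_def i'_def j'_def
  by (simp_all only: image_insert split_conv insert_iff simp_thms)

text \<open>Two equal residues, scaled to 1, leave \<open>m\<close> and \<open>x\<close> with
  \<open>2 + m + x\<close> divisible by \<open>p\<close>. The second case covers \<open>m\<close>
  from 2 to \<open>p - 4\<close>, and the remaining values are treated one by one: 1 is the first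
  case, \<open>p - 3\<close> makes \<open>x\<close> equal to 1 and leads back to it,
  \<open>p - 2\<close> makes \<open>x\<close> vanish, and \<open>p - 1\<close> makes
  \<open>x\<close> equal to -1, the third case. The hypotheses \<open>ones\<close> and
  \<open>minus_ones\<close> supply the pairs required for this.\<close>

lemma kappa6_no_unit_pair:
  fixes m x :: int
  assumes p: "prime p" "odd p" and \<kappa>: "kappa6 p i j"
    and sum: "int p dvd 2 + m + x" and nz: "\<not> int p dvd m" "\<not> int p dvd x"
    and unit: "(1, m mod int p) \<in> Lambda_e p i j \<or> (m mod int p, 1) \<in> Lambda_e p i j"
    and ones: "[x = 1] (mod int p) \<Longrightarrow> (1, 1) \<in> Lambda_e p i j"
    and minus_ones: "[m = -1] (mod int p) \<Longrightarrow> [x = -1] (mod int p) \<Longrightarrow> (int p - 1, int p - 1) \<in> Lambda_e p i j"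
  shows False
proof -
  define q where "q = int p"
  define \<mu> where "\<mu> = m mod q"
  have q2: "q > 2" using p prime_ge_2_nat[of p] by (cases "p = 2") (auto simp: q_def)
  have m\<mu>: "q dvd m - \<mu>" unfolding \<mu>_def by (simp add: dvd_minus_mod)
  have "q dvd (2 + m + x) - (m - \<mu>)" using sum m\<mu> unfolding q_def by (rule dvd_diff)
  then have x\<mu>: "q dvd x + 2 + \<mu>" by (simp add: algebra_simps)
  have k: "(1, 1) \<notin> Lambda_e p i j" "(q - 1, q - 1) \<notin> Lambda_e p i j"
    "\<And>m. m \<in> {2..q - 4} \<Longrightarrow> (1, m) \<notin> Lambda_e p i j \<and> (m, 1) \<notin> Lambda_e p i j"
    using \<kappa> unfolding kappa6_def kappa1_def kappa2_def kappa3_def q_def by blast+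
  have "0 \<le> \<mu>" "\<mu> < q" using q2 by (simp_all add: \<mu>_def)
  moreover have "\<mu> \<noteq> 0" using nz(1) by (auto simp: \<mu>_def q_def)
  ultimately consider "\<mu> = 1" | "\<mu> \<in> {2..q - 4}" | "\<mu> = q - 3" | "\<mu> = q - 2" | "\<mu> = q - 1"
    by fastforce
  then show False
  proof cases
    case 1
    then show False using k(1) unit by (simp add: \<mu>_def q_def)
  next
    case 2
    then show False using k(3)[of \<mu>] unit by (simp add: \<mu>_def q_def)
  next
    case 3
    then have "x + 2 + \<mu> = (x - 1) + q" by simp
    then have "q dvd (x - 1) + q" using x\<mu> by (simp only:)
    then have "[x = 1] (mod q)" by (simp add: cong_iff_dvd_diff)
    then show False using ones k(1) by (simp add: q_def)
  next
    case 4
    then have "x + 2 + \<mu> = x + q" by simp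
    then have "q dvd x + q" using x\<mu> by (simp only:)
    then show False using nz(2) by (simp add: q_def)
  next
    case 5
    then have "x + 2 + \<mu> = (x + 1) + q" "m - \<mu> = (m + 1) - q" by simp_all
    then have "q dvd (x + 1) + q" "q dvd (m + 1) - q" using x\<mu> m\<mu> by (simp_all only:)
    then have "q dvd x + 1" "q dvd m + 1"
      using dvd_add[of q "m + 1 - q" q] by (simp_all only: dvd_add_triv_right_iff dvd_refl diff_add_cancel)
    then have "[x = -1] (mod q)" "[m = -1] (mod q)" by (simp_all add: cong_iff_dvd_diff)
    then show False using minus_ones k(2) by (simp add: q_def)
  qed
qed

text \<open>If two of 1, i, j, k agree, dividing by one of them leads to
  \<open>kappa6_no_unit_pair\<close>. Once coincidences are excluded, a residue -1 gives a pair
  \<open>(-1, m)\<close> with \<open>m\<close> different from 0, 1 and -1; this is the fourth or the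
  fifth case, according to whether \<open>p\<close> divides \<open>m^2 + 1\<close>.\<close>

lemma kappa6_residues:
  assumes p: "prime p" "odd p" and \<kappa>: "kappa6 p i j"
    and i: "i \<in> {1..p - 1}" and j: "j \<in> {1..p - 1}" and ij: "\<not> p dvd i + j + 1"
  defines "k \<equiv> - (int i + int j + 1)"
  shows "\<not> [int i = 1] (mod int p)" "\<not> [int j = 1] (mod int p)" "\<not> [k = 1] (mod int p)"
    "\<not> [int i = int j] (mod int p)" "\<not> [int j = k] (mod int p)" "\<not> [int i = k] (mod int p)"
    "\<not> [int i = -1] (mod int p)" "\<not> [int j = -1] (mod int p)" "\<not> [k = -1] (mod int p)"
proof -
  define q where "q = int p"
  have q2: "q > 2" using p prime_ge_2_nat[of p] by (cases "p = 2") (auto simp: q_def)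
  have pq: "prime q" using p(1) by (simp add: q_def)
  define i' j' where "i' = modular_inverse q (int i)" and "j' = modular_inverse q (int j)"
  note mem = Lambda_e_mem[where p = p and i = i and j = j, folded q_def, folded k_def i'_def j'_def]
  note no = kappa6_no_unit_pair[OF p \<kappa>, folded q_def]
  have M1: "a mod q = 1" if "[a = 1] (mod q)" for a using that q2 by (simp add: cong_def)
  have Mm: "a mod q = q - 1" if "[a = -1] (mod q)" for a
    using that q2 by (simp add: cong_def zmod_minus1)
  have sum: "1 + int i + int j + k = 0" by (simp add: k_def)
  have ni: "\<not> q dvd int i" and nj: "\<not> q dvd int j"
    using i j by (auto simp: q_def int_dvd_int_iff dest: dvd_imp_le)
  have nk: "\<not> q dvd k"
  proof
    assume "q dvd k"
    then have "q dvd int (i + j + 1)" unfolding k_def by (simp only: dvd_minus_iff) (simp add: algebra_simps)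
    then show False using ij unfolding q_def int_dvd_int_iff by blast
  qed
  have cop: "coprime (int i) q" "coprime (int j) q"
    using ni nj pq by (metis prime_imp_coprime coprime_commute)+
  have ii: "[i' * int i = 1] (mod q)" and jj: "[j' * int j = 1] (mod q)"
    using cong_modular_inverse2[OF cop(1)] cong_modular_inverse2[OF cop(2)] by (simp_all add: i'_def j'_def)
  have inv_nz: "\<not> q dvd a" if "[a * b = 1] (mod q)" for a b
  proof
    assume "q dvd a"
    then have "[a * b = 0] (mod q)" by (simp add: cong_0_iff)
    then have "[1 = 0] (mod q)" using that by (metis cong_sym cong_trans)
    then show False using q2 by (simp add: cong_def)
  qed
  note ni' = inv_nz[OF ii] and nj' = inv_nz[OF jj]
  have nm: "\<not> q dvd a * b" if "\<not> q dvd a" "\<not> q dvd b" for a b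
    using that pq prime_dvd_mult_iff by blast
  show i1: "\<not> [int i = 1] (mod int p)"
  proof
    assume "[int i = 1] (mod int p)"
    then have h: "[int i = 1] (mod q)" by (simp add: q_def)
    show False
    proof (rule no[of "int j" k])
      have "2 + int j + k = - (int i - 1)" using sum by simp
      then show "q dvd 2 + int j + k" using h by (simp only: cong_iff_dvd_diff dvd_minus_iff)
      show "(1, int j mod q) \<in> Lambda_e p i j \<or> (int j mod q, 1) \<in> Lambda_e p i j"
        using mem(1) M1[OF h] by simp
      show "(1, 1) \<in> Lambda_e p i j" if "[k = 1] (mod q)" using mem(3) M1[OF that] M1[OF h] by simp
      show "(q - 1, q - 1) \<in> Lambda_e p i j" if "[int j = -1] (mod q)" "[k = -1] (mod q)"
        using mem(2) Mm[OF that(1)] Mm[OF that(2)] by simp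
    qed (fact nj nk)+
  qed
  show j1: "\<not> [int j = 1] (mod int p)"
  proof
    assume "[int j = 1] (mod int p)"
    then have h: "[int j = 1] (mod q)" by (simp add: q_def)
    show False
    proof (rule no[of "int i" k])
      have "2 + int i + k = - (int j - 1)" using sum by simp
      then show "q dvd 2 + int i + k" using h by (simp only: cong_iff_dvd_diff dvd_minus_iff)
      show "(1, int i mod q) \<in> Lambda_e p i j \<or> (int i mod q, 1) \<in> Lambda_e p i j"
        using mem(1) M1[OF h] by simp
      show "(1, 1) \<in> Lambda_e p i j" if "[k = 1] (mod q)" using mem(2) M1[OF that] M1[OF h] by simp
      show "(q - 1, q - 1) \<in> Lambda_e p i j" if "[int i = -1] (mod q)" "[k = -1] (mod q)"
        using mem(3) Mm[OF that(1)] Mm[OF that(2)] by simp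
    qed (fact ni nk)+
  qed
  show k1: "\<not> [k = 1] (mod int p)"
  proof
    assume "[k = 1] (mod int p)"
    then have h: "[k = 1] (mod q)" by (simp add: q_def)
    show False
    proof (rule no[of "int j" "int i"])
      have "2 + int j + int i = - (k - 1)" using sum by simp
      then show "q dvd 2 + int j + int i" using h by (simp only: cong_iff_dvd_diff dvd_minus_iff)
      show "(1, int j mod q) \<in> Lambda_e p i j \<or> (int j mod q, 1) \<in> Lambda_e p i j"
        using mem(2) M1[OF h] by simp
      show "(1, 1) \<in> Lambda_e p i j" if "[int i = 1] (mod q)" using mem(3) M1[OF that] M1[OF h] by simp
      show "(q - 1, q - 1) \<in> Lambda_e p i j" if "[int j = -1] (mod q)" "[int i = -1] (mod q)"
        using mem(1) Mm[OF that(1)] Mm[OF that(2)] by simp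
    qed (fact ni nj)+
  qed
  \<comment> \<open>\<open>a\<close> and \<open>c\<close> are the two residues scaled to 1, and
    \<open>b\<close> and \<open>d\<close> are the other two.\<close>
  have scaled: "q dvd 2 + b + d" if "[a = 1] (mod q)" "[c = 1] (mod q)" "a + b + c + d = 0" for a b c d
  proof -
    have "q dvd (a - 1) + (c - 1)" using that(1,2) by (simp only: cong_iff_dvd_diff dvd_add)
    moreover have "2 + b + d = - ((a - 1) + (c - 1))" using that(3) by simp
    ultimately show ?thesis by (simp only: dvd_minus_iff)
  qed
  have si: "i' * int i + i' + i' * int j + i' * k = 0"
  proof -
    have "i' * (1 + int i + int j + k) = 0" by (simp only: sum mult_zero_right)
    then show ?thesis by (simp add: algebra_simps)
  qed
  have sj: "j' * int j + j' + j' * k + int i * j' = 0"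
  proof -
    have "j' * (1 + int i + int j + k) = 0" by (simp only: sum mult_zero_right)
    then show ?thesis by (simp add: algebra_simps)
  qed
  show eij: "\<not> [int i = int j] (mod int p)"
  proof
    assume "[int i = int j] (mod int p)"
    then have "[i' * int i = i' * int j] (mod q)" by (intro cong_scalar_left) (simp add: q_def)
    then have h: "[i' * int j = 1] (mod q)" using ii by (metis cong_sym cong_trans)
    show False
    proof (rule no[of i' "i' * k"])
      show "q dvd 2 + i' + i' * k" by (rule scaled[OF ii h si])
      show "(1, i' mod q) \<in> Lambda_e p i j \<or> (i' mod q, 1) \<in> Lambda_e p i j"
        using mem(4) M1[OF h] by simp
      show "(1, 1) \<in> Lambda_e p i j" if "[i' * k = 1] (mod q)" using mem(6) M1[OF that] M1[OF h] by simp
      show "(q - 1, q - 1) \<in> Lambda_e p i j" if "[i' = -1] (mod q)" "[i' * k = -1] (mod q)"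
        using mem(5) Mm[OF that(1)] Mm[OF that(2)] by simp
    qed (fact ni' nm[OF ni' nk])+
  qed
  show ejk: "\<not> [int j = k] (mod int p)"
  proof
    assume "[int j = k] (mod int p)"
    then have "[j' * int j = j' * k] (mod q)" by (intro cong_scalar_left) (simp add: q_def)
    then have h: "[j' * k = 1] (mod q)" using jj by (metis cong_sym cong_trans)
    show False
    proof (rule no[of j' "int i * j'"])
      show "q dvd 2 + j' + int i * j'" by (rule scaled[OF jj h sj])
      show "(1, j' mod q) \<in> Lambda_e p i j \<or> (j' mod q, 1) \<in> Lambda_e p i j"
        using mem(9) M1[OF h] by simp
      show "(1, 1) \<in> Lambda_e p i j" if "[int i * j' = 1] (mod q)" using mem(8) M1[OF that] M1[OF h] by simp
      show "(q - 1, q - 1) \<in> Lambda_e p i j" if "[j' = -1] (mod q)" "[int i * j' = -1] (mod q)"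
        using mem(7) Mm[OF that(1)] Mm[OF that(2)] by simp
    qed (fact nj' nm[OF ni nj'])+
  qed
  show eik: "\<not> [int i = k] (mod int p)"
  proof
    assume "[int i = k] (mod int p)"
    then have "[i' * int i = i' * k] (mod q)" by (intro cong_scalar_left) (simp add: q_def)
    then have h: "[i' * k = 1] (mod q)" using ii by (metis cong_sym cong_trans)
    show False
    proof (rule no[of "i' * int j" i'])
      have "i' * int i + i' * int j + i' * k + i' = 0" using si by simp
      from scaled[OF ii h this] show "q dvd 2 + i' * int j + i'" .
      show "(1, i' * int j mod q) \<in> Lambda_e p i j \<or> (i' * int j mod q, 1) \<in> Lambda_e p i j"
        using mem(6) M1[OF h] by simp
      show "(1, 1) \<in> Lambda_e p i j" if "[i' = 1] (mod q)" using mem(5) M1[OF that] M1[OF h] by simp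
      show "(q - 1, q - 1) \<in> Lambda_e p i j" if "[i' * int j = -1] (mod q)" "[i' = -1] (mod q)"
        using mem(4) Mm[OF that(1)] Mm[OF that(2)] by simp
    qed (fact ni' nm[OF ni' nj])+
  qed
  have minus_one: False
    if "(a mod q, b mod q) \<in> Lambda_e p i j" "[a = -1] (mod q)" "\<not> q dvd b" "\<not> [b = 1] (mod q)"
      "\<not> [b = a] (mod q)" for a b
  proof -
    define m where "m = b mod q"
    have bm: "[b = m] (mod q)" by (simp add: m_def cong_def)
    have mem': "(q - 1, m) \<in> Lambda_e p i j" using that(1) Mm[OF that(2)] by (simp add: m_def)
    have "m \<noteq> 0" using that(3) by (auto simp: m_def)
    moreover have "m \<noteq> 1" using that(4) bm by auto
    moreover have "m \<noteq> q - 1"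
    proof
      assume "m = q - 1"
      then have "[b = -1 + q] (mod q)" using bm by simp
      then have "[b = -1] (mod q)" by (simp only: cong_def mod_add_self2)
      then show False using that(2,5) by (metis cong_sym cong_trans)
    qed
    moreover have "0 \<le> m" "m < q" using q2 by (simp_all add: m_def)
    ultimately have "m \<in> {2..q - 2}" by auto
    then have "q dvd m\<^sup>2 + 1" using \<kappa> mem' unfolding kappa6_def kappa4_def q_def by blast
    then have "[m\<^sup>2 = -1] (mod q)" by (simp add: cong_iff_dvd_diff)
    then show False using \<kappa> mem' unfolding kappa6_def kappa5_def q_def by blast
  qed
  show "\<not> [int i = -1] (mod int p)"
    using minus_one[OF mem(1) _ nj] j1 eij by (auto simp: q_def cong_sym_eq)
  show "\<not> [int j = -1] (mod int p)"
    using minus_one[OF mem(2) _ nk] k1 ejk by (auto simp: q_def cong_sym_eq)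
  show "\<not> [k = -1] (mod int p)"
    using minus_one[OF mem(3) _ ni] i1 eik by (auto simp: q_def cong_sym_eq)
qed

text \<open>Multiplication by a factor \<open>l\<close> different from 1 fixes no nonzero residue,
  so all its orbits on the four residues have the length of the order of \<open>l\<close>, which
  therefore divides 4. Then -1 is a power of \<open>l\<close> and belongs to the orbit of 1,
  contrary to \<open>m1\<close>. The orders 2, 3 and 4 are examined separately.\<close>

lemma four_residues_closed:
  fixes e :: "nat \<Rightarrow> int" and l q :: int
  assumes q: "prime q" and dist: "\<And>s r. s < 4 \<Longrightarrow> r < 4 \<Longrightarrow> [e s = e r] (mod q) \<Longrightarrow> s = r"
    and nz: "\<And>s. s < 4 \<Longrightarrow> \<not> q dvd e s" and e0: "e 0 = 1"
    and m1: "\<And>s. s < 4 \<Longrightarrow> \<not> [e s = -1] (mod q)"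
    and cl: "\<And>s. s < 4 \<Longrightarrow> \<exists>r<4. [l * e s = e r] (mod q)"
  shows "[l = 1] (mod q)"
proof (rule ccontr)
  assume l1: "\<not> [l = 1] (mod q)"
  define X where "X = (\<lambda>s. e s mod q) ` {..<4::nat}"
  have "inj_on (\<lambda>s. e s mod q) {..<4::nat}"
    using dist by (auto simp: inj_on_def cong_def)
  then have cX: "card X = 4" and fX: "finite X" unfolding X_def by (simp_all add: card_image)
  have one: "1 mod q \<in> X" unfolding X_def using e0 by (intro image_eqI[of _ _ 0]) auto
  have clX: "l * y mod q \<in> X" if y: "y mod q \<in> X" for y
  proof -
    obtain s where s: "s < 4" "[y = e s] (mod q)" using y by (auto simp: X_def cong_def)
    obtain r where r: "r < 4" "[l * e s = e r] (mod q)" using cl[OF s(1)] by blast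
    have "[l * y = e r] (mod q)" using cong_trans[OF cong_scalar_left[OF s(2)] r(2)] .
    then show ?thesis using r(1) by (auto simp: X_def cong_def)
  qed
  have m1X: "\<not> [y = -1] (mod q)" if yX: "y mod q \<in> X" for y
  proof
    assume y: "[y = -1] (mod q)"
    obtain s where s: "s < 4" "[y = e s] (mod q)" using yX by (auto simp: X_def cong_def)
    then show False using m1[OF s(1)] y by (metis cong_sym cong_trans)
  qed
  have L: "l mod q \<in> X" "l ^ 2 mod q \<in> X" "l ^ 3 mod q \<in> X" "l ^ 4 mod q \<in> X"
    using clX[OF one[THEN clX[THEN clX[THEN clX]]]] clX[OF one[THEN clX[THEN clX]]]
      clX[OF one[THEN clX]] clX[OF one]
    by (simp_all add: power_numeral_reduce)
  have nl: "\<not> q dvd l"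
  proof
    assume "q dvd l"
    then have "[l = 0] (mod q)" by (simp add: cong_0_iff)
    obtain s where s: "s < 4" "[l = e s] (mod q)" using L(1) by (auto simp: X_def cong_def)
    then show False using nz[OF s(1)] \<open>q dvd l\<close> by (simp add: cong_dvd_iff)
  qed
  then have cop: "coprime l q" using q by (metis prime_imp_coprime coprime_commute)
  have canc: "[x = y] (mod q)" if "[l * x = l * y] (mod q)" for x y
    using that cong_mult_lcancel[OF cop] by blast
  have l2: "\<not> [l ^ 2 = 1] (mod q)"
  proof
    assume "[l ^ 2 = 1] (mod q)"
    then have "q dvd (l - 1) * (l + 1)" by (simp add: cong_iff_dvd_diff algebra_simps power2_eq_square)
    then have "q dvd l - 1 \<or> q dvd l + 1" using q prime_dvd_mult_iff by blast
    then show False using l1 m1X[OF L(1)] by (auto simp: cong_iff_dvd_diff)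
  qed
  have l21: "\<not> [l ^ 2 = l] (mod q)"
    using canc[of l 1] l1 by (auto simp: power2_eq_square)
  have l31: "\<not> [l ^ 3 = l] (mod q)"
    using canc[of "l ^ 2" 1] l2 by (auto simp: power2_eq_square power3_eq_cube mult.assoc)
  have l32: "\<not> [l ^ 3 = l ^ 2] (mod q)"
    using canc[of "l ^ 2" l] l21 by (auto simp: power2_eq_square power3_eq_cube mult.assoc)
  \<comment> \<open>Order 3: the orbit of 1 leaves a single residue \<open>r\<close>, and
    \<open>l * r\<close> would be a fifth one.\<close>
  have l3: "\<not> [l ^ 3 = 1] (mod q)"
  proof
    assume l3: "[l ^ 3 = 1] (mod q)"
    have "card {1 mod q, l mod q, l ^ 2 mod q} \<le> 3" by (simp add: card_insert_if)
    moreover have "card X \<le> card {1 mod q, l mod q, l ^ 2 mod q}"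
      if "X \<subseteq> {1 mod q, l mod q, l ^ 2 mod q}"
      by (rule card_mono[OF _ that]) simp
    ultimately have "\<not> X \<subseteq> {1 mod q, l mod q, l ^ 2 mod q}"
      unfolding cX by linarith
    then obtain r where r: "r \<in> X" "r \<notin> {1 mod q, l mod q, l ^ 2 mod q}" by blast
    have rm: "r mod q = r" using r(1) by (auto simp: X_def)
    have rn: "\<not> [r = 1] (mod q)" "\<not> [r = l] (mod q)" "\<not> [r = l ^ 2] (mod q)"
      using r(2) rm by (auto simp: cong_def)
    have lr: "l * r mod q \<in> X" using clX[of r] r(1) rm by simp
    have a: "\<not> [l * r = 1] (mod q)"
    proof
      assume "[l * r = 1] (mod q)"
      moreover have "[1 = l * l ^ 2] (mod q)"
        using cong_sym[OF l3] by (simp add: power2_eq_square power3_eq_cube mult.assoc)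
      ultimately have "[l * r = l * l ^ 2] (mod q)" by (rule cong_trans)
      then show False using canc rn(3) by blast
    qed
    have b: "\<not> [l * r = l] (mod q)" using canc[of r 1] rn(1) by auto
    have c: "\<not> [l * r = l ^ 2] (mod q)" using canc[of r l] rn(2) by (auto simp: power2_eq_square)
    have d: "\<not> [l * r = r] (mod q)"
    proof
      assume "[l * r = r] (mod q)"
      then have "q dvd (l - 1) * r" by (simp add: cong_iff_dvd_diff algebra_simps)
      then have "q dvd l - 1 \<or> q dvd r" using q prime_dvd_mult_iff by blast
      moreover have "\<not> q dvd r" using r(1) nz by (auto simp: X_def dvd_mod_iff)
      ultimately show False using l1 by (simp add: cong_iff_dvd_diff)
    qed
    have "{1 mod q, l mod q, l ^ 2 mod q, r, l * r mod q} \<subseteq> X" using one L r(1) lr by blast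
    moreover have "card {1 mod q, l mod q, l ^ 2 mod q, r, l * r mod q} = 5"
      using l1 l2 l21 rn a b c d rm by (auto simp: card_insert_if cong_def)
    ultimately have "5 \<le> card X" using card_mono[OF fX] by metis
    then show False using cX by simp
  qed
  \<comment> \<open>Now the first four powers of \<open>l\<close> are distinct and exhaust
    \<open>X\<close>. Closure returns \<open>l ^ 4\<close> to \<open>X\<close>, where only 1 is
    possible, so \<open>l ^ 2\<close> is 1 or -1.\<close>
  have "card {1 mod q, l mod q, l ^ 2 mod q, l ^ 3 mod q} = 4"
    using l1 l2 l21 l31 l32 l3 by (auto simp: card_insert_if cong_def)
  moreover have "{1 mod q, l mod q, l ^ 2 mod q, l ^ 3 mod q} \<subseteq> X" using one L by blast
  ultimately have X: "X = {1 mod q, l mod q, l ^ 2 mod q, l ^ 3 mod q}"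
    using card_subset_eq[OF fX] cX by metis
  have "\<not> [l ^ 4 = l] (mod q)" "\<not> [l ^ 4 = l ^ 2] (mod q)" "\<not> [l ^ 4 = l ^ 3] (mod q)"
    using canc[of "l ^ 3" 1] l3 canc[of "l ^ 3" l] l31 canc[of "l ^ 3" "l ^ 2"] l32
    by (auto simp: power_numeral_reduce)
  then have "[l ^ 4 = 1] (mod q)" using L(4) unfolding X by (auto simp: cong_def)
  then have "q dvd (l ^ 2 - 1) * (l ^ 2 + 1)"
    by (simp add: cong_iff_dvd_diff algebra_simps power_numeral_reduce)
  then have "q dvd l ^ 2 - 1 \<or> q dvd l ^ 2 + 1" using q prime_dvd_mult_iff by blast
  then show False using l2 m1X[OF L(2)] by (auto simp: cong_iff_dvd_diff)
qed

section \<open>The surface, its Fuchsian model and its automorphisms\<close>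

lemma orbit_map_eq_iff:
  assumes S: "riemann_surface S" and H: "subgroup H (Aut S)" and x: "x \<in> points S" and y: "y \<in> points S"
  shows "orbit_map H x = orbit_map H y \<longleftrightarrow> (\<exists>g\<in>H. y = g x)"
proof -
  interpret group "Aut S" by (rule group_Aut[OF S])
  have Hc: "g \<in> carrier (Aut S)" if "g \<in> H" for g by (rule subgroup.mem_carrier[OF H that])
  have sub: "orbit_map H (g z) \<subseteq> orbit_map H z" if g: "g \<in> H" and z: "z \<in> points S" for g z
  proof
    fix w assume "w \<in> orbit_map H (g z)"
    then obtain k where k: "k \<in> H" "w = k (g z)" by (auto simp: orbit_map_def)
    then have "w = (k \<otimes>\<^bsub>Aut S\<^esub> g) z" using Aut_mult_apply[OF Hc[OF k(1)] Hc[OF g] z] by simp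
    then show "w \<in> orbit_map H z"
      using subgroup.m_closed[OF H k(1) g] by (auto simp: orbit_map_def)
  qed
  show ?thesis
  proof
    assume "orbit_map H x = orbit_map H y"
    moreover have "y \<in> orbit_map H y"
      unfolding orbit_map_def
      by (rule image_eqI[of _ _ "\<one>\<^bsub>Aut S\<^esub>"]) (simp_all add: Aut_one_apply[OF y] subgroup.one_closed[OF H])
    ultimately show "\<exists>g\<in>H. y = g x" by (auto simp: orbit_map_def)
  next
    assume "\<exists>g\<in>H. y = g x"
    then obtain g where g: "g \<in> H" "y = g x" by blast
    have "(inv\<^bsub>Aut S\<^esub> g) y = x"
      using Aut_mult_apply[OF inv_closed[OF Hc[OF g(1)]] Hc[OF g(1)] x] Aut_one_apply[OF x] Hc[OF g(1)]
      by (simp add: g(2))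
    then show "orbit_map H x = orbit_map H y"
      using sub[OF g(1) x] sub[OF subgroup.m_inv_closed[OF H g(1)] y] g(2) by auto
  qed
qed

lemma gimelD:
  assumes "gimel p S T" "prime p"
  shows "riemann_surface S" "compact_space (rs_top S)" "T \<in> carrier (Aut S)" "group.ord (Aut S) T = p"
    "card (Fix S T) = 4" "finite (Fix S T)"
    "generate (Aut S) {T} = {T [^]\<^bsub>Aut S\<^esub> k |k. k \<in> (UNIV :: nat set)}"
proof -
  show 1: "riemann_surface S" "compact_space (rs_top S)" "T \<in> carrier (Aut S)"
    "group.ord (Aut S) T = p" "card (Fix S T) = 4"
    using assms unfolding gimel_def by blast+
  then show "finite (Fix S T)" by (metis card.infinite zero_neq_numeral)
  show "generate (Aut S) {T} = {T [^]\<^bsub>Aut S\<^esub> k |k. k \<in> (UNIV :: nat set)}"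
    using group.generate_pow_nat[OF group_Aut[OF 1(1)] 1(3)] 1(4) prime_gt_0_nat[OF assms(2)] by simp
qed

text \<open>The coordinate \<open>u\<close> on the quotient sphere separates the orbits, and the
  orbit of a fixed point of \<open>T\<close> is that point alone. So
  \<open>quotient_invariant\<close> applies, \<open>g\<close> maps every point into its own orbit,
  and \<open>orbit_preserving_imp_power\<close> makes it a power of \<open>T\<close>.\<close>

lemma gimel_fixing_three:
  assumes p: "prime p" and G: "gimel p S T" and g: "g \<in> carrier (Aut S)"
    and q: "q1 \<in> Fix S T" "q2 \<in> Fix S T" "q3 \<in> Fix S T" "q1 \<noteq> q2" "q1 \<noteq> q3" "q2 \<noteq> q3"
    and gq: "g q1 = q1" "g q2 = q2" "g q3 = q3"
  shows "g \<in> generate (Aut S) {T}"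
proof -
  note D = gimelD[OF G p]
  note S = D(1)
  interpret group "Aut S" by (rule group_Aut[OF S])
  define H where "H = generate (Aut S) {T}"
  have H: "subgroup H (Aut S)"
    unfolding H_def by (rule generate_is_subgroup) (use D(3) in simp)
  obtain Q k where Q: "quotient_surface S H Q" and k: "biholomorphic_map Q riemann_sphere k"
    using G unfolding gimel_def biholomorphic_surfaces_def H_def by blast
  have QR: "riemann_surface Q" and hQ: "holomorphic_map S Q (orbit_map H)"
    using Q unfolding quotient_surface_def by blast+
  have hk: "holomorphic_map Q riemann_sphere k" and bk: "bij_betw k (points Q) (points riemann_sphere)"
    using k unfolding biholomorphic_map_def by blast+
  define u where "u = k \<circ> orbit_map H"
  have hu: "holomorphic_map S riemann_sphere u"
    unfolding u_def by (rule holomorphic_map_compose[OF S QR open_charts_sphere hQ hk])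
  have oQ: "orbit_map H x \<in> points Q" if "x \<in> points S" for x
    using continuous_map_in_topspace[OF holomorphic_map_continuous[OF hQ] that] .
  have u_eq: "u x = u y \<longleftrightarrow> (\<exists>n::nat. y = (T [^]\<^bsub>Aut S\<^esub> n) x)" if "x \<in> points S" "y \<in> points S" for x y
  proof -
    have "u x = u y \<longleftrightarrow> orbit_map H x = orbit_map H y"
      using bk oQ that by (auto simp: u_def bij_betw_def inj_on_def)
    also have "\<dots> \<longleftrightarrow> (\<exists>h\<in>H. y = h x)" by (rule orbit_map_eq_iff[OF S H that])
    also have "\<dots> \<longleftrightarrow> (\<exists>n::nat. y = (T [^]\<^bsub>Aut S\<^esub> n) x)"
      unfolding H_def D(7) by blast
    finally show ?thesis .
  qed
  have qp: "q1 \<in> points S" "q2 \<in> points S" "q3 \<in> points S" using q by (auto simp: Fix_def)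
  have fib: "x = r" if x: "x \<in> points S" and r: "r \<in> {q1, q2, q3}" and e: "u x = u r" for x r
  proof -
    have rF: "r \<in> points S" "T r = r" using r q by (auto simp: Fix_def)
    obtain n :: nat where "x = (T [^]\<^bsub>Aut S\<^esub> n) r" using u_eq[OF rF(1) x] e by auto
    then show ?thesis using Aut_pow_fix[OF S D(3) rF] by simp
  qed
  have "\<exists>n::nat. g = T [^]\<^bsub>Aut S\<^esub> n"
  proof (rule orbit_preserving_imp_power[OF S D(2,3) p D(4,6) g])
    fix x assume x: "x \<in> points S"
    have "u (g x) = u x"
      by (rule quotient_invariant[OF S D(2) hu qp q(4-6) fib g gq x])
    then show "\<exists>n::nat. g x = (T [^]\<^bsub>Aut S\<^esub> n) x"
      using u_eq[OF x AutD(4)[OF g x]] by simp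
  qed
  then show ?thesis unfolding D(7) by blast
qed

text \<open>Points of a small disc with the same image differ by an element of the freely acting
  group \<open>\<Gamma>'\<close>, which by \<open>free_fuchsian_locally_injective\<close> moves no
  point within that disc; hence \<open>P\<close> is locally injective. The other clauses translate
  the model into statements about \<open>P\<close>.\<close>

lemma fuchsian_model_projection:
  assumes S: "riemann_surface S" and M: "fuchsian_model p S T \<Gamma> \<Gamma>'"
  obtains P where "holomorphic_map unit_disc S P" "P ` ball 0 1 = points S"
    "\<forall>a. cmod a < 1 \<longrightarrow> (\<exists>r>0. ball a r \<subseteq> ball 0 1 \<and> inj_on P (ball a r))"
    "\<forall>\<gamma>\<in>\<Gamma>. \<exists>t\<in>generate (Aut S) {T}. \<forall>z\<in>ball 0 1. P (\<gamma> z) = t (P z)"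
    "\<forall>\<gamma>\<in>\<Gamma>'. \<forall>z\<in>ball 0 1. P (\<gamma> z) = P z" "\<Gamma>' \<subseteq> carrier (Aut unit_disc)"
proof -
  interpret group "Aut unit_disc" by (rule group_Aut_unit_disc)
  note R = riemann_surface_unit_disc
  have F: "fuchsian_group \<Gamma>" and free: "acts_freely \<Gamma>'"
    and N: "\<Gamma>' \<lhd> (Aut unit_disc)\<lparr>carrier := \<Gamma>\<rparr>"
    using M unfolding fuchsian_model_def by blast+
  obtain Q h where Q: "quotient_surface unit_disc \<Gamma>' Q" and h: "biholomorphic_map Q S h"
    and t: "\<forall>\<gamma>\<in>\<Gamma>. \<exists>t\<in>generate (Aut S) {T}. \<forall>z\<in>ball 0 1. h (orbit_map \<Gamma>' (\<gamma> z)) = t (h (orbit_map \<Gamma>' z))"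
    using M unfolding fuchsian_model_def by blast
  have G: "subgroup \<Gamma> (Aut unit_disc)" using F unfolding fuchsian_group_def by blast
  have N': "subgroup \<Gamma>' ((Aut unit_disc)\<lparr>carrier := \<Gamma>\<rparr>)"
    using N by (rule normal_imp_subgroup)
  have G': "subgroup \<Gamma>' (Aut unit_disc)" by (rule incl_subgroup[OF G N'])
  have sub: "\<Gamma>' \<subseteq> \<Gamma>" using subgroup.subset[OF N'] by simp
  have QR: "riemann_surface Q" and hQ: "holomorphic_map unit_disc Q (orbit_map \<Gamma>')"
    and qm: "quotient_map (rs_top unit_disc) (rs_top Q) (orbit_map \<Gamma>')"
    using Q unfolding quotient_surface_def by blast+
  have hh: "holomorphic_map Q S h" and bh: "bij_betw h (points Q) (points S)"
    using h unfolding biholomorphic_map_def by blast+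
  define P where "P = h \<circ> orbit_map \<Gamma>'"
  have hP: "holomorphic_map unit_disc S P"
    unfolding P_def by (rule holomorphic_map_compose[OF R QR riemann_surface_open_charts[OF S] hQ hh])
  have im: "orbit_map \<Gamma>' ` ball 0 1 = points Q"
    using qm unfolding quotient_map_def by simp
  have P_eq: "P z = P w \<longleftrightarrow> (\<exists>g\<in>\<Gamma>'. w = g z)" if "z \<in> ball 0 1" "w \<in> ball 0 1" for z w
  proof -
    have "orbit_map \<Gamma>' z \<in> points Q" "orbit_map \<Gamma>' w \<in> points Q" using im that by blast+
    then have "P z = P w \<longleftrightarrow> orbit_map \<Gamma>' z = orbit_map \<Gamma>' w"
      using inj_on_eq_iff[OF bij_betw_imp_inj_on[OF bh]] by (simp add: P_def)
    also have "\<dots> \<longleftrightarrow> (\<exists>g\<in>\<Gamma>'. w = g z)" by (rule orbit_map_eq_iff[OF R G']) (use that in simp_all)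
    finally show ?thesis .
  qed
  show ?thesis
  proof (rule that[OF hP])
    show "P ` ball 0 1 = points S"
      using im bh unfolding P_def image_comp[symmetric] bij_betw_def by simp
    have *: "\<exists>r>0. ball a r \<subseteq> ball 0 1 \<and> inj_on P (ball a r)" if a: "cmod a < 1" for a
    proof -
      obtain r where r: "0 < r" "ball a r \<subseteq> ball 0 1"
        "\<And>g z. g \<in> \<Gamma>' \<Longrightarrow> z \<in> ball a r \<Longrightarrow> g z \<in> ball a r \<Longrightarrow> g z = z"
        using free_fuchsian_locally_injective[OF G' sub F free a] by metis
      have "inj_on P (ball a r)"
      proof (rule inj_onI)
        fix z w assume zw: "z \<in> ball a r" "w \<in> ball a r" "P z = P w"
        then obtain g where "g \<in> \<Gamma>'" "w = g z" using P_eq[of z w] r(2) by blast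
        then show "z = w" using r(3)[of g z] zw by simp
      qed
      then show ?thesis using r by blast
    qed
    show "\<forall>a. cmod a < 1 \<longrightarrow> (\<exists>r>0. ball a r \<subseteq> ball 0 1 \<and> inj_on P (ball a r))"
      using * by blast
    show "\<forall>\<gamma>\<in>\<Gamma>. \<exists>t\<in>generate (Aut S) {T}. \<forall>z\<in>ball 0 1. P (\<gamma> z) = t (P z)"
      using t by (simp add: P_def)
    have "P (\<gamma> z) = P z" if "\<gamma> \<in> \<Gamma>'" "z \<in> ball 0 1" for \<gamma> z
    proof -
      have "\<gamma> z \<in> ball 0 1"
        using Aut_unit_discD(5)[OF subgroup.mem_carrier[OF G' that(1)] that(2)] .
      then have "P z = P (\<gamma> z)" using P_eq[OF that(2)] that(1) by blast
      then show ?thesis by simp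
    qed
    then show "\<forall>\<gamma>\<in>\<Gamma>'. \<forall>z\<in>ball 0 1. P (\<gamma> z) = P z" by blast
    show "\<Gamma>' \<subseteq> carrier (Aut unit_disc)" by (rule subgroup.subset[OF G'])
  qed
qed

text \<open>The data attached to the four vertices \<open>s < 4\<close>: the element of the group of \<open>T\<close> with
  multiplier \<open>cis (2 * pi / p)\<close> at the image \<open>P (A s)\<close> is the power \<open>e s\<close> of the one at the first.\<close>

lemma associated_pair_vertices:
  assumes p: "prime p" and G: "gimel p S T" and pair: "associated_pair p S T i j"
  defines "\<theta> \<equiv> 2 * pi / real p"
  obtains P \<tau> and A :: "nat \<Rightarrow> complex" and e :: "nat \<Rightarrow> nat"
  where "holomorphic_map unit_disc S P"
    "\<forall>a. cmod a < 1 \<longrightarrow> (\<exists>r>0. ball a r \<subseteq> ball 0 1 \<and> inj_on P (ball a r))"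
    "\<tau> \<in> generate (Aut S) {T}"
    "\<forall>s<4. cmod (A s) < 1"
    "\<forall>s<4. \<forall>z. cmod z < 1 \<longrightarrow> P (hyp_rotation (A s) \<theta> z) = (\<tau> [^]\<^bsub>Aut S\<^esub> e s) (P z)"
    "e 0 = 1" "e 1 = i" "e 2 = j" "[e 3 + (i + j + 1) = 0] (mod p)"
    "i \<in> {1..p - 1}" "j \<in> {1..p - 1}" "\<not> p dvd i + j + 1"
proof -
  note D = gimelD[OF G p]
  note S = D(1)
  interpret SG: group "Aut S" by (rule group_Aut[OF S])
  interpret DG: group "Aut unit_disc" by (rule group_Aut_unit_disc)
  obtain \<Gamma> \<Gamma>' \<alpha> \<beta> \<gamma> \<T> a b c where t: "(a, b, c) \<in> \<T>" and M: "fuchsian_model p S T \<Gamma> \<Gamma>'"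
    and C: "canonical_tiling p \<Gamma> \<alpha> \<beta> \<gamma> \<T>" and pt: "pair_of_tile p \<Gamma>' (a, b, c) i j"
    using pair unfolding associated_pair_def by (metis prod_cases3)
  define x y z where "x = hyp_rotation a \<theta>" and "y = hyp_rotation b \<theta>" and "z = hyp_rotation c \<theta>"
  note rot = canonical_tiling_rotations[OF C t, folded \<theta>_def, folded x_def y_def z_def]
  obtain d where d: "cmod d < 1" "hyp_rotation d \<theta> \<in> \<Gamma>"
    "\<And>w. cmod w < 1 \<Longrightarrow> hyp_rotation d \<theta> (x (y (z w))) = w"
    using rot(7) by blast
  have yc: "y \<in> \<Gamma>' #>\<^bsub>Aut unit_disc\<^esub> (x [^]\<^bsub>Aut unit_disc\<^esub> i)"
    and zc: "z \<in> \<Gamma>' #>\<^bsub>Aut unit_disc\<^esub> (x [^]\<^bsub>Aut unit_disc\<^esub> j)"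
    and ij: "i \<in> {1..p - 1}" "j \<in> {1..p - 1}" "\<not> p dvd i + j + 1"
    using pt unfolding pair_of_tile_def by (simp_all add: Let_def \<theta>_def x_def y_def z_def)
  obtain P where P: "holomorphic_map unit_disc S P" "P ` ball 0 1 = points S"
    "\<forall>a. cmod a < 1 \<longrightarrow> (\<exists>r>0. ball a r \<subseteq> ball 0 1 \<and> inj_on P (ball a r))"
    "\<forall>\<gamma>\<in>\<Gamma>. \<exists>t\<in>generate (Aut S) {T}. \<forall>z\<in>ball 0 1. P (\<gamma> z) = t (P z)"
    "\<forall>\<gamma>\<in>\<Gamma>'. \<forall>z\<in>ball 0 1. P (\<gamma> z) = P z" "\<Gamma>' \<subseteq> carrier (Aut unit_disc)"
    using fuchsian_model_projection[OF S M] .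
  have PS: "P w \<in> points S" if "cmod w < 1" for w using P(2) that by auto
  obtain \<tau> where \<tau>: "\<tau> \<in> generate (Aut S) {T}" and x\<tau>: "\<forall>w\<in>ball 0 1. P (x w) = \<tau> (P w)"
    using P(4)[rule_format, OF rot(4)] by blast
  have genc: "t \<in> carrier (Aut S)" if "t \<in> generate (Aut S) {T}" for t
    by (rule SG.generate_in_carrier[OF _ that]) (use D(3) in simp)
  have \<tau>c: "\<tau> \<in> carrier (Aut S)" by (rule genc[OF \<tau>])
  have xc: "x \<in> carrier (Aut unit_disc)" using Aut_hyp_rotation[OF rot(1)] by (simp add: x_def)
  have powc: "x [^]\<^bsub>Aut unit_disc\<^esub> n \<in> carrier (Aut unit_disc)" for n :: nat by (rule DG.nat_pow_closed[OF xc])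
  have \<tau>n: "\<tau> [^]\<^bsub>Aut S\<^esub> n \<in> carrier (Aut S)" for n :: nat by (rule SG.nat_pow_closed[OF \<tau>c])
  have xn: "P ((x [^]\<^bsub>Aut unit_disc\<^esub> n) w) = (\<tau> [^]\<^bsub>Aut S\<^esub> n) (P w)" if "cmod w < 1" for n :: nat and w
    using that
  proof (induction n arbitrary: w)
    case 0
    then show ?case
      using Aut_pow_Suc(2)[OF riemann_surface_unit_disc xc, of w] Aut_pow_Suc(2)[OF S \<tau>c PS[OF 0]] by simp
  next
    case (Suc n)
    have "cmod (x w) < 1" using Aut_unit_discD(5)[OF xc, of w] Suc.prems by simp
    from Suc.IH[OF this] show ?case
      using Aut_pow_Suc(1)[OF riemann_surface_unit_disc xc, of w n]
        Aut_pow_Suc(1)[OF S \<tau>c PS[OF Suc.prems], of n] x\<tau> Suc.prems by simp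
  qed
  \<comment> \<open>\<open>P\<close> is invariant under \<open>\<Gamma>'\<close>, so every element
    of the coset of the \<open>n\<close>-th power of \<open>x\<close> induces the
    \<open>n\<close>-th power of \<open>\<tau>\<close>.\<close>
  have coset: "P (v w) = (\<tau> [^]\<^bsub>Aut S\<^esub> n) (P w)"
    if v: "v \<in> \<Gamma>' #>\<^bsub>Aut unit_disc\<^esub> (x [^]\<^bsub>Aut unit_disc\<^esub> n)" and w: "cmod w < 1" for v w and n :: nat
  proof -
    obtain g where g: "g \<in> \<Gamma>'" "v = g \<otimes>\<^bsub>Aut unit_disc\<^esub> (x [^]\<^bsub>Aut unit_disc\<^esub> n)"
      using v by (auto simp: r_coset_def)
    have "(x [^]\<^bsub>Aut unit_disc\<^esub> n) w \<in> ball 0 1"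
      using Aut_unit_discD(5)[OF powc, of w] w by simp
    then show ?thesis
      using P(5)[rule_format, OF g(1)] xn[OF w] Aut_mult_apply[OF subsetD[OF P(6) g(1)] powc, of w] w by (simp add: g(2))
  qed
  \<comment> \<open>A natural number representing \<open>-(i + j + 1)\<close> modulo
    \<open>p\<close>, since the exponents \<open>e s\<close> are natural numbers.\<close>
  define m where "m = (p - 1) * (i + j + 1)"
  have m: "[m + (i + j + 1) = 0] (mod p)"
  proof -
    have "m + (i + j + 1) = p * (i + j + 1)"
      using prime_gt_0_nat[OF p] unfolding m_def by (cases p) simp_all
    then show ?thesis by (simp add: cong_0_iff)
  qed
  have dm: "P (hyp_rotation d \<theta> w) = (\<tau> [^]\<^bsub>Aut S\<^esub> m) (P w)" if w: "cmod w < 1" for w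
  proof -
    obtain t where t: "t \<in> generate (Aut S) {T}" "\<forall>w\<in>ball 0 1. P (hyp_rotation d \<theta> w) = t (P w)"
      using P(4)[rule_format, OF d(2)] by blast
    have tc: "t \<in> carrier (Aut S)" by (rule genc[OF t(1)])
    \<comment> \<open>The product of the rotations about \<open>d\<close>, \<open>a\<close>,
      \<open>b\<close>, \<open>c\<close> is the identity. Projected to \<open>S\<close>, this
      relation makes \<open>t\<close> the inverse of the power \<open>i + j + 1\<close> of
      \<open>\<tau>\<close>.\<close>
    have rel: "t ((\<tau> [^]\<^bsub>Aut S\<^esub> (i + j + 1)) (P w)) = P w" if w: "cmod w < 1" for w
    proof -
      have 1: "cmod (z w) < 1" using rot(3) w by (simp add: z_def)
      have 2: "cmod (y (z w)) < 1" using rot(2) 1 by (simp add: y_def)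
      have 3: "cmod (x (y (z w))) < 1" using rot(1) 2 by (simp add: x_def)
      have "P (x (y (z w))) = \<tau> ((\<tau> [^]\<^bsub>Aut S\<^esub> i) ((\<tau> [^]\<^bsub>Aut S\<^esub> j) (P w)))"
        using x\<tau> 2 coset[OF yc 1] coset[OF zc w] by simp
      also have "\<dots> = (\<tau> \<otimes>\<^bsub>Aut S\<^esub> ((\<tau> [^]\<^bsub>Aut S\<^esub> i) \<otimes>\<^bsub>Aut S\<^esub> (\<tau> [^]\<^bsub>Aut S\<^esub> j))) (P w)"
        using \<tau>c \<tau>n PS[OF w] by (simp add: Aut_mult_apply AutD(4))
      also have "\<tau> \<otimes>\<^bsub>Aut S\<^esub> ((\<tau> [^]\<^bsub>Aut S\<^esub> i) \<otimes>\<^bsub>Aut S\<^esub> (\<tau> [^]\<^bsub>Aut S\<^esub> j)) = \<tau> [^]\<^bsub>Aut S\<^esub> (i + j + 1)"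
        using \<tau>c SG.nat_pow_mult[OF \<tau>c, of 1 "i + j"] by (simp add: SG.nat_pow_mult)
      finally have e: "P (x (y (z w))) = (\<tau> [^]\<^bsub>Aut S\<^esub> (i + j + 1)) (P w)" .
      have "P (hyp_rotation d \<theta> (x (y (z w)))) = t (P (x (y (z w))))"
        using t(2) 3 by simp
      then show ?thesis unfolding e d(3)[OF w] by (rule sym)
    qed
    have "t \<otimes>\<^bsub>Aut S\<^esub> (\<tau> [^]\<^bsub>Aut S\<^esub> (i + j + 1)) = \<one>\<^bsub>Aut S\<^esub>"
    proof (rule Aut_ext)
      fix r assume r: "r \<in> points S"
      then obtain w where w: "cmod w < 1" "r = P w" using P(2) by (metis imageE mem_ball_0)
      show "(t \<otimes>\<^bsub>Aut S\<^esub> (\<tau> [^]\<^bsub>Aut S\<^esub> (i + j + 1))) r = \<one>\<^bsub>Aut S\<^esub> r"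
        unfolding Aut_mult_apply[OF tc \<tau>n r] Aut_one_apply[OF r] unfolding w(2) by (rule rel[OF w(1)])
    qed (rule SG.m_closed[OF tc \<tau>n] SG.one_closed)+
    moreover have "(\<tau> [^]\<^bsub>Aut S\<^esub> m) \<otimes>\<^bsub>Aut S\<^esub> (\<tau> [^]\<^bsub>Aut S\<^esub> (i + j + 1)) = \<one>\<^bsub>Aut S\<^esub>"
    proof -
      obtain n :: nat where n: "\<tau> = T [^]\<^bsub>Aut S\<^esub> n" using \<tau> D(7) by blast
      have "p dvd n * (m + (i + j + 1))" using m unfolding cong_0_iff by (rule dvd_mult)
      then show ?thesis
        unfolding n SG.nat_pow_pow[OF D(3)] SG.nat_pow_mult[OF D(3)] SG.pow_eq_id[OF D(3)] D(4)
        by (simp only: distrib_left)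
    qed
    ultimately have "t = \<tau> [^]\<^bsub>Aut S\<^esub> m"
      using tc \<tau>n SG.right_cancel by metis
    then show ?thesis using t(2) w by simp
  qed
  define A where "A = (\<lambda>s::nat. if s = 0 then a else if s = 1 then b else if s = 2 then c else d)"
  define e where "e = (\<lambda>s::nat. if s = 0 then 1 else if s = 1 then i else if s = 2 then j else m)"
  show ?thesis
  proof (rule that[of P \<tau> A e])
    show "\<forall>s<4. cmod (A s) < 1"
      using rot(1-3) d(1) by (simp add: A_def)
    have "P (hyp_rotation (A s) \<theta> w) = (\<tau> [^]\<^bsub>Aut S\<^esub> e s) (P w)" if "cmod w < 1" for s w
      using x\<tau> coset[OF yc that] coset[OF zc that] dm[OF that] that \<tau>c
      by (simp add: A_def e_def flip: x_def y_def z_def)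
    then show "\<forall>s<4. \<forall>z. cmod z < 1 \<longrightarrow> P (hyp_rotation (A s) \<theta> z) = (\<tau> [^]\<^bsub>Aut S\<^esub> e s) (P z)"
      by blast
  qed (use P(1,3) \<tau> m ij in \<open>simp_all add: e_def\<close>)
qed

text \<open>Phrased through carrier and multiplication of a second structure \<open>H\<close>,
  because \<open>Aut_Fix\<close> is \<open>Aut\<close> with its carrier replaced.\<close>

lemma (in group) cyclic_carrier_iso_integer_mod_group:
  assumes a: "a \<in> carrier G" and p: "ord a = p" "p > 0"
    and c: "carrier H = generate G {a}" and m: "\<And>x y. x \<in> generate G {a} \<Longrightarrow> y \<in> generate G {a} \<Longrightarrow> x \<otimes>\<^bsub>H\<^esub> y = x \<otimes> y"
    and H: "group H"
  shows "H \<cong> integer_mod_group p"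
proof -
  have gen: "generate G {a} = {a [^] k |k. k \<in> (UNIV :: nat set)}"
    by (rule generate_pow_nat[OF a]) (use p in simp)
  have "(\<lambda>n. a [^] nat n) \<in> iso (integer_mod_group p) H"
    unfolding iso_def
  proof (intro CollectI conjI homI)
    fix x y assume xy: "x \<in> carrier (integer_mod_group p)" "y \<in> carrier (integer_mod_group p)"
    then have nn: "0 \<le> x" "0 \<le> y" using p(2) by (auto simp: carrier_integer_mod_group)
    show "a [^] nat x \<in> carrier H" unfolding c gen by blast
    have "nat ((x + y) mod int p) = (nat x + nat y) mod p"
      using nn by (simp add: nat_mod_distrib nat_add_distrib)
    then have "a [^] nat ((x + y) mod int p) = a [^] (nat x + nat y)"
      by (simp add: nat_pow_eq_iff_cong[OF a] p(1) cong_def)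
    also have "\<dots> = a [^] nat x \<otimes> a [^] nat y" by (rule nat_pow_mult[OF a, symmetric])
    also have "\<dots> = a [^] nat x \<otimes>\<^bsub>H\<^esub> a [^] nat y" by (rule m[symmetric]) (auto simp: gen)
    finally show "a [^] nat (x \<otimes>\<^bsub>integer_mod_group p\<^esub> y) = a [^] nat x \<otimes>\<^bsub>H\<^esub> a [^] nat y" by simp
  next
    show "bij_betw (\<lambda>n. a [^] nat n) (carrier (integer_mod_group p)) (carrier H)"
      unfolding bij_betw_def
    proof
      show "inj_on (\<lambda>n. a [^] nat n) (carrier (integer_mod_group p))"
      proof (rule inj_onI)
        fix x y assume xy: "x \<in> carrier (integer_mod_group p)" "y \<in> carrier (integer_mod_group p)"
          "a [^] nat x = a [^] nat y"
        then have "[nat x = nat y] (mod p)" by (simp add: nat_pow_eq_iff_cong[OF a] p(1))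
        moreover have "nat x < p" "nat y < p" "0 \<le> x" "0 \<le> y"
          using xy(1,2) p(2) by (auto simp: carrier_integer_mod_group)
        ultimately show "x = y" using cong_less_modulus_unique_nat by (metis eq_nat_nat_iff)
      qed
      show "(\<lambda>n. a [^] nat n) ` carrier (integer_mod_group p) = carrier H"
      proof (intro equalityI subsetI)
        fix h assume "h \<in> carrier H"
        then obtain k :: nat where k: "h = a [^] k" unfolding c gen by blast
        have "h = a [^] nat (int (k mod p))"
          by (simp add: k nat_pow_eq_iff_cong[OF a] p(1) cong_def)
        moreover have "int (k mod p) \<in> carrier (integer_mod_group p)"
          using p(2) by (simp add: carrier_integer_mod_group)
        ultimately show "h \<in> (\<lambda>n. a [^] nat n) ` carrier (integer_mod_group p)" by blast
      qed (auto simp: c gen)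
    qed
  qed
  then have "integer_mod_group p \<cong> H" by (rule is_isoI)
  then show ?thesis by (rule group.iso_sym[OF group_integer_mod_group])
qed

lemma kappa6_Aut_Fix_subset:
  assumes p: "prime p" "odd p" and G: "gimel p S T" and pair: "associated_pair p S T i j"
    and \<kappa>: "kappa6 p i j" and f: "f \<in> carrier (Aut S)" "f ` Fix S T = Fix S T"
  shows "f \<in> generate (Aut S) {T}"
proof -
  note D = gimelD[OF G p(1)]
  note S = D(1)
  interpret group "Aut S" by (rule group_Aut[OF S])
  define \<theta> where "\<theta> = 2 * pi / real p"
  obtain P \<tau> and A :: "nat \<Rightarrow> complex" and e :: "nat \<Rightarrow> nat"
    where hP: "holomorphic_map unit_disc S P"
    and inj: "\<forall>a. cmod a < 1 \<longrightarrow> (\<exists>r>0. ball a r \<subseteq> ball 0 1 \<and> inj_on P (ball a r))"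
    and \<tau>: "\<tau> \<in> generate (Aut S) {T}"
    and A: "\<forall>s<4. cmod (A s) < 1"
    and rot: "\<forall>s<4. \<forall>z. cmod z < 1 \<longrightarrow> P (hyp_rotation (A s) \<theta> z) = (\<tau> [^]\<^bsub>Aut S\<^esub> e s) (P z)"
    and e: "e 0 = 1" "e 1 = i" "e 2 = j" "[e 3 + (i + j + 1) = 0] (mod p)"
    and ij: "i \<in> {1..p - 1}" "j \<in> {1..p - 1}" "\<not> p dvd i + j + 1"
    using associated_pair_vertices[OF p(1) G pair, folded \<theta>_def] .
  note inj = inj[rule_format] and A = A[rule_format] and rot = rot[rule_format]
  obtain n :: nat where n: "\<tau> = T [^]\<^bsub>Aut S\<^esub> n" using \<tau> D(7) by blast
  have \<tau>e: "\<tau> [^]\<^bsub>Aut S\<^esub> k = T [^]\<^bsub>Aut S\<^esub> (n * k)" for k :: nat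
    unfolding n by (rule nat_pow_pow[OF D(3)])
  have gen: "T [^]\<^bsub>Aut S\<^esub> k \<in> generate (Aut S) {T}" for k :: nat using D(7) by blast
  have Tc: "T [^]\<^bsub>Aut S\<^esub> k \<in> carrier (Aut S)" for k :: nat by (rule nat_pow_closed[OF D(3)])
  have PS: "P z \<in> points S" if "cmod z < 1" for z
    using continuous_map_in_topspace[OF holomorphic_map_continuous[OF hP]] that by simp
  define v where "v = (\<lambda>s. P (A s))"
  have vS: "v s \<in> points S" if "s < 4" for s using PS A that by (simp add: v_def)
  have mult: "has_multiplier S (T [^]\<^bsub>Aut S\<^esub> (n * e s)) (v s) (cis \<theta>)" if s: "s < 4" for s
  proof -
    obtain r where r: "0 < r" "ball (A s) r \<subseteq> ball 0 1" "inj_on P (ball (A s) r)"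
      using inj[OF A[OF s]] by blast
    show ?thesis
      unfolding v_def \<tau>e[symmetric]
      by (rule rotation_multiplier[OF S hP A[OF s] r(1,3,2) _ rot[OF s]]) (simp_all add: \<tau>e Tc)
  qed
  note unique = multiplier_determines_power[OF S _ D(3) p(1) D(4), folded \<theta>_def]
  \<comment> \<open>\<open>\<tau>\<close> is nontrivial because its multiplier at \<open>v 0\<close>
    is not 1. Hence it generates the group of \<open>T\<close>, and its powers correspond exactly to
    exponents modulo \<open>p\<close>.\<close>
  have nn: "\<not> p dvd n"
  proof
    assume "p dvd n"
    then have "T [^]\<^bsub>Aut S\<^esub> (n * e 0) = T [^]\<^bsub>Aut S\<^esub> (0::nat)"
      unfolding nat_pow_eq_iff_cong[OF D(3)] by (simp add: D(4) cong_0_iff)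
    then have "has_multiplier S \<one>\<^bsub>Aut S\<^esub> (v 0) (cis \<theta>)" using mult[of 0] by simp
    then have "cis \<theta> = 1"
      using has_multiplier_unique[OF S vS[of 0] _ has_multiplier_one[OF S vS[of 0]]] by simp
    then show False
      using cis_root_power_eq[OF prime_gt_1_nat[OF p(1)], of 0] prime_gt_1_nat[OF p(1)]
      by (simp add: \<theta>_def cong_def)
  qed
  have cop: "coprime n p" using nn p(1) by (metis prime_imp_coprime coprime_commute)
  have pow_eq: "T [^]\<^bsub>Aut S\<^esub> (n * k) = T [^]\<^bsub>Aut S\<^esub> (n * k') \<longleftrightarrow> [k = k'] (mod p)" for k k' :: nat
    unfolding nat_pow_eq_iff_cong[OF D(3)] D(4) by (rule cong_mult_lcancel_nat[OF cop])
  define k where "k = - (int i + int j + 1)"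
  have e3: "[int (e 3) = k] (mod int p)"
  proof -
    have "[int (e 3 + (i + j + 1)) = int 0] (mod int p)" using e(4) by (simp only: cong_int_iff)
    then show ?thesis by (simp add: cong_iff_dvd_diff k_def algebra_simps)
  qed
  note res = kappa6_residues[OF p \<kappa> ij, folded k_def]
  have less4: "s = 0 \<or> s = 1 \<or> s = 2 \<or> s = 3" if "s < 4" for s :: nat using that by auto
  \<comment> \<open>\<open>e 3\<close> is a natural number representing \<open>k\<close>; this moves
    congruences from one to the other.\<close>
  have ek: "[int (e 3) = x] (mod int p) \<longleftrightarrow> [k = x] (mod int p)"
    "[x = int (e 3)] (mod int p) \<longleftrightarrow> [x = k] (mod int p)" for x
    using e3 by (meson cong_sym cong_trans)+
  have dist: "s = r" if "s < 4" "r < 4" "[int (e s) = int (e r)] (mod int p)" for s r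
    using less4[OF that(1)] less4[OF that(2)] that(3) res(1-6)
    by (auto simp: e(1) e(2)[simplified] e(3) ek cong_sym_eq)
  have m1: "\<not> [int (e s) = -1] (mod int p)" if "s < 4" for s
  proof -
    \<comment> \<open>The residue 1 of the first vertex differs from -1 because \<open>p\<close> is
      odd.\<close>
    have "\<not> [1 = (-1::int)] (mod int p)"
    proof
      assume "[1 = (-1::int)] (mod int p)"
      then have "int p dvd int 2" by (simp add: cong_iff_dvd_diff)
      then have "p dvd 2" by (simp only: int_dvd_int_iff)
      then have "p = 2" by (rule primes_dvd_imp_eq[OF p(1) two_is_prime_nat])
      then show False using p(2) by simp
    qed
    then show ?thesis using less4[OF that] res(7-9) by (auto simp: e(1) e(2)[simplified] e(3) ek)
  qed
  have nz: "\<not> int p dvd int (e s)" if "s < 4" for s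
  proof -
    have "\<not> p dvd e 3"
    proof
      assume "p dvd e 3"
      moreover have "p dvd e 3 + (i + j + 1)" using e(4) by (simp add: cong_0_iff)
      ultimately have "p dvd i + j + 1" using dvd_add_right_iff by blast
      then show False using ij(3) by blast
    qed
    moreover have "\<not> p dvd i" "\<not> p dvd j" "\<not> p dvd 1"
      using ij prime_gt_1_nat[OF p(1)] by (auto dest: dvd_imp_le)
    ultimately show ?thesis using less4[OF that] unfolding int_dvd_int_iff
      by (auto simp: e(1) e(2)[simplified] e(3))
  qed
  \<comment> \<open>At a given point only one power of \<open>T\<close> has multiplier
    \<open>cis \<theta>\<close>, so different residues belong to different points.\<close>
  have vinj: "s = r" if "s < 4" "r < 4" "v s = v r" for s r
  proof -
    have "T [^]\<^bsub>Aut S\<^esub> (n * e s) = T [^]\<^bsub>Aut S\<^esub> (n * e r)"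
      by (rule unique[OF vS[OF that(1)] gen gen mult[OF that(1)]]) (use mult[OF that(2)] that(3) in simp)
    then have "[int (e s) = int (e r)] (mod int p)" by (simp add: pow_eq cong_int_iff)
    then show ?thesis using dist that by blast
  qed
  have vF: "v s \<in> Fix S T" if s: "s < 4" for s
  proof -
    have "(T [^]\<^bsub>Aut S\<^esub> (n * e s)) (v s) = v s" using has_multiplier_fix[OF mult[OF s]] .
    moreover have "\<not> p dvd n * e s"
      using nn nz[OF s] p(1) by (simp add: prime_dvd_mult_iff int_dvd_int_iff)
    ultimately have "T (v s) = v s" by (rule Aut_pow_fix_prime[OF S D(3) vS[OF s] p(1) D(4)])
    then show ?thesis using vS[OF s] by (simp add: Fix_def)
  qed
  \<comment> \<open>The four points \<open>v s\<close> are distinct and fixed by \<open>T\<close>,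
    which has exactly four fixed points.\<close>
  have Fix_eq: "Fix S T = v ` {..<4}"
  proof (rule card_subset_eq[OF D(6), symmetric])
    show "v ` {..<4} \<subseteq> Fix S T" using vF by auto
    have "inj_on v {..<4}" using vinj by (auto simp: inj_on_def)
    then show "card (v ` {..<4}) = card (Fix S T)" using D(5) by (simp add: card_image)
  qed
  have three: "g \<in> generate (Aut S) {T}" if g: "g \<in> carrier (Aut S)" "\<And>x. x \<in> Fix S T \<Longrightarrow> g x = x" for g
  proof (rule gimel_fixing_three[OF p(1) G g(1)])
    show "v 0 \<in> Fix S T" "v 1 \<in> Fix S T" "v 2 \<in> Fix S T" by (rule vF, simp)+
    show "v 0 \<noteq> v 1" "v 0 \<noteq> v 2" "v 1 \<noteq> v 2"
      using vinj[of 0 1] vinj[of 0 2] vinj[of 1 2] by auto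
    show "g (v 0) = v 0" "g (v 1) = v 1" "g (v 2) = v 2" by (rule g(2)[OF vF], simp)+
  qed
  define F where "F = inv\<^bsub>Aut S\<^esub> f"
  have Fc: "F \<in> carrier (Aut S)" using f(1) by (simp add: F_def)
  have Ff: "F (f x) = x" if "x \<in> points S" for x
    using Aut_mult_apply[OF Fc f(1) that] Aut_one_apply[OF that] f(1) by (simp add: F_def)
  define conj where "conj = (\<lambda>t. f \<otimes>\<^bsub>Aut S\<^esub> t \<otimes>\<^bsub>Aut S\<^esub> F)"
  have conjc: "conj t \<in> carrier (Aut S)" if "t \<in> carrier (Aut S)" for t
    using that f(1) Fc by (simp add: conj_def)
  have conj_apply: "conj t (f x) = f (t x)" if "t \<in> carrier (Aut S)" "x \<in> points S" for t x
    using that f(1) Fc by (simp add: conj_def Aut_mult_apply AutD(4) Ff)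
  have conj_pow: "conj (T [^]\<^bsub>Aut S\<^esub> k) = conj T [^]\<^bsub>Aut S\<^esub> k" for k :: nat
  proof (induction k)
    case 0
    then show ?case using f(1) by (simp add: conj_def F_def)
  next
    case (Suc k)
    have "conj T [^]\<^bsub>Aut S\<^esub> Suc k = conj (T [^]\<^bsub>Aut S\<^esub> k) \<otimes>\<^bsub>Aut S\<^esub> conj T" using Suc by simp
    also have "\<dots> = conj (T [^]\<^bsub>Aut S\<^esub> k \<otimes>\<^bsub>Aut S\<^esub> T)"
    proof -
      have "F \<otimes>\<^bsub>Aut S\<^esub> (f \<otimes>\<^bsub>Aut S\<^esub> (T \<otimes>\<^bsub>Aut S\<^esub> F)) = T \<otimes>\<^bsub>Aut S\<^esub> F"
        using f(1) D(3) Fc by (simp add: F_def m_assoc[symmetric])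
      then show ?thesis using f(1) D(3) Fc Tc[of k] by (simp add: conj_def m_assoc)
    qed
    finally show ?case by simp
  qed
  have "conj T \<in> generate (Aut S) {T}"
  proof (rule three[OF conjc[OF D(3)]])
    fix x assume "x \<in> Fix S T"
    then obtain y where y: "y \<in> Fix S T" "x = f y" using f(2) by blast
    then show "conj T x = x" using conj_apply[OF D(3), of y] by (simp add: Fix_def)
  qed
  then obtain l :: nat where l: "conj T = T [^]\<^bsub>Aut S\<^esub> l" using D(7) by blast
  have perm: "\<exists>r<4. f (v s) = v r \<and> [l * e s = e r] (mod p)" if s: "s < 4" for s
  proof -
    have "f (v s) \<in> Fix S T" using f(2) vF[OF s] by blast
    then obtain r where r: "r < 4" "f (v s) = v r" unfolding Fix_eq by auto
    obtain \<rho> where \<rho>: "0 < \<rho>" "ball (A s) \<rho> \<subseteq> ball 0 1" "inj_on P (ball (A s) \<rho>)"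
      using inj[OF A[OF s]] by blast
    \<comment> \<open>Instead of differentiating the conjugate by the chain rule, the projection is
      changed: \<open>f \<circ> P\<close> is again holomorphic and locally injective, and it turns
      the rotation about \<open>A s\<close> into the conjugate by \<open>f\<close> of the power
      belonging to \<open>s\<close>.\<close>
    have hfP: "holomorphic_map unit_disc S (f \<circ> P)"
      by (rule holomorphic_map_compose[OF riemann_surface_unit_disc S riemann_surface_open_charts[OF S] hP AutD(3)[OF f(1)]])
    have inj': "inj_on (f \<circ> P) (ball (A s) \<rho>)"
    proof (rule comp_inj_on[OF \<rho>(3)])
      have "P ` ball (A s) \<rho> \<subseteq> points S" using PS \<rho>(2) by force
      then show "inj_on f (P ` ball (A s) \<rho>)"
        using AutD(2)[OF f(1)] by (meson bij_betw_def inj_on_subset)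
    qed
    have "has_multiplier S (conj (T [^]\<^bsub>Aut S\<^esub> (n * e s))) ((f \<circ> P) (A s)) (cis \<theta>)"
    proof (rule rotation_multiplier[OF S hfP A[OF s] \<rho>(1) inj' \<rho>(2) conjc[OF Tc]])
      fix w assume w: "cmod w < 1"
      show "(f \<circ> P) (hyp_rotation (A s) \<theta> w) = conj (T [^]\<^bsub>Aut S\<^esub> (n * e s)) ((f \<circ> P) w)"
        using rot[OF s w] conj_apply[OF Tc PS[OF w]] by (simp add: \<tau>e)
    qed
    moreover have "conj (T [^]\<^bsub>Aut S\<^esub> (n * e s)) = T [^]\<^bsub>Aut S\<^esub> (n * (l * e s))"
      unfolding conj_pow l nat_pow_pow[OF D(3)] by (simp add: mult_ac)
    ultimately have "has_multiplier S (T [^]\<^bsub>Aut S\<^esub> (n * (l * e s))) (v r) (cis \<theta>)"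
      using r(2) by (simp add: v_def)
    then have "T [^]\<^bsub>Aut S\<^esub> (n * (l * e s)) = T [^]\<^bsub>Aut S\<^esub> (n * e r)"
      by (rule unique[OF vS[OF r(1)] gen gen _ mult[OF r(1)]])
    then have "[l * e s = e r] (mod p)" by (simp add: pow_eq)
    then show ?thesis using r by blast
  qed
  have pq: "prime (int p)" using p(1) by simp
  have l1: "[int l = 1] (mod int p)"
  proof (rule four_residues_closed[OF pq, of "\<lambda>s. int (e s)"])
    show "\<exists>r<4. [int l * int (e s) = int (e r)] (mod int p)" if "s < 4" for s
      using perm[OF that] by (metis cong_int_iff of_nat_mult)
  qed (use dist nz m1 e(1) in simp_all)
  show ?thesis
  proof (rule three[OF f(1)])
    fix x assume "x \<in> Fix S T"
    then obtain s where s: "s < 4" "x = v s" unfolding Fix_eq by auto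
    obtain r where r: "r < 4" "f (v s) = v r" "[l * e s = e r] (mod p)" using perm[OF s(1)] by blast
    \<comment> \<open>With \<open>l\<close> equal to 1 modulo \<open>p\<close>, the residues
      attached to \<open>v s\<close> and to its image agree, and the residues are distinct.\<close>
    have "[int l * int (e s) = int (e r)] (mod int p)" using r(3) by (metis cong_int_iff of_nat_mult)
    moreover have "[int l * int (e s) = 1 * int (e s)] (mod int p)" by (rule cong_scalar_right[OF l1])
    ultimately have "[int (e s) = int (e r)] (mod int p)" by (metis cong_sym cong_trans mult_1)
    then have "s = r" by (rule dist[OF s(1) r(1)])
    then show "f x = x" using r(2) s(2) by simp
  qed
qed

theorem proposition9p6:
  fixes p :: nat and S :: "'a rsurface" and T :: "'a \<Rightarrow> 'a" and i j :: nat
  assumes "prime p" and "odd p"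
    and "gimel p S T"
    and "associated_pair p S T i j"
    and "kappa6 p i j"
  shows "Aut_Fix S T \<cong> integer_mod_group p"
proof -
  note D = gimelD[OF assms(3,1)]
  interpret group "Aut S" by (rule group_Aut[OF D(1)])
  have sub: "subgroup (generate (Aut S) {T}) (Aut S)"
    by (rule generate_is_subgroup) (use D(3) in simp)
  have "f ` Fix S T = Fix S T" if f: "f \<in> generate (Aut S) {T}" for f
  proof -
    obtain n :: nat where n: "f = T [^]\<^bsub>Aut S\<^esub> n" using f D(7) by blast
    have "f x = x" if "x \<in> Fix S T" for x
      using that Aut_pow_fix[OF D(1,3), of x n] by (simp add: n Fix_def)
    then show ?thesis by force
  qed
  then have c: "{f \<in> carrier (Aut S). f ` Fix S T = Fix S T} = generate (Aut S) {T}"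
    using kappa6_Aut_Fix_subset[OF assms] subgroup.subset[OF sub] by blast
  show ?thesis
  proof (rule cyclic_carrier_iso_integer_mod_group[OF D(3,4)])
    show "p > 0" using assms(1) by (rule prime_gt_0_nat)
    show "carrier (Aut_Fix S T) = generate (Aut S) {T}" by (simp add: Aut_Fix_def c)
    show "x \<otimes>\<^bsub>Aut_Fix S T\<^esub> y = x \<otimes>\<^bsub>Aut S\<^esub> y" for x y by (simp add: Aut_Fix_def)
    show "group (Aut_Fix S T)"
      using subgroup.subgroup_is_group[OF sub group_Aut[OF D(1)]] by (simp add: Aut_Fix_def c)
  qed
qed

end
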